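(* Let $G$ be a finite group, $p$ a prime, and $P$ a normal $p$-subgroup of $G$. Suppose that there is a power $d$ of $p$ with $1<d<|P|$ such that: (1) every subgroup of $P$ of order $d$ satisfies the $IC$-$\Pi$-property in $G$; (2) if $p=d=2$ and $P$ is non-abelian, then in addition every cyclic subgroup of $P$ of order $4$ satisfies the $IC$-$\Pi$-property in $G$. Then $P\le Z_{\mathfrak{U}}(G)$.
   Context: All groups are finite and $p$ is a fixed prime. For a group $A$, $\pi(A)$ denotes the set of prime divisors of $|A|$; for a set $\pi$ of primes, a $\pi$-number is a positive integer all of whose prime divisors lie in $\pi$ (so $1$ is always a $\pi$-number). $\Pi$-property: a subgroup $H$ of $G$ satisfies the $\Pi$-property in $G$ if for every chief factor $L/K$ of $G$, the index $|G/K:N_{G/K}(HK/K\cap L/K)|$ is a $\pi(HK/K\cap L/K)$-number. $IC$-$\Pi$-property: a subgroup $H$ of $G$ satisfies the $IC$-$\Pi$-property in $G$ if the subgroup $H\cap[H,G]$ satisfies the $\Pi$-property in $G$, where $[H,G]$ is the commutator subgroup generated by all $[h,g]$, $h\in H$, $g\in G$. $\mathfrak{U}$-hypercenter: $Z_{\mathfrak{U}}(G)$ is the product of all normal subgroups $A$ of $G$ such that every chief factor $L/K$ of $G$ with $L\le A$ is cyclic. *)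

theory Defs
  imports "HOL-Algebra.Algebra" "HOL-Computational_Algebra.Primes"
begin

(* L/K as a set of cosets; it is a subgroup of G Mod K whenever K <= L <= G with K normal in G. *)
definition subgroup_quotient :: "('a, 'b) monoid_scheme \<Rightarrow> 'a set \<Rightarrow> 'a set \<Rightarrow> 'a set set"
  where "subgroup_quotient G L K = carrier (G\<lparr>carrier := L\<rparr> Mod K)"

definition minimal_normal :: "('a, 'b) monoid_scheme \<Rightarrow> 'a set \<Rightarrow> bool"
  where "minimal_normal G N \<longleftrightarrow>
    N \<lhd> G \<and> N \<noteq> {\<one>\<^bsub>G\<^esub>} \<and> (\<forall>M. M \<lhd> G \<and> M \<subseteq> N \<longrightarrow> M = {\<one>\<^bsub>G\<^esub>} \<or> M = N)"

definition chief_factor :: "('a, 'b) monoid_scheme \<Rightarrow> 'a set \<Rightarrow> 'a set \<Rightarrow> bool"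
  where "chief_factor G L K \<longleftrightarrow>
    L \<lhd> G \<and> K \<lhd> G \<and> K \<subseteq> L \<and> minimal_normal (G Mod K) (subgroup_quotient G L K)"

definition pi_number :: "nat set \<Rightarrow> nat \<Rightarrow> bool"
  where "pi_number \<pi> n \<longleftrightarrow> n > 0 \<and> prime_factors n \<subseteq> \<pi>"

definition Pi_property :: "('a, 'b) monoid_scheme \<Rightarrow> 'a set \<Rightarrow> bool"
  where "Pi_property G H \<longleftrightarrow>
    (\<forall>L K. chief_factor G L K \<longrightarrow>
      (let I = subgroup_quotient G (H <#>\<^bsub>G\<^esub> K) K \<inter> subgroup_quotient G L K
       in pi_number (prime_factors (card I))
            (card (rcosets\<^bsub>G Mod K\<^esub> (normalizer (G Mod K) I)))))"

(* Convention [h,g] = h^-1 g^-1 h g.  For subgroups H and K the convention h g h^-1 g^-1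
   generates the same subgroup, since both H and K are closed under inverses. *)
definition commutator_subgroup :: "('a, 'b) monoid_scheme \<Rightarrow> 'a set \<Rightarrow> 'a set \<Rightarrow> 'a set"
  where "commutator_subgroup G H K =
    generate G {(inv\<^bsub>G\<^esub> h) \<otimes>\<^bsub>G\<^esub> (inv\<^bsub>G\<^esub> g) \<otimes>\<^bsub>G\<^esub> h \<otimes>\<^bsub>G\<^esub> g | h g. h \<in> H \<and> g \<in> K}"

definition IC_Pi_property :: "('a, 'b) monoid_scheme \<Rightarrow> 'a set \<Rightarrow> bool"
  where "IC_Pi_property G H \<longleftrightarrow> Pi_property G (H \<inter> commutator_subgroup G H (carrier G))"

(* The product of a family of normal subgroups is the subgroup generated by their union. *)
definition U_hypercenter :: "('a, 'b) monoid_scheme \<Rightarrow> 'a set"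
  where "U_hypercenter G =
    generate G (\<Union>{A. A \<lhd> G \<and>
      (\<forall>L K. chief_factor G L K \<and> L \<subseteq> A \<longrightarrow> cyclic_group (G\<lparr>carrier := L\<rparr> Mod K))})"

end

theory Submission
  imports Defs
begin

text \<open>
  Let \<open>S\<close> be a Sylow \<open>p\<close>-subgroup of \<open>G\<close>. If \<open>H\<close> satisfies the \<open>\<Pi>\<close>-property, \<open>L/K\<close> is a chief factor
  below \<open>P\<close> and \<open>S\<close> normalizes \<open>HK \<inter> L\<close>, then \<open>HK \<inter> L\<close> is normal in \<open>G\<close>, hence equal to \<open>K\<close> or \<open>L\<close>.
  So one has to find, for a noncyclic (\<^emph>\<open>bad\<close>) chief factor \<open>L/K\<close> below \<open>P\<close>, a subgroup \<open>H\<close> of order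
  \<open>d\<close> cutting out a proper nontrivial \<open>S\<close>-invariant subgroup of \<open>L/K\<close>.

  If \<open>L\<close> is minimal with a bad chief factor \<open>L/K\<close>, then \<open>[L,K] = 1\<close> and \<open>L\<close> has exponent \<open>p\<close> (or \<open>4\<close>):
  otherwise a commutator map or a power map carries \<open>L/K\<close> to a bad chief factor of smaller order.
  With such elements of small order one gets \<open>|L| \<le> d\<close>. Now let \<open>L/K\<close> be bad with \<open>|L| \<le> d\<close> as large as
  possible. One finds a normal \<open>M \<ge> L\<close> with \<open>|M| = p d\<close>, and maximality of \<open>|L|\<close> together with the
  same transfer of bad chief factors shows that \<open>M/K\<close> is elementary abelian. Then a complement
  argument in \<open>M/K\<close> produces the subgroup \<open>H\<close> that meets \<open>L\<close> in an \<open>S\<close>-invariant hyperplane.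
\<close>

section \<open>Fixed points of \<open>p\<close>-groups\<close>

text \<open>The property concerns \<open>H \<inter> [H,G]\<close> rather than \<open>H\<close>, so
  \<open>H\<close> has to be chosen such that this intersection keeps what \<open>H\<close> cuts
  out. Noncyclicity helps: if \<open>L/K\<close> is bad and \<open>t\<close> lies in
  \<open>L\<close> but not in \<open>K\<close>, then \<open>[t,G]\<close> is not contained in
  \<open>K\<close>, since otherwise \<open>K\<close> and \<open>t\<close> would generate a normal
  subgroup. Hence \<open>[H,G]K\<close> contains \<open>L\<close> as soon as \<open>H\<close> meets
  \<open>L\<close> outside \<open>K\<close>, and if \<open>K\<close> is contained in
  \<open>H\<close> the modular law does the rest. If the order of \<open>K\<close> is at least
  \<open>d\<close>, a suitable element \<open>t\<close> of \<open>H\<close> has to lie in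
  \<open>[H,G]\<close> itself. This is achieved by taking \<open>t\<close> in a normal subgroup that
  is minimal among those not contained in \<open>K\<close>; then the order of \<open>t\<close>
  matters, and with it the exponent \<open>p\<close> or 4. Subgroups of order 4 enter because
  squaring on a nonabelian 2-group is not multiplicative, while the fourth power is, when
  commutators are central with trivial square. There is no induction on the order of
  \<open>G\<close>: all arguments compare sections of \<open>P\<close> inside the fixed
  group.\<close>

context group
begin

lemma inv_cancel:
  assumes "x \<in> carrier G" "y \<in> carrier G"
  shows "inv x \<otimes> (x \<otimes> y) = y" "x \<otimes> (inv x \<otimes> y) = y"
  using assms by (simp_all add: m_assoc[symmetric])

lemmas word_simps = m_assoc inv_mult_group inv_cancel

lemma subgroup_finiteI:
  assumes fin: "finite (carrier G)" and D: "D \<subseteq> carrier G" "\<one> \<in> D"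
    and closed: "\<And>x y. x \<in> D \<Longrightarrow> y \<in> D \<Longrightarrow> x \<otimes> y \<in> D"
  shows "subgroup D G"
proof (rule subgroupI)
  fix x assume x: "x \<in> D"
  have pow: "x [^] (n::nat) \<in> D" for n
    by (induction n) (use x D closed in auto)
  have xc: "x \<in> carrier G" using x D by blast
  have "order G > 0" using fin order_gt_0_iff_finite by blast
  then have "x [^] (order G - 1) \<otimes> x = x [^] order G"
    by (metis Suc_diff_1 nat_pow_Suc)
  also have "\<dots> = \<one>" using pow_order_eq_1 xc by simp
  finally have "inv x = x [^] (order G - 1)"
    using inv_equality xc by simp
  then show "inv x \<in> D" using pow by simp
qed (use D closed in auto)

lemma conj_nat_pow:
  assumes "s \<in> carrier G" "x \<in> carrier G"
  shows "s \<otimes> x [^] (n::nat) \<otimes> inv s = (s \<otimes> x \<otimes> inv s) [^] n"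
proof (induction n)
  case (Suc n)
  have "s \<otimes> x [^] Suc n \<otimes> inv s = (s \<otimes> x [^] n \<otimes> inv s) \<otimes> (s \<otimes> x \<otimes> inv s)"
    using assms by (simp add: word_simps)
  then show ?case using Suc assms by simp
qed (use assms in simp)

end

text \<open>The fixed points of an action of a \<open>p\<close>-group are counted modulo \<open>p\<close>
  by its orbits.\<close>

lemma (in group_action) p_group_fixed_point:
  assumes p: "Factorial_Ring.prime (p::nat)" and order: "order G = p ^ a" and fin: "finite E"
    and dvd: "p dvd card E" and x0: "x0 \<in> E" "\<And>s. s \<in> carrier G \<Longrightarrow> \<phi> s x0 = x0"
  shows "\<exists>x\<in>E. x \<noteq> x0 \<and> (\<forall>s\<in>carrier G. \<phi> s x = x)"
proof (rule ccontr)
  assume no: "\<not> ?thesis"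
  have grp: "group G" using group_hom group_hom.axioms(1) by blast
  have orb0: "orbit G \<phi> x0 = {x0}"
  proof -
    have "\<one> \<in> carrier G" using grp group.is_monoid monoid.one_closed by blast
    then show ?thesis using x0 unfolding orbit_def by force
  qed
  let ?C = "orbits G E \<phi> - {{x0}}"
  have mem: "{x0} \<in> orbits G E \<phi>" using orb0 x0 unfolding orbits_def by force
  have "\<Union>?C = E - {x0}"
  proof -
    have "c \<inter> {x0} = {}" if "c \<in> ?C" for c using that disjoint_union[OF _ mem, of c] by auto
    then show ?thesis using orbits_coverture mem by blast
  qed
  moreover have "p dvd card c" if c: "c \<in> ?C" for c
  proof -
    obtain x where x: "x \<in> E" "c = orbit G \<phi> x" using c unfolding orbits_def by auto
    have cE: "c \<subseteq> E" using c orbits_coverture by blast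
    have xc: "x \<in> c" using orbit_refl x by blast
    have ne: "x \<noteq> x0" using c x orb0 by auto
    then obtain s where s: "s \<in> carrier G" "\<phi> s x \<noteq> x" using no x by auto
    then have "{x, \<phi> s x} \<subseteq> c" using xc x unfolding orbit_def by auto
    moreover have "finite c" using cE fin finite_subset by blast
    ultimately have "card c \<noteq> 1" using s by (metis card_1_singletonE insert_subset singletonD)
    moreover have "card c dvd p ^ a"
      using orbit_stabilizer_theorem[OF x(1)] order x by (metis dvd_triv_left)
    then obtain k where "card c = p ^ k" using p divides_primepow_nat by blast
    ultimately show ?thesis by (cases k) auto
  qed
  moreover have "c \<inter> c' = {}" if "c \<in> ?C" "c' \<in> ?C" "c \<noteq> c'" for c c'
    using that disjoint_union by blast
  ultimately have "p dvd card (E - {x0})"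
    using dvd_partition[of ?C p] fin by (metis finite_Diff)
  moreover have "card E = Suc (card (E - {x0}))" using card.remove fin x0 by metis
  ultimately have "p dvd 1" using dvd dvd_add_right_iff[of p _ 1] by (metis Suc_eq_plus1)
  then show False using p not_prime_unit by blast
qed

text \<open>Applies to maps known only through their action laws on \<open>E\<close>. Elements of
  \<open>BijGroup E\<close> are extensional, which is why \<open>f s\<close> is restricted to
  \<open>E\<close> before it becomes an action.\<close>

lemma (in group) p_group_fixed_point:
  assumes p: "Factorial_Ring.prime (p::nat)" and S: "subgroup S G" "card S = p ^ a"
    and fin: "finite E" and dvd: "p dvd card E"
    and closed: "\<And>s x. s \<in> S \<Longrightarrow> x \<in> E \<Longrightarrow> f s x \<in> E"
    and one: "\<And>x. x \<in> E \<Longrightarrow> f \<one> x = x"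
    and mult: "\<And>s t x. s \<in> S \<Longrightarrow> t \<in> S \<Longrightarrow> x \<in> E \<Longrightarrow> f (s \<otimes> t) x = f s (f t x)"
    and x0: "x0 \<in> E" "\<And>s. s \<in> S \<Longrightarrow> f s x0 = x0"
  shows "\<exists>x\<in>E. x \<noteq> x0 \<and> (\<forall>s\<in>S. f s x = x)"
proof -
  interpret S: subgroup S G by fact
  let ?S = "G\<lparr>carrier := S\<rparr>" and ?f = "\<lambda>s. \<lambda>x\<in>E. f s x"
  have grp: "group ?S" using S.subgroup_is_group group_axioms by blast
  have bij: "bij_betw (f s) E E" if s: "s \<in> S" for s
  proof (rule bij_betw_byWitness[where f' = "f (inv s)"])
    show "\<forall>x\<in>E. f (inv s) (f s x) = x" "\<forall>x\<in>E. f s (f (inv s) x) = x"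
      using mult[symmetric] one s by auto
  qed (use closed s in auto)
  have "?f \<in> hom ?S (BijGroup E)"
  proof (rule homI)
    show "?f s \<in> carrier (BijGroup E)" if "s \<in> carrier ?S" for s
    proof -
      have "bij_betw (?f s) E E" using bij that by (simp cong: bij_betw_cong)
      then show ?thesis by (simp add: BijGroup_def Bij_def)
    qed
  next
    fix s t assume "s \<in> carrier ?S" "t \<in> carrier ?S"
    then have st: "s \<in> S" "t \<in> S" by auto
    have B: "?f u \<in> Bij E" if "u \<in> S" for u
      using bij[OF that] by (simp add: Bij_def cong: bij_betw_cong)
    show "?f (s \<otimes>\<^bsub>?S\<^esub> t) = ?f s \<otimes>\<^bsub>BijGroup E\<^esub> ?f t"
      using st B mult closed by (auto simp: BijGroup_def compose_def restrict_def)
  qed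
  then interpret group_action ?S E ?f
    by (intro group_action.intro group_hom.intro grp group_BijGroup group_hom_axioms.intro)
  have "order ?S = p ^ a" using S by (simp add: order_def)
  from p_group_fixed_point[OF p this fin dvd x0(1)] x0 show ?thesis by auto
qed

section \<open>Adjoining an element to a subgroup\<close>

text \<open>When \<open>g\<close> normalizes the subgroup \<open>C\<close> of a finite group, this
  is the subgroup generated by \<open>C\<close> and \<open>g\<close>; natural exponents suffice
  because \<open>g\<close> has finite order.\<close>

definition adjoin :: "('a, 'b) monoid_scheme \<Rightarrow> 'a set \<Rightarrow> 'a \<Rightarrow> 'a set"
  where "adjoin G C g = {c \<otimes>\<^bsub>G\<^esub> g [^]\<^bsub>G\<^esub> i | c i. c \<in> C \<and> i \<in> (UNIV :: nat set)}"

context group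
begin

lemma adjoinI: "c \<in> C \<Longrightarrow> c \<otimes> g [^] (i::nat) \<in> adjoin G C g"
  unfolding adjoin_def by blast

lemma adjoinE:
  assumes "x \<in> adjoin G C g"
  obtains c i where "c \<in> C" "x = c \<otimes> g [^] (i::nat)"
  using assms unfolding adjoin_def by blast

lemma conj_pow_closed:
  assumes "subgroup C G" "g \<in> carrier G" "\<And>c. c \<in> C \<Longrightarrow> g \<otimes> c \<otimes> inv g \<in> C" "c \<in> C"
  shows "g [^] (i::nat) \<otimes> c \<otimes> inv (g [^] i) \<in> C"
proof -
  have c: "c \<in> carrier G" by (rule subgroup.mem_carrier[OF assms(1,4)])
  have step: "(g \<otimes> z) \<otimes> c \<otimes> inv (g \<otimes> z) = g \<otimes> (z \<otimes> c \<otimes> inv z) \<otimes> inv g" if "z \<in> carrier G" for z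
    using that assms(2) c by (simp add: word_simps)
  show ?thesis
  proof (induction i)
    case 0
    then show ?case using c assms(4) by simp
  next
    case (Suc i)
    show ?case
      unfolding nat_pow_Suc2[OF assms(2)] step[OF nat_pow_closed[OF assms(2)]] by (rule assms(3)[OF Suc])
  qed
qed

lemma adjoin_subset:
  assumes "subgroup D G" "C \<subseteq> D" "g \<in> D"
  shows "adjoin G C g \<subseteq> D"
proof -
  interpret D: subgroup D G by fact
  have "g [^] (i::nat) \<in> D" for i by (induction i) (use assms in auto)
  then show ?thesis using assms unfolding adjoin_def by auto
qed

lemma base_subset_adjoin:
  assumes "subgroup C G" "g \<in> carrier G"
  shows "C \<subseteq> adjoin G C g"
proof
  fix c assume "c \<in> C"
  then show "c \<in> adjoin G C g" using adjoinI[of c C g 0] assms subgroup.mem_carrier by fastforce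
qed

lemma mem_adjoin:
  assumes "subgroup C G" "g \<in> carrier G"
  shows "g \<in> adjoin G C g"
  using adjoinI[of \<one> C g 1] subgroup.one_closed[OF assms(1)] assms(2) by simp

lemma subgroup_adjoin:
  assumes fin: "finite (carrier G)" and C: "subgroup C G" and g: "g \<in> carrier G"
    and conj: "\<And>c. c \<in> C \<Longrightarrow> g \<otimes> c \<otimes> inv g \<in> C"
  shows "subgroup (adjoin G C g) G"
proof (rule subgroup_finiteI[OF fin])
  interpret C: subgroup C G by fact
  show "adjoin G C g \<subseteq> carrier G" unfolding adjoin_def using g by auto
  show "\<one> \<in> adjoin G C g" using base_subset_adjoin[OF C g] by auto
  fix x y assume "x \<in> adjoin G C g" "y \<in> adjoin G C g"
  then obtain c i c' j where *: "c \<in> C" "x = c \<otimes> g [^] (i::nat)" "c' \<in> C" "y = c' \<otimes> g [^] (j::nat)"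
    by (elim adjoinE)
  have "x \<otimes> y = (c \<otimes> (g [^] i \<otimes> c' \<otimes> inv (g [^] i))) \<otimes> g [^] (i + j)"
    using * g by (simp add: word_simps nat_pow_mult[symmetric])
  then show "x \<otimes> y \<in> adjoin G C g"
    using * conj_pow_closed[OF C g conj] by (auto intro!: adjoinI)
qed

lemma subgroup_adjoin_normal:
  assumes "finite (carrier G)" "N \<lhd> G" "g \<in> carrier G"
  shows "subgroup (adjoin G N g) G"
  using assms subgroup_adjoin normal_imp_subgroup normal.inv_op_closed2 by metis

lemma rcoset_eq_iff:
  assumes "subgroup A G" "x \<in> carrier G" "y \<in> carrier G"
  shows "A #> x = A #> y \<longleftrightarrow> x \<otimes> inv y \<in> A"
proof
  assume "A #> x = A #> y"
  then have "x \<in> A #> y" using rcos_self assms by blast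
  then show "x \<otimes> inv y \<in> A" using assms subgroup.rcos_module_imp[OF assms(1) group_axioms]
    by blast
next
  assume "x \<otimes> inv y \<in> A"
  then have "x \<in> A #> y" using subgroup.rcos_module_rev[OF assms(1) group_axioms] assms by blast
  then show "A #> x = A #> y" using repr_independence assms by metis
qed

end

section \<open>Orders, normalizers and intermediate subgroups inside \<open>P\<close>\<close>

locale normal_p_subgroup = group G for G (structure) +
  fixes p :: nat and P :: "'a set"
  assumes fin: "finite (carrier G)"
    and prime_p: "Factorial_Ring.prime p"
    and P_normal: "P \<lhd> G"
    and P_card: "\<exists>n. card P = p ^ n"
begin

lemma p_gt_1: "p > 1" using prime_p prime_gt_1_nat by blast

lemma P_subgroup: "subgroup P G" using P_normal normal_imp_subgroup by blast

lemma P_carrier: "P \<subseteq> carrier G" using P_subgroup subgroup.subset by blast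

lemma finite_subgroup: "subgroup A G \<Longrightarrow> finite A"
  using fin finite_subset subgroup.subset by blast

lemma card_cosets:
  assumes A: "subgroup A G" and B: "subgroup B G" and AB: "A \<subseteq> B"
  shows "card ((\<lambda>b. A #> b) ` B) * card A = card B"
proof -
  have "subgroup A (G\<lparr>carrier := B\<rparr>)" using subgroup_incl A B AB by blast
  then have "card (rcosets\<^bsub>G\<lparr>carrier := B\<rparr>\<^esub> A) * card A = order (G\<lparr>carrier := B\<rparr>)"
    using group.lagrange subgroup.subgroup_is_group[OF B group_axioms] by blast
  moreover have "rcosets\<^bsub>G\<lparr>carrier := B\<rparr>\<^esub> A = (\<lambda>b. A #> b) ` B"
    unfolding RCOSETS_def by auto
  ultimately show ?thesis by (simp add: order_def)
qed

lemma subgroup_p_card: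
  assumes "subgroup A G" "A \<subseteq> P"
  shows "\<exists>k. card A = p ^ k"
proof -
  obtain n where n: "card P = p ^ n" using P_card by blast
  have "card A dvd p ^ n" using card_cosets[OF assms(1) P_subgroup assms(2)] n
    by (intro dvdI[where k = "card ((\<lambda>b. A #> b) ` P)"]) (simp add: mult.commute)
  then show ?thesis using prime_p divides_primepow_nat by blast
qed

lemma p_power_less:
  assumes "\<exists>i. a = p ^ i" "\<exists>j. b = p ^ j" "a < (b::nat)"
  shows "p * a \<le> b" "p * a dvd b"
proof -
  obtain i j where ij: "a = p ^ i" "b = p ^ j" using assms by blast
  then have "Suc i \<le> j" using assms(3) p_gt_1 power_strict_increasing_iff[of p i j] by auto
  then have "p ^ Suc i dvd b" using ij le_imp_power_dvd by blast
  then show "p * a dvd b" using ij by simp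
  then show "p * a \<le> b" using assms(3) by (simp add: dvd_imp_le)
qed

lemma psubset_p_card:
  assumes "subgroup A G" "subgroup B G" "A \<subset> B" "B \<subseteq> P"
  shows "p * card A \<le> card B"
proof (rule p_power_less(1))
  show "\<exists>i. card A = p ^ i" "\<exists>j. card B = p ^ j" using assms subgroup_p_card by auto
  show "card A < card B" using assms finite_subgroup psubset_card_mono by blast
qed

lemma p_dvd_card_cosets:
  assumes A: "subgroup A G" and B: "subgroup B G" and AB: "A \<subset> B" and P: "B \<subseteq> P"
  shows "p dvd card ((\<lambda>b. A #> b) ` B)"
proof -
  have *: "card ((\<lambda>b. A #> b) ` B) * card A = card B" using card_cosets A B AB by blast
  have "card A < card B" using AB finite_subgroup[OF B] psubset_card_mono by blast
  moreover have "\<exists>i. card A = p ^ i" "\<exists>j. card B = p ^ j" using A B AB P subgroup_p_card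
    by auto
  ultimately have "p * card A dvd card B" using p_power_less(2) by blast
  moreover have "card A \<noteq> 0" using finite_subgroup[OF A] subgroup.one_closed[OF A] by auto
  ultimately show ?thesis unfolding *[symmetric] by (simp add: mult.commute)
qed

text \<open>The iterated \<open>p\<close>-th powers of \<open>y\<close> end at
  \<open>\<one>\<close>, so some step is the first to enter \<open>D\<close>. This supplies elements
  to which \<open>card_adjoin\<close> applies.\<close>

lemma p_root_outside:
  assumes D: "subgroup D G" and y: "y \<in> P" "y \<notin> D"
  shows "\<exists>i::nat. y [^] i \<notin> D \<and> (y [^] i) [^] p \<in> D"
proof -
  have yc: "y \<in> carrier G" using y P_carrier by blast
  obtain n where n: "card P = p ^ n" using P_card by blast
  have "y [^]\<^bsub>G\<lparr>carrier := P\<rparr>\<^esub> card P = \<one>"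
    using group.pow_order_eq_1[OF subgroup.subgroup_is_group[OF P_subgroup group_axioms], of y] y
    by (simp add: order_def)
  then have "y [^] (p ^ n) \<in> D"
    using n nat_pow_consistent[of y "card P"] subgroup.one_closed[OF D] by simp
  define k where "k = (LEAST k. y [^] (p ^ k) \<in> D)"
  have k: "y [^] (p ^ k) \<in> D" unfolding k_def using \<open>y [^] (p ^ n) \<in> D\<close>
    by (rule LeastI)
  have "k \<noteq> 0"
  proof
    assume "k = 0"
    then have "y [^] (1::nat) \<in> D" using k by simp
    then show False using y yc by simp
  qed
  then obtain j where j: "k = Suc j" using not0_implies_Suc by blast
  then have "j < k" by simp
  then have "y [^] (p ^ j) \<notin> D" unfolding k_def by (rule not_less_Least)
  moreover have "(y [^] (p ^ j)) [^] p \<in> D" using k j yc by (simp add: nat_pow_pow mult.commute)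
  ultimately show ?thesis by blast
qed

text \<open>\<open>C\<close> acts on its cosets in \<open>Q\<close> by right multiplication. The
  coset \<open>C\<close> is fixed and the number of cosets is divisible by \<open>p\<close>, so a
  second coset \<open>C #> q\<close> is fixed, which says that \<open>q\<close> normalizes
  \<open>C\<close>. Passing to a power of \<open>q\<close> puts its \<open>p\<close>-th power into
  \<open>C\<close>.\<close>

lemma normalizer_growth:
  assumes C: "subgroup C G" and Q: "subgroup Q G" and CQ: "C \<subset> Q" and QP: "Q \<subseteq> P"
  shows "\<exists>g\<in>Q - C. g [^] p \<in> C \<and> (\<forall>c\<in>C. g \<otimes> c \<otimes> inv g \<in> C)"
proof -
  interpret C: subgroup C G by fact
  interpret Q: subgroup Q G by fact
  let ?E = "(\<lambda>q. C #> q) ` Q"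
  obtain a where a: "card C = p ^ a" using subgroup_p_card C CQ QP by blast
  \<comment> \<open>The inverse turns right multiplication into a left action.\<close>
  have "\<exists>Y\<in>?E. Y \<noteq> C \<and> (\<forall>s\<in>C. Y #> inv s = Y)"
  proof (rule p_group_fixed_point[OF prime_p C a])
    show "finite ?E" using finite_subgroup Q by blast
    show "p dvd card ?E" using p_dvd_card_cosets assms by blast
    show "C \<in> ?E" using Q.one_closed C.subset by (intro image_eqI[of _ _ \<one>]) simp_all
    show "C #> inv s = C" if "s \<in> C" for s using that C.rcos_const by simp
    fix x assume x: "x \<in> ?E"
    then obtain q where q: "q \<in> Q" "x = C #> q" by blast
    show "x #> inv \<one> = x" using q C.subset by (simp add: coset_mult_assoc)
    fix s assume s: "s \<in> C"
    show "x #> inv s \<in> ?E" using q s CQ C.subset by (auto simp: coset_mult_assoc)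
    fix t assume t: "t \<in> C"
    show "x #> inv (s \<otimes> t) = x #> inv t #> inv s"
      using q s t C.subset by (simp add: coset_mult_assoc inv_mult_group m_assoc)
  qed
  then obtain q where q: "q \<in> Q" "C #> q \<noteq> C" "\<And>s. s \<in> C \<Longrightarrow> C #> q #> inv s = C #> q" by blast
  have qC: "q \<notin> C" using q(2) C.rcos_const by blast
  have qn: "q \<otimes> s \<otimes> inv q \<in> C" if s: "s \<in> C" for s
  proof -
    have "C #> (q \<otimes> s) = C #> q" using q(3)[of "inv s"] q(1) s C.subset
      by (simp add: coset_mult_assoc)
    then show ?thesis using rcoset_eq_iff[OF C] q(1) s by simp
  qed
  obtain i :: nat where i: "q [^] i \<notin> C" "(q [^] i) [^] p \<in> C"
    using p_root_outside[OF C _ qC] q QP by blast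
  have "q [^] j \<in> Q" for j :: nat by (induction j) (use q in auto)
  moreover have "q [^] i \<otimes> c \<otimes> inv (q [^] i) \<in> C" if "c \<in> C" for c
    by (rule conj_pow_closed[OF C _ qn that]) (use q in auto)
  ultimately show ?thesis using i by blast
qed

text \<open>Exponents reduce modulo \<open>p\<close> because \<open>g [^] p \<in> C\<close>, which
  bounds the order from above; from below, a strictly larger \<open>p\<close>-subgroup has at least
  \<open>p\<close> times the order.\<close>

lemma card_adjoin:
  assumes C: "subgroup C G" "C \<subseteq> P" and g: "g \<in> P" "g \<notin> C" "g [^] p \<in> C"
    and conj: "\<And>c. c \<in> C \<Longrightarrow> g \<otimes> c \<otimes> inv g \<in> C"
  shows "card (adjoin G C g) = p * card C"
proof (rule antisym)
  interpret C: subgroup C G by fact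
  have gc: "g \<in> carrier G" using g P_carrier by blast
  have sub: "subgroup (adjoin G C g) G" by (rule subgroup_adjoin[OF fin C(1) gc conj])
  show "p * card C \<le> card (adjoin G C g)"
  proof (rule psubset_p_card[OF C(1) sub])
    show "C \<subset> adjoin G C g" using base_subset_adjoin[OF C(1) gc] mem_adjoin[OF C(1) gc] g by blast
    show "adjoin G C g \<subseteq> P" using adjoin_subset[OF P_subgroup C(2)] g by blast
  qed
  have pw: "(g [^] p) [^] j \<in> C" for j :: nat by (induction j) (use g in auto)
  have "adjoin G C g \<subseteq> (\<lambda>(c, i). c \<otimes> g [^] i) ` (C \<times> {..<p})"
  proof
    fix x assume "x \<in> adjoin G C g"
    then obtain c i where c: "c \<in> C" "x = c \<otimes> g [^] (i::nat)" by (elim adjoinE)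
    have "g [^] i = (g [^] p) [^] (i div p) \<otimes> g [^] (i mod p)"
      using gc by (simp add: nat_pow_pow nat_pow_mult)
    then have "x = c \<otimes> (g [^] p) [^] (i div p) \<otimes> g [^] (i mod p)"
      using c gc by (simp add: m_assoc)
    moreover have "i mod p < p" using p_gt_1 by simp
    ultimately show "x \<in> (\<lambda>(c, i). c \<otimes> g [^] i) ` (C \<times> {..<p})"
      using c pw[of "i div p"]
      by (intro image_eqI[of _ _ "(c \<otimes> (g [^] p) [^] (i div p), i mod p)"]) auto
  qed
  then have "card (adjoin G C g) \<le> card (C \<times> {..<p})"
    using finite_subgroup[OF C(1)] surj_card_le finite_cartesian_product by blast
  then show "card (adjoin G C g) \<le> p * card C" by (simp add: mult.commute card_cartesian_product)
qed

text \<open>A largest candidate of order at most \<open>d\<close> has order \<open>d\<close>: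
  otherwise adjoining a normalizing element multiplies the order by \<open>p\<close>, which cannot
  jump over the \<open>p\<close>-power \<open>d\<close>.\<close>

lemma intermediate_subgroup:
  assumes C: "subgroup C G" and Q: "subgroup Q G" "C \<subseteq> Q" "Q \<subseteq> P"
    and d: "\<exists>m. d = p ^ m" "card C \<le> d" "d \<le> card Q"
  shows "\<exists>H. subgroup H G \<and> C \<subseteq> H \<and> H \<subseteq> Q \<and> card H = d"
proof -
  let ?P = "\<lambda>H. subgroup H G \<and> C \<subseteq> H \<and> H \<subseteq> Q \<and> card H \<le> d"
  have "?P C" using assms by blast
  then obtain H where H: "?P H" "\<And>H'. ?P H' \<Longrightarrow> card H' \<le> card H"
    using ex_has_greatest_nat[of ?P C card "Suc d"] by (auto simp: less_Suc_eq_le)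
  have "card H = d"
  proof (rule ccontr)
    assume "card H \<noteq> d"
    then have lt: "card H < d" using H by simp
    then have HQ: "H \<subset> Q" using H d by auto
    obtain g where g: "g \<in> Q - H" "g [^] p \<in> H" "\<forall>c\<in>H. g \<otimes> c \<otimes> inv g \<in> H"
      using normalizer_growth[OF _ Q(1) HQ Q(3)] H by blast
    have gc: "g \<in> carrier G" using g Q P_carrier by blast
    have "card (adjoin G H g) = p * card H" using card_adjoin g H Q by blast
    moreover have "p * card H \<le> d"
      using p_power_less(1)[OF _ d(1) lt] subgroup_p_card[of H] H Q by blast
    moreover have "subgroup (adjoin G H g) G" using subgroup_adjoin[OF fin] g gc H by blast
    moreover have "H \<subseteq> adjoin G H g" using base_subset_adjoin H gc by blast
    moreover have "adjoin G H g \<subseteq> Q" using adjoin_subset Q H g by blast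
    ultimately have "?P (adjoin G H g)" "card (adjoin G H g) = p * card H" using H by auto
    then have "p * card H \<le> card H" using H(2) by metis
    moreover have "card H > 0" using H finite_subgroup subgroup.one_closed card_gt_0_iff by blast
    ultimately show False using p_gt_1 by simp
  qed
  then show ?thesis using H by blast
qed

text \<open>\<open>S\<close> permutes the cosets of \<open>A\<close> in \<open>B\<close> by
  conjugation and fixes \<open>A\<close> itself; their number is divisible by \<open>p\<close>, so
  another one is fixed. Used with \<open>S = P\<close> for the centrality of chief factors, and with
  a Sylow subgroup for invariant chains.\<close>

lemma fixed_coset:
  assumes S: "subgroup S G" "\<exists>a. card S = p ^ a"
    and A: "subgroup A G" and B: "subgroup B G" and AB: "A \<subset> B" "B \<subseteq> P"
    and BA: "\<And>b a. b \<in> B \<Longrightarrow> a \<in> A \<Longrightarrow> b \<otimes> a \<otimes> inv b \<in> A"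
    and SA: "\<And>s a. s \<in> S \<Longrightarrow> a \<in> A \<Longrightarrow> s \<otimes> a \<otimes> inv s \<in> A"
    and SB: "\<And>s b. s \<in> S \<Longrightarrow> b \<in> B \<Longrightarrow> s \<otimes> b \<otimes> inv s \<in> B"
  shows "\<exists>g\<in>B - A. \<forall>s\<in>S. s \<otimes> g \<otimes> inv s \<otimes> inv g \<in> A"
proof -
  interpret S: subgroup S G by fact
  interpret A: subgroup A G by fact
  interpret B: subgroup B G by fact
  let ?E = "(\<lambda>q. A #> q) ` B"
  let ?f = "\<lambda>s Y. (\<lambda>x. s \<otimes> x \<otimes> inv s) ` Y"
  obtain a where a: "card S = p ^ a" using S by blast
  have SA': "?f s A = A" if s: "s \<in> S" for s
  proof
    show "?f s A \<subseteq> A" using SA s by blast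
    show "A \<subseteq> ?f s A"
    proof
      fix x assume x: "x \<in> A"
      have "x = s \<otimes> (inv s \<otimes> x \<otimes> inv (inv s)) \<otimes> inv s" using x s
        by (simp add: word_simps)
      then show "x \<in> ?f s A" using SA[of "inv s" x] s x by blast
    qed
  qed
  have fE: "?f s (A #> b) = A #> (s \<otimes> b \<otimes> inv s)" if s: "s \<in> S" "b \<in> B" for s b
  proof -
    have "?f s (A #> b) = (\<lambda>a. s \<otimes> (a \<otimes> b) \<otimes> inv s) ` A"
      unfolding r_coset_def by blast
    also have "\<dots> = (\<lambda>a. s \<otimes> a \<otimes> inv s \<otimes> (s \<otimes> b \<otimes> inv s)) ` A"
      by (rule image_cong) (use s in \<open>simp_all add: word_simps\<close>)
    also have "\<dots> = (\<lambda>x. x \<otimes> (s \<otimes> b \<otimes> inv s)) ` ?f s A"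
      by (simp add: image_image)
    also have "\<dots> = A #> (s \<otimes> b \<otimes> inv s)" unfolding SA'[OF s(1)] r_coset_def by blast
    finally show ?thesis .
  qed
  have "\<exists>Y\<in>?E. Y \<noteq> A \<and> (\<forall>s\<in>S. ?f s Y = Y)"
  proof (rule p_group_fixed_point[OF prime_p S(1) a])
    show "finite ?E" using finite_subgroup B by blast
    show "p dvd card ?E" using p_dvd_card_cosets A B AB by blast
    show "A \<in> ?E" using B.one_closed A.subset by (intro image_eqI[of _ _ \<one>]) simp_all
    show "?f s A = A" if "s \<in> S" for s using that SA' by simp
    fix Y assume x: "Y \<in> ?E"
    then obtain q where q: "q \<in> B" "Y = A #> q" by blast
    have Y: "Y \<subseteq> carrier G" using q A.subset r_coset_subset_G by simp
    show "?f \<one> Y = Y" using Y by (auto simp: subset_iff image_iff)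
    fix s assume s: "s \<in> S"
    show "?f s Y \<in> ?E" using q s fE SB by simp
    fix t assume t: "t \<in> S"
    show "?f (s \<otimes> t) Y = ?f s (?f t Y)"
      unfolding image_image by (rule image_cong) (use Y s t in \<open>auto simp: subset_iff word_simps\<close>)
  qed
  then obtain q where q: "q \<in> B" "A #> q \<noteq> A" "\<And>s. s \<in> S \<Longrightarrow> ?f s (A #> q) = A #> q" by blast
  have "q \<notin> A" using q(2) A.rcos_const by blast
  moreover have "s \<otimes> q \<otimes> inv s \<otimes> inv q \<in> A" if "s \<in> S" for s
    using q(3)[OF that] fE[OF that q(1)] rcoset_eq_iff[OF A] q(1) that by simp
  ultimately show ?thesis using q by blast
qed

end

section \<open>Chief factors inside a normal \<open>p\<close>-subgroup\<close>

context group
begin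

lemma rcos_commute_iff:
  assumes "subgroup K G" "x \<in> carrier G" "y \<in> carrier G"
  shows "x \<otimes> y \<otimes> inv x \<otimes> inv y \<in> K \<longleftrightarrow> K #> (x \<otimes> y) = K #> (y \<otimes> x)"
  using rcoset_eq_iff[OF assms(1), of "x \<otimes> y" "y \<otimes> x"] assms(2,3)
    by (simp add: inv_mult_group m_assoc)

lemma pow_mult_mod:
  assumes K: "K \<lhd> G" and x: "x \<in> carrier G" and y: "y \<in> carrier G"
    and comm: "x \<otimes> y \<otimes> inv x \<otimes> inv y \<in> K"
  shows "(x \<otimes> y) [^] (n::nat) \<otimes> inv (x [^] n \<otimes> y [^] n) \<in> K"
proof -
  interpret K: normal K G by fact
  interpret Q: group "G Mod K" by (rule K.factorgroup_is_group)
  have m: "(K #> a) \<otimes>\<^bsub>G Mod K\<^esub> (K #> b) = K #> (a \<otimes> b)"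
    if "a \<in> carrier G" "b \<in> carrier G" for a b
    using K.rcos_sum that by simp
  have c: "K #> a \<in> carrier (G Mod K)" if "a \<in> carrier G" for a using that
    by (simp add: carrier_FactGroup)
  have "(K #> x) \<otimes>\<^bsub>G Mod K\<^esub> (K #> y) = (K #> y) \<otimes>\<^bsub>G Mod K\<^esub> (K #> x)"
    using rcos_commute_iff[OF K.is_subgroup x y] comm m x y by simp
  from Q.pow_mult_distrib[OF this c[OF x] c[OF y], of n]
  have "K #> ((x \<otimes> y) [^] n) = K #> (x [^] n \<otimes> y [^] n)"
    using K.FactGroup_pow m x y by simp
  then show ?thesis using rcoset_eq_iff[OF K.is_subgroup] x y by simp
qed

end

context normal_p_subgroup
begin

definition nsub :: "'a set \<Rightarrow> bool"
  where "nsub A \<longleftrightarrow> A \<lhd> G \<and> A \<subseteq> P"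

text \<open>Chief factors below \<open>P\<close>, phrased by subgroups of \<open>G\<close> alone;
  \<open>chief_imp_chief_factor\<close> and \<open>chief_factor_imp_chief\<close> link this to the
  quotient group.\<close>

definition chief :: "'a set \<Rightarrow> 'a set \<Rightarrow> bool"
  where "chief L K \<longleftrightarrow>
    nsub L \<and> nsub K \<and> K \<subset> L \<and> (\<forall>D. nsub D \<and> K \<subseteq> D \<and> D \<subseteq> L \<longrightarrow> D = K \<or> D = L)"

text \<open>\<open>L \<subseteq> adjoin G K x\<close> means that the coset of \<open>x\<close>
  generates \<open>L/K\<close>, so this is noncyclicity without forming the quotient.\<close>

definition bad :: "'a set \<Rightarrow> 'a set \<Rightarrow> bool"
  where "bad L K \<longleftrightarrow> chief L K \<and> \<not> (\<exists>x\<in>L. L \<subseteq> adjoin G K x)"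

lemma nsub_subgroup: "nsub A \<Longrightarrow> subgroup A G"
  by (simp add: nsub_def normal_imp_subgroup)

lemma nsub_normal: "nsub A \<Longrightarrow> A \<lhd> G" by (simp add: nsub_def)

lemma nsub_subset: "nsub A \<Longrightarrow> A \<subseteq> P" by (simp add: nsub_def)

lemma nsub_carrier: "nsub A \<Longrightarrow> x \<in> A \<Longrightarrow> x \<in> carrier G"
  using P_carrier by (auto simp: nsub_def)

lemma nsub_conj: "nsub A \<Longrightarrow> g \<in> carrier G \<Longrightarrow> a \<in> A \<Longrightarrow> g \<otimes> a \<otimes> inv g \<in> A"
  by (simp add: nsub_def normal.inv_op_closed2)

lemma nsub_conj': "nsub A \<Longrightarrow> g \<in> carrier G \<Longrightarrow> a \<in> A \<Longrightarrow> inv g \<otimes> a \<otimes> g \<in> A"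
  by (simp add: nsub_def normal.inv_op_closed1)

lemma nsub_P: "nsub P" by (simp add: nsub_def P_normal)

lemma nsub_one: "nsub {\<one>}"
  by (simp add: nsub_def one_is_normal subgroup.one_closed[OF P_subgroup])

lemma nsub_Int: "nsub A \<Longrightarrow> nsub B \<Longrightarrow> nsub (A \<inter> B)"
  by (auto simp: nsub_def normal_subgroup_intersect)

lemma set_mult_subset:
  assumes "subgroup D G" "A \<subseteq> D" "B \<subseteq> D"
  shows "A <#> B \<subseteq> D"
  using assms subgroup.m_closed by (fastforce simp: set_mult_def)

lemma set_mult_supset:
  assumes "subgroup A G" "subgroup B G"
  shows "A \<subseteq> A <#> B" "B \<subseteq> A <#> B"
proof -
  interpret A: subgroup A G by fact
  interpret B: subgroup B G by fact
  show "A \<subseteq> A <#> B"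
  proof
    fix a assume "a \<in> A"
    then have "a = a \<otimes> \<one>" by simp
    then show "a \<in> A <#> B" using \<open>a \<in> A\<close> B.one_closed unfolding set_mult_def by blast
  qed
  show "B \<subseteq> A <#> B"
  proof
    fix b assume "b \<in> B"
    then have "b = \<one> \<otimes> b" by simp
    then show "b \<in> A <#> B" using \<open>b \<in> B\<close> A.one_closed unfolding set_mult_def by blast
  qed
qed

lemma nsub_mult: "nsub A \<Longrightarrow> nsub B \<Longrightarrow> nsub (A <#> B)"
  by (simp add: nsub_def normal_subgroup_set_mult_closed set_mult_subset[OF P_subgroup])

lemma nsubI:
  assumes sub: "A \<subseteq> P" "\<one> \<in> A"
    and mult: "\<And>x y. x \<in> A \<Longrightarrow> y \<in> A \<Longrightarrow> x \<otimes> y \<in> A"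
    and conj: "\<And>g x. g \<in> carrier G \<Longrightarrow> x \<in> A \<Longrightarrow> g \<otimes> x \<otimes> inv g \<in> A"
  shows "nsub A"
proof -
  have "subgroup A G" using subgroup_finiteI[OF fin _ sub(2) mult] sub(1) P_carrier by blast
  then show ?thesis using normal_invI conj sub(1) by (simp add: nsub_def)
qed

lemma chiefD:
  assumes "chief L K"
  shows "nsub L" "nsub K" "K \<subset> L" "\<And>D. nsub D \<Longrightarrow> K \<subseteq> D \<Longrightarrow> D \<subseteq> L \<Longrightarrow> D = K \<or> D = L"
  using assms unfolding chief_def by blast+

lemma badD: "bad L K \<Longrightarrow> chief L K" "bad L K \<Longrightarrow> x \<in> L \<Longrightarrow> \<not> L \<subseteq> adjoin G K x"
  unfolding bad_def by blast+

lemma exists_chief: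
  assumes "nsub A" "nsub B" "A \<subset> B"
  shows "\<exists>C. chief C A \<and> C \<subseteq> B"
proof -
  let ?P = "\<lambda>C. nsub C \<and> A \<subset> C \<and> C \<subseteq> B"
  have "?P B" using assms by blast
  then obtain C where C: "?P C" "\<And>C'. ?P C' \<Longrightarrow> card C \<le> card C'"
    using ex_has_least_nat[of ?P B card] by blast
  have "D = A \<or> D = C" if D: "nsub D" "A \<subseteq> D" "D \<subseteq> C" for D
  proof (rule ccontr)
    assume "\<not> ?thesis"
    then have "?P D" "D \<subset> C" using D C by auto
    then show False using C psubset_card_mono finite_subgroup nsub_subgroup by (metis leD)
  qed
  then show ?thesis using C assms unfolding chief_def by blast
qed

text \<open>With \<open>A\<close> the top of a chief factor, normality of this relative centralizer
  makes it the whole of \<open>A\<close> as soon as it contains the bottom and one further element.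
  Products rest on [g,xy] = [g,x] x[g,y]x^-1.\<close>

lemma nsub_centralizer_mod:
  assumes A: "nsub A" and M: "nsub M" and K: "nsub K"
  shows "nsub {x \<in> A. \<forall>g\<in>M. g \<otimes> x \<otimes> inv g \<otimes> inv x \<in> K}" (is "nsub ?D")
proof (rule nsubI)
  interpret A: normal A G using A by (rule nsub_normal)
  interpret M: normal M G using M by (rule nsub_normal)
  interpret K: normal K G using K by (rule nsub_normal)
  show "?D \<subseteq> P" using nsub_subset[OF A] by blast
  show "\<one> \<in> ?D" by simp
  fix x assume x: "x \<in> ?D"
  show "x \<otimes> y \<in> ?D" if y: "y \<in> ?D" for y
  proof -
    have "g \<otimes> (x \<otimes> y) \<otimes> inv g \<otimes> inv (x \<otimes> y) \<in> K"
      if g: "g \<in> M" for g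
    proof -
      have "g \<otimes> (x \<otimes> y) \<otimes> inv g \<otimes> inv (x \<otimes> y)
          = (g \<otimes> x \<otimes> inv g \<otimes> inv x) \<otimes> (x \<otimes> (g \<otimes> y \<otimes> inv g \<otimes> inv y) \<otimes> inv x)"
        using x y g by (simp add: word_simps)
      moreover have "x \<otimes> (g \<otimes> y \<otimes> inv g \<otimes> inv y) \<otimes> inv x \<in> K"
        using x y g by (intro K.inv_op_closed2) auto
      ultimately show ?thesis using x g by simp
    qed
    then show ?thesis using x y by auto
  qed
  show "h \<otimes> x \<otimes> inv h \<in> ?D" if h: "h \<in> carrier G" for h
  proof -
    have "g \<otimes> (h \<otimes> x \<otimes> inv h) \<otimes> inv g \<otimes> inv (h \<otimes> x \<otimes> inv h) \<in> K" if g: "g \<in> M" for g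
    proof -
      let ?g = "inv h \<otimes> g \<otimes> h"
      have g': "?g \<in> M" using nsub_conj'[OF M h g] .
      have eq: "g \<otimes> (h \<otimes> x \<otimes> inv h) \<otimes> inv g \<otimes> inv (h \<otimes> x \<otimes> inv h)
          = h \<otimes> (?g \<otimes> x \<otimes> inv ?g \<otimes> inv x) \<otimes> inv h"
        using x h g by (simp add: word_simps)
      show ?thesis unfolding eq by (rule K.inv_op_closed2) (use x h g' in blast)+
    qed
    then show ?thesis using x h A.inv_op_closed2 by auto
  qed
qed

text \<open>The \<open>p\<close>-group \<open>P\<close> has a nontrivial fixed point on
  \<open>L/K\<close>. The fixed points form a normal subgroup of \<open>G\<close> between
  \<open>K\<close> and \<open>L\<close>, which by minimality is all of \<open>L\<close>.\<close>

lemma chief_central: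
  assumes LK: "chief L K" and x: "x \<in> L" and g: "g \<in> P"
  shows "g \<otimes> x \<otimes> inv g \<otimes> inv x \<in> K"
proof -
  note L = chiefD[OF LK]
  interpret K: normal K G using L by (simp add: nsub_normal)
  let ?D = "{x \<in> L. \<forall>g\<in>P. g \<otimes> x \<otimes> inv g \<otimes> inv x \<in> K}"
  have "nsub ?D" by (rule nsub_centralizer_mod[OF L(1) nsub_P L(2)])
  moreover have "g \<otimes> x \<otimes> inv g \<otimes> inv x \<in> K" if "x \<in> K" "g \<in> P" for x g
    using that K.inv_op_closed2[of g x] nsub_carrier[OF nsub_P] by simp
  then have "K \<subseteq> ?D" using L(3) by blast
  moreover have "?D \<noteq> K"
  proof -
    have "\<exists>g\<in>L - K. \<forall>s\<in>P. s \<otimes> g \<otimes> inv s \<otimes> inv g \<in> K"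
      by (rule fixed_coset[OF P_subgroup P_card])
        (use L(3) nsub_subgroup[OF L(1)] nsub_subgroup[OF L(2)] nsub_subset[OF L(1)] nsub_conj[OF L(1)]
          nsub_conj[OF L(2)] nsub_carrier[OF nsub_P] nsub_carrier[OF L(1)] in auto)
    then show ?thesis by blast
  qed
  ultimately have "?D = L" using L(4)[of ?D] by blast
  then show ?thesis using x g by blast
qed

text \<open>As \<open>L/K\<close> is abelian, the elements with \<open>p\<close>-th power in
  \<open>K\<close> form a normal subgroup; it is larger than \<open>K\<close> by
  \<open>p_root_outside\<close>, so it is \<open>L\<close>.\<close>

lemma chief_pow:
  assumes LK: "chief L K" and x: "x \<in> L"
  shows "x [^] p \<in> K"
proof -
  note L = chiefD[OF LK]
  interpret K: normal K G using L by (simp add: nsub_normal)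
  interpret L: normal L G using L by (simp add: nsub_normal)
  have pL: "x [^] (i::nat) \<in> L" if "x \<in> L" for x i by (induction i) (use that in auto)
  let ?D = "{x \<in> L. x [^] p \<in> K}"
  have "nsub ?D"
  proof (rule nsubI)
    show "?D \<subseteq> P" using nsub_subset[OF L(1)] by blast
    show "\<one> \<in> ?D" by simp
  next
    fix x y assume *: "x \<in> ?D" "y \<in> ?D"
    have "x \<otimes> y \<otimes> inv x \<otimes> inv y \<in> K"
      using chief_central[OF LK, of y x] * nsub_subset[OF L(1)] by auto
    then have "(x \<otimes> y) [^] p \<otimes> inv (x [^] p \<otimes> y [^] p) \<in> K"
      using pow_mult_mod[OF K.normal_axioms] * by simp
    then have "(x \<otimes> y) [^] p \<otimes> inv (x [^] p \<otimes> y [^] p) \<otimes> (x [^] p \<otimes> y [^] p) \<in> K"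
      by (rule K.m_closed) (use * in auto)
    moreover have "(x \<otimes> y) [^] p \<otimes> inv (x [^] p \<otimes> y [^] p) \<otimes> (x [^] p \<otimes> y [^] p) = (x \<otimes> y) [^] p"
      using * by (simp add: word_simps)
    ultimately have "(x \<otimes> y) [^] p \<in> K" by (simp only:)
    then show "x \<otimes> y \<in> ?D" using * by simp
  next
    fix h x assume *: "h \<in> carrier G" "x \<in> ?D"
    then show "h \<otimes> x \<otimes> inv h \<in> ?D"
      using L.inv_op_closed2 K.inv_op_closed2[of h "x [^] p"] conj_nat_pow[of h x p] by auto
  qed
  moreover have "K \<subseteq> ?D"
  proof
    fix x assume "x \<in> K"
    moreover have "x [^] (i::nat) \<in> K" for i by (induction i) (use \<open>x \<in> K\<close> in auto)
    ultimately show "x \<in> ?D" using L(3) by blast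
  qed
  moreover have "?D \<noteq> K"
  proof -
    obtain y where y: "y \<in> L" "y \<notin> K" using L(3) by blast
    then obtain i :: nat where "y [^] i \<notin> K" "(y [^] i) [^] p \<in> K"
      using p_root_outside[OF K.is_subgroup, of y] nsub_subset[OF L(1)] by blast
    then show ?thesis using pL[OF y(1)] by blast
  qed
  ultimately have "?D = L" using L(4)[of ?D] by blast
  then show ?thesis using x by blast
qed

text \<open>Second isomorphism theorem for \<open>LZ/Z\<close> and \<open>L/(L \<inter> Z)\<close>,
  compatible with conjugation by \<open>G\<close>. It enlarges a bad factor, to be played off
  against a largest one.\<close>

lemma bad_mult:
  assumes LK: "bad L K" and Z: "nsub Z" "Z \<inter> L = K"
  shows "bad (L <#> Z) Z"
proof -
  note L = chiefD[OF badD(1)[OF LK]]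
  have sub: "subgroup L G" "subgroup Z G" "subgroup K G" using L(1-3) Z nsub_subgroup by auto
  interpret L: subgroup L G by fact
  interpret Z: subgroup Z G by fact
  have LZ: "nsub (L <#> Z)" "L \<subseteq> L <#> Z" "Z \<subseteq> L <#> Z"
    using nsub_mult L(1-3) Z set_mult_supset sub by auto
  have "chief (L <#> Z) Z"
    unfolding chief_def
  proof (intro conjI allI impI)
    show "Z \<subset> L <#> Z" using LZ L(1-3) Z by blast
  next
    fix D assume D: "nsub D \<and> Z \<subseteq> D \<and> D \<subseteq> L <#> Z"
    interpret D: subgroup D G using D nsub_subgroup by blast
    have "D \<inter> L = K \<or> D \<inter> L = L" using L(4)[of "D \<inter> L"] nsub_Int L(1,3) D Z
      by blast
    then show "D = Z \<or> D = L <#> Z"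
    proof
      assume DL: "D \<inter> L = K"
      have "D \<subseteq> Z"
      proof
        fix d assume d: "d \<in> D"
        then obtain l z where lz: "d = l \<otimes> z" "l \<in> L" "z \<in> Z" using D
          by (auto simp: set_mult_def)
        then have "l = d \<otimes> inv z" by (simp add: m_assoc)
        moreover have "d \<otimes> inv z \<in> D" using d lz D by auto
        ultimately have "l \<in> D" by metis
        then have "l \<in> Z" using DL lz Z by blast
        then show "d \<in> Z" using lz by simp
      qed
      then show ?thesis using D by blast
    next
      assume "D \<inter> L = L"
      then have "L <#> Z \<subseteq> D" using set_mult_subset[OF D.subgroup_axioms] D by blast
      then show ?thesis using D by blast
    qed
  qed (use LZ Z in auto)
  moreover have False if y: "y \<in> L <#> Z" "L <#> Z \<subseteq> adjoin G Z y" for y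
  proof -
    obtain l z where lz: "y = l \<otimes> z" "l \<in> L" "z \<in> Z" using y by (auto simp: set_mult_def)
    have sZ: "subgroup (adjoin G Z l) G" using subgroup_adjoin_normal fin Z nsub_normal lz by auto
    have "y \<in> adjoin G Z l"
      unfolding lz by (rule subgroup.m_closed[OF sZ])
        (use lz mem_adjoin[of Z l] base_subset_adjoin[of Z l] sub L.subset in auto)
    then have "adjoin G Z y \<subseteq> adjoin G Z l"
      using adjoin_subset[OF sZ, of Z y] base_subset_adjoin[of Z l] sub lz by auto
    have "L \<subseteq> adjoin G K l"
    proof
      fix u assume u: "u \<in> L"
      then have "u \<in> adjoin G Z l" using \<open>adjoin G Z y \<subseteq> adjoin G Z l\<close> y LZ
        by blast
      then obtain z' i where z': "z' \<in> Z" "u = z' \<otimes> l [^] (i::nat)" by (elim adjoinE)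
      have li: "l [^] i \<in> L" by (induction i) (use lz in auto)
      then have "z' = u \<otimes> inv (l [^] i)" using z' u lz by (simp add: m_assoc)
      moreover have "u \<otimes> inv (l [^] i) \<in> L" using li u by auto
      ultimately have "z' \<in> K" using z' Z by auto
      then show "u \<in> adjoin G K l" using z' adjoinI by auto
    qed
    then show False using badD(2)[OF LK lz(2)] by blast
  qed
  ultimately show ?thesis unfolding bad_def by blast
qed

text \<open>As no normal subgroup lies strictly between \<open>K\<close> and \<open>L\<close>, a
  normal \<open>D\<close> outside \<open>K\<close> gives \<open>DK = L\<close>, and
  \<open>D/(D \<inter> K)\<close> is isomorphic to \<open>L/K\<close>. It shrinks a bad factor, to
  be played off against a smallest one.\<close>

lemma bad_Int:
  assumes LK: "bad L K" and D: "nsub D" "D \<subseteq> L" "\<not> D \<subseteq> K"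
  shows "bad D (D \<inter> K)" and "D <#> K = L"
proof -
  note L = chiefD[OF badD(1)[OF LK]]
  have sub: "subgroup L G" "subgroup D G" "subgroup K G" using L(1-3) D nsub_subgroup by auto
  have K_join: "E <#> K = L" if E: "nsub E" "E \<subseteq> L" "\<not> E \<subseteq> K" for E
  proof -
    have *: "E \<subseteq> E <#> K" "K \<subseteq> E <#> K"
      using set_mult_supset[OF nsub_subgroup[OF E(1)] sub(3)] by auto
    have "E <#> K \<subseteq> L" using set_mult_subset[OF sub(1)] E L(1-3) by blast
    then show ?thesis using L(4)[OF nsub_mult[OF E(1) L(2)] *(2)] E(3) * by blast
  qed
  show DK: "D <#> K = L" using K_join D by blast
  have "chief D (D \<inter> K)"
    unfolding chief_def
  proof (intro conjI allI impI)
    fix E assume E: "nsub E \<and> D \<inter> K \<subseteq> E \<and> E \<subseteq> D"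
    show "E = D \<inter> K \<or> E = D"
    proof (cases "E \<subseteq> K")
      case False
      then have EK: "E <#> K = L" using K_join E D by blast
      interpret E: subgroup E G using E nsub_subgroup by blast
      interpret D: subgroup D G by fact
      interpret K: subgroup K G by fact
      have "D \<subseteq> E"
      proof
        fix d assume d: "d \<in> D"
        have "d \<in> E <#> K" using d D EK by blast
        then obtain e k where ek: "d = e \<otimes> k" "e \<in> E" "k \<in> K" by (auto simp: set_mult_def)
        then have "k = inv e \<otimes> d" by (simp add: inv_cancel)
        moreover have "inv e \<otimes> d \<in> D" using d ek E by auto
        ultimately have "k \<in> D" by metis
        then show "d \<in> E" using ek E by auto
      qed
      then show ?thesis using E by blast
    qed (use E in blast)
  qed (use D L(1-3) nsub_Int in auto)
  moreover have False if y: "y \<in> D" "D \<subseteq> adjoin G (D \<inter> K) y" for y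
  proof -
    have yc: "y \<in> carrier G" using y D nsub_carrier by blast
    have sK: "subgroup (adjoin G K y) G" using subgroup_adjoin_normal fin L(1-3) nsub_normal yc by auto
    have KK: "K \<subseteq> adjoin G K y" "y \<in> adjoin G K y"
      using base_subset_adjoin[OF sub(3) yc] mem_adjoin[OF sub(3) yc] by auto
    have "D \<subseteq> adjoin G K y" using y(2) adjoin_subset[OF sK, of "D \<inter> K" y] KK by blast
    then have "L \<subseteq> adjoin G K y" using set_mult_subset[OF sK _ KK(1)] DK by blast
    then show False using badD(2)[OF LK] y D by blast
  qed
  ultimately show "bad D (D \<inter> K)" unfolding bad_def by blast
qed

end

section \<open>Transfer of chief factors along twisted homomorphisms\<close>

text \<open>Conjugation need only turn \<open>\<phi> g\<close> into a power of \<open>\<phi>\<close> at the conjugate of \<open>g\<close>: this is what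
  happens for \<open>\<phi> g = [g, x]\<close> when \<open>G\<close> acts on the coset of \<open>x\<close> by taking powers.\<close>

locale twisted_hom = normal_p_subgroup +
  fixes M K\<^sub>0 :: "'a set" and \<phi> :: "'a \<Rightarrow> 'a"
  assumes M: "nsub M" and K0: "nsub K\<^sub>0"
    and phi_P: "g \<in> M \<Longrightarrow> \<phi> g \<in> P"
    and phi_mult: "g \<in> M \<Longrightarrow> h \<in> M \<Longrightarrow> \<exists>k\<in>K\<^sub>0. \<phi> (g \<otimes> h) = \<phi> g \<otimes> \<phi> h \<otimes> k"
    and phi_conj: "s \<in> carrier G \<Longrightarrow> g \<in> M \<Longrightarrow>
      \<exists>j::nat. \<exists>k\<in>K\<^sub>0. s \<otimes> \<phi> g \<otimes> inv s = \<phi> (s \<otimes> g \<otimes> inv s) [^] j \<otimes> k"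
begin

text \<open>The factor from \<open>K\<^sub>0\<close> compensates that \<open>\<phi>\<close> is
  multiplicative only modulo \<open>K\<^sub>0\<close>: with it the image of a subgroup is a
  subgroup.\<close>

definition img :: "'a set \<Rightarrow> 'a set"
  where "img A = {\<phi> a \<otimes> k | a k. a \<in> A \<and> k \<in> K\<^sub>0}"

definition pre :: "'a set \<Rightarrow> 'a set"
  where "pre W = {g \<in> M. \<phi> g \<in> W}"

sublocale M: normal M G using M by (rule nsub_normal)
sublocale K0: normal "K\<^sub>0" G using K0 by (rule nsub_normal)

lemma phi_carrier: "g \<in> M \<Longrightarrow> \<phi> g \<in> carrier G"
  using phi_P P_carrier by blast

lemma phi_one: "\<phi> \<one> \<in> K\<^sub>0"
proof -
  obtain k where k: "k \<in> K\<^sub>0" "\<phi> (\<one> \<otimes> \<one>) = \<phi> \<one> \<otimes> \<phi> \<one> \<otimes> k" using phi_mult[of \<one> \<one>] by auto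
  have c: "\<phi> \<one> \<in> carrier G" using phi_carrier by simp
  have "\<phi> \<one> \<otimes> \<one> = \<phi> \<one> \<otimes> (\<phi> \<one> \<otimes> k)" using k c
    by (simp add: m_assoc)
  then have "\<one> = \<phi> \<one> \<otimes> k" using c k(1) by (simp del: r_one)
  then have "\<phi> \<one> = inv k" using c k(1) by (metis K0.mem_carrier inv_equality)
  then show ?thesis using k by simp
qed

lemma subgroup_img:
  assumes A: "subgroup A G" "A \<subseteq> M"
  shows "subgroup (img A) G"
proof (rule subgroup_finiteI[OF fin])
  interpret A: subgroup A G by fact
  show "img A \<subseteq> carrier G" using A phi_carrier by (auto simp: img_def)
  have "\<one> = \<phi> \<one> \<otimes> inv (\<phi> \<one>)" using phi_carrier by simp
  then show "\<one> \<in> img A" using phi_one A.one_closed unfolding img_def by blast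
  fix x y assume "x \<in> img A" "y \<in> img A"
  then obtain a k b l where *: "x = \<phi> a \<otimes> k" "a \<in> A" "k \<in> K\<^sub>0" "y = \<phi> b \<otimes> l" "b \<in> A" "l \<in> K\<^sub>0"
    unfolding img_def by blast
  obtain m where m: "m \<in> K\<^sub>0" "\<phi> (a \<otimes> b) = \<phi> a \<otimes> \<phi> b \<otimes> m" using phi_mult[of a b] * A by auto
  have c: "\<phi> a \<in> carrier G" "\<phi> b \<in> carrier G" using * A phi_carrier by auto
  have "x \<otimes> y = \<phi> (a \<otimes> b) \<otimes> (inv m \<otimes> (inv (\<phi> b) \<otimes> k \<otimes> \<phi> b) \<otimes> l)"
    unfolding m using * c m(1) by (simp add: word_simps)
  moreover have "inv m \<otimes> (inv (\<phi> b) \<otimes> k \<otimes> \<phi> b) \<otimes> l \<in> K\<^sub>0"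
    using * c m(1) K0.inv_op_closed1 by auto
  moreover have "a \<otimes> b \<in> A" using * by simp
  ultimately show "x \<otimes> y \<in> img A" unfolding img_def by blast
qed

lemma img_I: "a \<in> A \<Longrightarrow> k \<in> K\<^sub>0 \<Longrightarrow> \<phi> a \<otimes> k \<in> img A"
  unfolding img_def by blast

lemma phi_img: "a \<in> A \<Longrightarrow> A \<subseteq> M \<Longrightarrow> \<phi> a \<in> img A"
  using img_I[of a A \<one>] phi_carrier by force

lemma img_mono: "A \<subseteq> B \<Longrightarrow> img A \<subseteq> img B"
  unfolding img_def by blast

lemma K0_img:
  assumes "subgroup A G" "A \<subseteq> M" shows "K\<^sub>0 \<subseteq> img A"
proof
  fix k assume k: "k \<in> K\<^sub>0"
  have c: "\<phi> \<one> \<in> carrier G" using phi_carrier by simp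
  have "k = \<phi> \<one> \<otimes> (inv (\<phi> \<one>) \<otimes> k)" using c k by (simp add: inv_cancel)
  moreover have "inv (\<phi> \<one>) \<otimes> k \<in> K\<^sub>0" using phi_one k by simp
  ultimately show "k \<in> img A" using img_I subgroup.one_closed[OF assms(1)] by metis
qed

lemma img_subset:
  assumes "A \<subseteq> pre W" "subgroup W G" "K\<^sub>0 \<subseteq> W"
  shows "img A \<subseteq> W"
  using assms subgroup.m_closed[OF assms(2)] unfolding img_def pre_def by blast

text \<open>Conjugation turns a value of \<open>\<phi>\<close> into a power of another value, up to
  \<open>K\<^sub>0\<close>. Subgroups are closed under powers, so the exponent does no harm.\<close>

lemma nsub_img:
  assumes A: "nsub A" "A \<subseteq> M"
  shows "nsub (img A)"
proof -
  have sub: "subgroup (img A) G" using subgroup_img nsub_subgroup A by blast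
  interpret I: subgroup "img A" G by (rule sub)
  show ?thesis
  proof (rule nsubI)
    show "img A \<subseteq> P"
    proof
      fix y assume "y \<in> img A"
      then obtain a k where *: "y = \<phi> a \<otimes> k" "a \<in> A" "k \<in> K\<^sub>0"
        unfolding img_def by blast
      have "\<phi> a \<in> P" "k \<in> P" using phi_P * A nsub_subset[OF K0] by auto
      then show "y \<in> P" using subgroup.m_closed[OF P_subgroup] * by simp
    qed
  next
    fix s y assume *: "s \<in> carrier G" "y \<in> img A"
    then obtain a k where y: "y = \<phi> a \<otimes> k" "a \<in> A" "k \<in> K\<^sub>0" unfolding img_def
      by blast
    let ?a = "s \<otimes> a \<otimes> inv s"
    obtain j :: nat and l where l: "l \<in> K\<^sub>0" "s \<otimes> \<phi> a \<otimes> inv s = \<phi> ?a [^] j \<otimes> l"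
      using phi_conj[OF *(1), of a] y(2) A(2) by auto
    have c: "\<phi> a \<in> carrier G" using y A phi_carrier by auto
    have "\<phi> ?a \<in> img A" by (rule phi_img[OF nsub_conj[OF A(1) *(1) y(2)] A(2)])
    then have "\<phi> ?a [^] j \<in> img A" by (induction j) auto
    moreover have "l \<in> img A" "s \<otimes> k \<otimes> inv s \<in> img A"
      using K0_img[OF nsub_subgroup[OF A(1)] A(2)] l K0.inv_op_closed2 * y by auto
    moreover have "s \<otimes> y \<otimes> inv s = (s \<otimes> \<phi> a \<otimes> inv s) \<otimes> (s \<otimes> k \<otimes> inv s)"
      using * y c by (simp add: word_simps)
    ultimately show "s \<otimes> y \<otimes> inv s \<in> img A" unfolding l(2) by simp
  qed auto
qed

lemma phi_cancel:
  assumes "a \<in> M" "g \<in> M" "\<phi> g = \<phi> a \<otimes> k" "k \<in> K\<^sub>0"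
  shows "\<phi> (inv a \<otimes> g) \<in> K\<^sub>0"
proof -
  let ?b = "inv a \<otimes> g"
  have b: "?b \<in> M" using assms by simp
  obtain m where m: "m \<in> K\<^sub>0" "\<phi> (a \<otimes> ?b) = \<phi> a \<otimes> \<phi> ?b \<otimes> m" using phi_mult[OF assms(1) b] by blast
  have "a \<otimes> ?b = g" using assms by (simp add: inv_cancel)
  then have "\<phi> a \<otimes> k = \<phi> a \<otimes> (\<phi> ?b \<otimes> m)"
    using m assms phi_carrier[OF assms(1)] phi_carrier[OF b] by (simp add: m_assoc)
  then have "k = \<phi> ?b \<otimes> m" using assms(4) m(1) phi_carrier[OF assms(1)] phi_carrier[OF b]
    by simp
  then have "\<phi> ?b = k \<otimes> inv m" using m(1) phi_carrier[OF b] by (simp add: m_assoc)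
  then show ?thesis using m assms by simp
qed

lemma pre_img:
  assumes A: "subgroup A G" "A \<subseteq> M" "pre K\<^sub>0 \<subseteq> A"
  shows "pre (img A) = A"
proof
  interpret A: subgroup A G by fact
  show "A \<subseteq> pre (img A)" using phi_img A unfolding pre_def by blast
  show "pre (img A) \<subseteq> A"
  proof
    fix g assume "g \<in> pre (img A)"
    then obtain a k where *: "g \<in> M" "\<phi> g = \<phi> a \<otimes> k" "a \<in> A" "k \<in> K\<^sub>0" unfolding pre_def img_def by blast
    then have "inv a \<otimes> g \<in> A" using phi_cancel[of a g k] A unfolding pre_def by auto
    then have "a \<otimes> (inv a \<otimes> g) \<in> A" using * by blast
    then show "g \<in> A" using * by (simp add: inv_cancel)
  qed
qed

lemma img_pre:
  assumes W: "subgroup W G" "K\<^sub>0 \<subseteq> W" "W \<subseteq> img M"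
  shows "img (pre W) = W"
proof
  interpret W: subgroup W G by fact
  show "img (pre W) \<subseteq> W" using img_subset W by blast
  show "W \<subseteq> img (pre W)"
  proof
    fix w assume w: "w \<in> W"
    then obtain a k where *: "w = \<phi> a \<otimes> k" "a \<in> M" "k \<in> K\<^sub>0" using W
      unfolding img_def by blast
    then have "\<phi> a = w \<otimes> inv k" using phi_carrier by (simp add: m_assoc)
    moreover have "w \<otimes> inv k \<in> W" using w * W by auto
    ultimately have "a \<in> pre W" using * unfolding pre_def by simp
    then show "w \<in> img (pre W)" using * img_I by simp
  qed
qed

lemma subgroup_pre:
  assumes W: "subgroup W G" "K\<^sub>0 \<subseteq> W"
  shows "subgroup (pre W) G"
proof (rule subgroup_finiteI[OF fin])
  interpret W: subgroup W G by fact
  show "pre W \<subseteq> carrier G" unfolding pre_def using M.subset by blast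
  show "\<one> \<in> pre W" unfolding pre_def using phi_one W by auto
  fix x y assume *: "x \<in> pre W" "y \<in> pre W"
  then obtain m where m: "m \<in> K\<^sub>0" "\<phi> (x \<otimes> y) = \<phi> x \<otimes> \<phi> y \<otimes> m"
    using phi_mult unfolding pre_def by blast
  have "\<phi> x \<otimes> \<phi> y \<otimes> m \<in> W" using * m W unfolding pre_def by auto
  then show "x \<otimes> y \<in> pre W" using * m unfolding pre_def by auto
qed

lemma nsub_pre:
  assumes W: "nsub W" "K\<^sub>0 \<subseteq> W"
  shows "nsub (pre W)"
proof (rule nsubI)
  interpret W: normal W G using W by (simp add: nsub_normal)
  interpret pre: subgroup "pre W" G using subgroup_pre W nsub_subgroup by blast
  show "pre W \<subseteq> P" using nsub_subset[OF M] unfolding pre_def by blast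
  show "\<one> \<in> pre W" by simp
  show "x \<otimes> y \<in> pre W" if "x \<in> pre W" "y \<in> pre W" for x y using that by simp
  fix s g assume *: "s \<in> carrier G" "g \<in> pre W"
  let ?g = "s \<otimes> g \<otimes> inv s"
  have g: "?g \<in> M" "g \<in> M" "\<phi> g \<in> W" using * M.inv_op_closed2 unfolding pre_def by auto
  \<comment> \<open>\<open>phi_conj\<close> makes the conjugate of a value a power, but gives no
    converse. It is therefore applied to \<open>inv s\<close> and \<open>?g\<close>, so that the
    power is one of \<open>\<phi> g\<close>, which is known to lie in \<open>W\<close>.\<close>
  have undo: "inv s \<otimes> ?g \<otimes> inv (inv s) = g" using * g by (simp add: word_simps)
  have "inv s \<in> carrier G" using * by simp
  from phi_conj[OF this g(1)] obtain j :: nat and k where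
    k: "k \<in> K\<^sub>0" "inv s \<otimes> \<phi> ?g \<otimes> inv (inv s) = \<phi> g [^] j \<otimes> k"
      unfolding undo by blast
  have "\<phi> g [^] j \<in> W" by (induction j) (use g in auto)
  then have "\<phi> g [^] j \<otimes> k \<in> W" using k W by auto
  then have "s \<otimes> (inv s \<otimes> \<phi> ?g \<otimes> inv (inv s)) \<otimes> inv s \<in> W"
    unfolding k(2) using * W.inv_op_closed2 by blast
  moreover have "s \<otimes> (inv s \<otimes> \<phi> ?g \<otimes> inv (inv s)) \<otimes> inv s = \<phi> ?g"
    using * phi_carrier[OF g(1)] by (simp add: word_simps)
  ultimately have "\<phi> ?g \<in> W" by (simp only:)
  then show "?g \<in> pre W" using g unfolding pre_def by blast
qed

lemma pre_mono: "V \<subseteq> W \<Longrightarrow> pre V \<subseteq> pre W"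
  unfolding pre_def by blast

text \<open>Correspondence theorem for the kernel \<open>pre K\<^sub>0\<close>: above it,
  \<open>pre\<close> undoes \<open>img\<close>, and both preserve normality in \<open>G\<close>. A
  generator of the image over \<open>img B\<close> is some \<open>\<phi> a\<close> up to
  \<open>K\<^sub>0\<close>, and then \<open>a\<close> would generate \<open>A\<close> over
  \<open>B\<close>.\<close>

lemma bad_img:
  assumes AB: "bad A B" and AM: "A \<subseteq> M" and ker: "pre K\<^sub>0 \<subseteq> B"
  shows "bad (img A) (img B)"
proof -
  note L = chiefD[OF badD(1)[OF AB]]
  have BM: "B \<subseteq> M" and kerA: "pre K\<^sub>0 \<subseteq> A" using L(3) AM ker by auto
  note sub = nsub_subgroup[OF L(1)] nsub_subgroup[OF L(2)]
  note inv = pre_img[OF sub(1) AM kerA] pre_img[OF sub(2) BM ker]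
  have "chief (img A) (img B)"
    unfolding chief_def
  proof (intro conjI allI impI)
    show "nsub (img A)" "nsub (img B)" using nsub_img L(1,2) AM BM by auto
    show "img B \<subset> img A" using img_mono[of B A] L(3) inv by auto
    fix D assume D: "nsub D \<and> img B \<subseteq> D \<and> D \<subseteq> img A"
    have KD: "K\<^sub>0 \<subseteq> D" using K0_img[OF sub(2) BM] D by blast
    have "pre D = B \<or> pre D = A"
      using L(4)[OF nsub_pre[of D]] KD D pre_mono[of "img B" D] pre_mono[of D "img A"] inv by blast
    moreover have "img (pre D) = D" using img_pre nsub_subgroup KD D img_mono[OF AM] by blast
    ultimately show "D = img B \<or> D = img A" by auto
  qed
  moreover have False if y: "y \<in> img A" "img A \<subseteq> adjoin G (img B) y" for y
  proof -
    obtain a k where a: "y = \<phi> a \<otimes> k" "a \<in> A" "k \<in> K\<^sub>0" using y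
      unfolding img_def by blast
    have ac: "a \<in> carrier G" using a L(1) nsub_carrier by blast
    let ?D = "adjoin G B a"
    have D: "subgroup ?D G" using subgroup_adjoin_normal[OF fin nsub_normal[OF L(2)] ac] .
    have BD: "B \<subseteq> ?D" "a \<in> ?D"
      using base_subset_adjoin[OF sub(2) ac] mem_adjoin[OF sub(2) ac] by auto
    have DM: "?D \<subseteq> M" using adjoin_subset[OF sub(1)] L(3) a AM by blast
    have "adjoin G (img B) y \<subseteq> img ?D"
      using adjoin_subset[OF subgroup_img[OF D DM], of "img B" y] img_mono[OF BD(1)] img_I BD(2) a by blast
    then have "pre (img A) \<subseteq> pre (img ?D)" using y pre_mono by blast
    then have "A \<subseteq> ?D" using inv pre_img[OF D DM] ker BD by simp
    then show False using badD(2)[OF AB a(2)] by blast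
  qed
  ultimately show ?thesis unfolding bad_def by blast
qed

text \<open>The same correspondence backwards: inside \<open>img M\<close>, \<open>img\<close>
  undoes \<open>pre\<close>, and a generator \<open>g\<close> of the preimage would yield the
  generator \<open>\<phi> g\<close>.\<close>

lemma bad_pre:
  assumes VW: "bad V W" and VM: "V \<subseteq> img M" and K: "K\<^sub>0 \<subseteq> W"
  shows "bad (pre V) (pre W)"
proof -
  note L = chiefD[OF badD(1)[OF VW]]
  have WM: "W \<subseteq> img M" and KV: "K\<^sub>0 \<subseteq> V" using L(3) VM K by auto
  note sub = nsub_subgroup[OF L(1)] nsub_subgroup[OF L(2)]
  note inv = img_pre[OF sub(1) KV VM] img_pre[OF sub(2) K WM]
  have "chief (pre V) (pre W)"
    unfolding chief_def
  proof (intro conjI allI impI)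
    show "nsub (pre V)" "nsub (pre W)" using nsub_pre L(1,2) K KV by auto
    show "pre W \<subset> pre V" using pre_mono[of W V] L(3) inv by auto
    fix D assume D: "nsub D \<and> pre W \<subseteq> D \<and> D \<subseteq> pre V"
    have DM: "D \<subseteq> M" "pre K\<^sub>0 \<subseteq> D" using D pre_mono[OF K] unfolding pre_def
      by auto
    have "img D = W \<or> img D = V"
      using L(4)[OF nsub_img[of D]] DM D img_mono[of "pre W" D] img_mono[of D "pre V"] inv by blast
    moreover have "pre (img D) = D" using pre_img nsub_subgroup DM D by blast
    ultimately show "D = pre W \<or> D = pre V" by auto
  qed
  moreover have False if g: "g \<in> pre V" "pre V \<subseteq> adjoin G (pre W) g" for g
  proof -
    have g': "g \<in> M" "\<phi> g \<in> V" using g unfolding pre_def by auto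
    have gc: "\<phi> g \<in> carrier G" using g' phi_carrier by blast
    let ?D = "adjoin G W (\<phi> g)"
    have D: "subgroup ?D G" using subgroup_adjoin_normal[OF fin nsub_normal[OF L(2)] gc] .
    have WD: "W \<subseteq> ?D" "\<phi> g \<in> ?D"
      using base_subset_adjoin[OF sub(2) gc] mem_adjoin[OF sub(2) gc] by auto
    then have KD: "K\<^sub>0 \<subseteq> ?D" using K by blast
    have "g \<in> pre ?D" using g' WD unfolding pre_def by blast
    then have "adjoin G (pre W) g \<subseteq> pre ?D"
      using adjoin_subset[OF subgroup_pre[OF D KD] pre_mono[OF WD(1)]] by blast
    then have "img (pre V) \<subseteq> ?D" using g img_subset[OF _ D KD] by blast
    then show False using inv badD(2)[OF VW g'(2)] by simp
  qed
  ultimately show ?thesis unfolding bad_def by blast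
qed

end

section \<open>Commutator subgroups and the \<open>\<Pi>\<close>-property\<close>

context group
begin

lemma commutator_subgroup_subgroup:
  assumes "subgroup H G"
  shows "subgroup (commutator_subgroup G H (carrier G)) G"
proof -
  interpret H: subgroup H G by fact
  show ?thesis unfolding commutator_subgroup_def by (rule generate_is_subgroup) auto
qed

lemma commutator_generator:
  assumes "h \<in> H" "g \<in> carrier G"
  shows "inv h \<otimes> inv g \<otimes> h \<otimes> g \<in> commutator_subgroup G H (carrier G)"
  unfolding commutator_subgroup_def by (rule generate.incl) (use assms in blast)

text \<open>Passes to the commutator form used in the centrality conditions: it is the inverse of
  the generator belonging to \<open>inv h\<close> and \<open>inv g\<close>.\<close>

lemma commutator_mem:
  assumes H: "subgroup H G" "h \<in> H" and g: "g \<in> carrier G"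
  shows "g \<otimes> h \<otimes> inv g \<otimes> inv h \<in> commutator_subgroup G H (carrier G)"
proof -
  interpret H: subgroup H G by fact
  interpret C: subgroup "commutator_subgroup G H (carrier G)" G
    by (rule commutator_subgroup_subgroup[OF H(1)])
  have "inv (inv (inv h) \<otimes> inv (inv g) \<otimes> inv h \<otimes> inv g) \<in> commutator_subgroup G H (carrier G)"
    using H g by (intro C.m_inv_closed commutator_generator) auto
  moreover have "inv (inv (inv h) \<otimes> inv (inv g) \<otimes> inv h \<otimes> inv g) = g \<otimes> h \<otimes> inv g \<otimes> inv h"
    using H g by (simp add: word_simps)
  ultimately show ?thesis by (simp only:)
qed

lemma commutator_least:
  assumes D: "D \<lhd> G" "H \<subseteq> D"
  shows "commutator_subgroup G H (carrier G) \<subseteq> D"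
  unfolding commutator_subgroup_def
proof (rule generate_subgroup_incl)
  interpret D: normal D G by fact
  show "{inv h \<otimes> inv g \<otimes> h \<otimes> g | h g. h \<in> H \<and> g \<in> carrier G} \<subseteq> D"
  proof
    fix x assume "x \<in> {inv h \<otimes> inv g \<otimes> h \<otimes> g | h g. h \<in> H \<and> g \<in> carrier G}"
    then obtain h g where *: "x = inv h \<otimes> inv g \<otimes> h \<otimes> g" "h \<in> D" "g \<in> carrier G" using D by blast
    then have "x = inv h \<otimes> (inv g \<otimes> h \<otimes> g)" by (simp add: m_assoc)
    then show "x \<in> D" using * D.inv_op_closed1 by simp
  qed
qed (rule normal_imp_subgroup[OF D(1)])

lemma commutator_normal:
  assumes fin: "finite (carrier G)" and H: "subgroup H G"
  shows "commutator_subgroup G H (carrier G) \<lhd> G"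
proof (rule normal_invI)
  let ?C = "commutator_subgroup G H (carrier G)"
  interpret H: subgroup H G by fact
  show C: "subgroup ?C G" by (rule commutator_subgroup_subgroup[OF H])
  interpret C: subgroup ?C G by (rule C)
  \<comment> \<open>It suffices to check generators, because the elements with all conjugates in
    \<open>?C\<close> form a subgroup.\<close>
  let ?W = "{x \<in> carrier G. \<forall>t\<in>carrier G. t \<otimes> x \<otimes> inv t \<in> ?C}"
  have "subgroup ?W G"
  proof (rule subgroup_finiteI[OF fin])
    fix x y assume *: "x \<in> ?W" "y \<in> ?W"
    have "t \<otimes> (x \<otimes> y) \<otimes> inv t \<in> ?C" if t: "t \<in> carrier G" for t
    proof -
      have "t \<otimes> (x \<otimes> y) \<otimes> inv t = (t \<otimes> x \<otimes> inv t) \<otimes> (t \<otimes> y \<otimes> inv t)"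
        using * t by (simp add: word_simps)
      then show ?thesis using * t C.m_closed by auto
    qed
    then show "x \<otimes> y \<in> ?W" using * by auto
  qed auto
  moreover have "{inv h \<otimes> inv g \<otimes> h \<otimes> g | h g. h \<in> H \<and> g \<in> carrier G} \<subseteq> ?W"
  proof
    fix x assume "x \<in> {inv h \<otimes> inv g \<otimes> h \<otimes> g | h g. h \<in> H \<and> g \<in> carrier G}"
    then obtain h g where *: "x = inv h \<otimes> inv g \<otimes> h \<otimes> g" "h \<in> H" "g \<in> carrier G" by blast
    have "t \<otimes> x \<otimes> inv t \<in> ?C" if t: "t \<in> carrier G" for t
    proof -
      \<comment> \<open>Conjugating \<open>h\<close> could lead out of \<open>H\<close>. Instead the
        conjugate of [h,g] by \<open>t\<close> is the inverse of [h,t^-1] times [h,gt^-1], with the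
        same \<open>h\<close>.\<close>
      have "inv (inv h \<otimes> inv (inv t) \<otimes> h \<otimes> inv t) \<in> ?C"
        using * t by (intro C.m_inv_closed commutator_generator) auto
      moreover have "inv h \<otimes> inv (g \<otimes> inv t) \<otimes> h \<otimes> (g \<otimes> inv t) \<in> ?C"
        using * t by (intro commutator_generator) auto
      ultimately have "inv (inv h \<otimes> inv (inv t) \<otimes> h \<otimes> inv t) \<otimes>
          (inv h \<otimes> inv (g \<otimes> inv t) \<otimes> h \<otimes> (g \<otimes> inv t)) \<in> ?C" by (rule C.m_closed)
      moreover have "inv (inv h \<otimes> inv (inv t) \<otimes> h \<otimes> inv t) \<otimes>
          (inv h \<otimes> inv (g \<otimes> inv t) \<otimes> h \<otimes> (g \<otimes> inv t)) = t \<otimes> x \<otimes> inv t"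
        using * t by (simp add: word_simps)
      ultimately show ?thesis by (simp only:)
    qed
    then show "x \<in> ?W" using * by auto
  qed
  ultimately have sub: "?C \<subseteq> ?W"
    unfolding commutator_subgroup_def by (intro generate_subgroup_incl)
  fix g h assume "g \<in> carrier G" "h \<in> ?C"
  then show "g \<otimes> h \<otimes> inv g \<in> ?C" using sub by blast
qed

end

section \<open>Chief factors and normalizers in the quotient \<open>G Mod K\<close>\<close>

context normal_p_subgroup
begin

abbreviation coset_set :: "'a set \<Rightarrow> 'a set \<Rightarrow> 'a set set"
  where "coset_set K A \<equiv> (\<lambda>x. K #> x) ` A"

lemma subgroup_quotient_eq: "subgroup_quotient G L K = coset_set K L"
  unfolding subgroup_quotient_def carrier_FactGroup by simp

lemma coset_set_subset_iff:
  assumes K: "subgroup K G" and D: "subgroup D G" "K \<subseteq> D" and A: "A \<subseteq> carrier G"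
  shows "coset_set K A \<subseteq> coset_set K D \<longleftrightarrow> A \<subseteq> D"
proof
  interpret D: subgroup D G by fact
  assume sub: "coset_set K A \<subseteq> coset_set K D"
  show "A \<subseteq> D"
  proof
    fix x assume x: "x \<in> A"
    then obtain y where y: "y \<in> D" "K #> x = K #> y" using sub by blast
    then have "x \<otimes> inv y \<in> D" using rcoset_eq_iff[OF K, of x y] x A D by auto
    then have "x \<otimes> inv y \<otimes> y \<in> D" using y by blast
    moreover have "x \<otimes> inv y \<otimes> y = x" using x y A by (auto simp: m_assoc)
    ultimately show "x \<in> D" by simp
  qed
qed blast

lemma coset_set_normal:
  assumes "nsub K" "nsub D" "K \<subseteq> D"
  shows "coset_set K D \<lhd> G Mod K"
proof -
  have "rcosets\<^bsub>G\<lparr>carrier := D\<rparr>\<^esub> K = coset_set K D" unfolding RCOSETS_def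
    by auto
  then show ?thesis using normality_factorization[of K D] assms by (simp add: nsub_def)
qed

lemma coset_set_self:
  assumes "subgroup K G" shows "coset_set K K = {K}"
  using subgroup.rcos_const[OF assms group_axioms] subgroup.one_closed[OF assms] by auto

text \<open>Correspondence theorem: a normal subgroup of the quotient is the set of cosets of its
  union, and this union is normal in \<open>G\<close>.\<close>

lemma chief_imp_chief_factor:
  assumes LK: "chief L K"
  shows "chief_factor G L K"
proof -
  note L = chiefD[OF LK]
  interpret K: normal K G using L(2) by (rule nsub_normal)
  note sub = nsub_subgroup[OF L(1)] nsub_subgroup[OF L(2)]
  have LG: "L \<subseteq> carrier G" using sub(1) by (rule subgroup.subset)
  show ?thesis
    unfolding chief_factor_def minimal_normal_def subgroup_quotient_eq one_FactGroup
  proof (intro conjI allI impI)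
    show "L \<lhd> G" "K \<lhd> G" "K \<subseteq> L" using L(1-3) nsub_normal by auto
    show "coset_set K L \<lhd> G Mod K" using coset_set_normal[OF L(2,1)] L(3) by auto
    show "coset_set K L \<noteq> {K}"
    proof -
      have "\<not> coset_set K L \<subseteq> coset_set K K"
        using coset_set_subset_iff[OF sub(2) sub(2) subset_refl LG] L(3) by blast
      then show ?thesis unfolding coset_set_self[OF sub(2)] by auto
    qed
    fix M assume M: "M \<lhd> G Mod K \<and> M \<subseteq> coset_set K L"
    let ?D = "\<Union>M"
    have Msub: "subgroup M (G Mod K)" using M normal_imp_subgroup by blast
    have D: "?D \<lhd> G" using M K.factgroup_subgroup_union_normal by blast
    have "rcosets\<^bsub>G\<lparr>carrier := ?D\<rparr>\<^esub> K = coset_set K ?D" unfolding RCOSETS_def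
      by auto
    with K.factgroup_subgroup_union_factor[OF Msub] have MD: "M = coset_set K ?D" by (rule trans)
    have "K \<in> M" using subgroup.one_closed[OF Msub] by simp
    then have KD: "K \<subseteq> ?D" by blast
    have "?D \<subseteq> L"
    proof -
      have "coset_set K ?D \<subseteq> coset_set K L" using M by (subst MD[symmetric]) blast
      then show ?thesis
        using coset_set_subset_iff[OF sub(2) sub(1) psubset_imp_subset[OF L(3)]
            subgroup.subset[OF normal_imp_subgroup[OF D]]] by blast
    qed
    then have "?D = K \<or> ?D = L" using L(4)[of ?D] D KD nsub_subset[OF L(1)] by (auto simp: nsub_def)
    then show "M = {K} \<or> M = coset_set K L" using MD coset_set_self[OF sub(2)] by metis
  qed
qed

lemma chief_factor_imp_chief:
  assumes LK: "chief_factor G L K" and LP: "L \<subseteq> P"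
  shows "chief L K"
proof -
  have n: "nsub L" "nsub K" "K \<subseteq> L" using LK LP unfolding chief_factor_def nsub_def by auto
  note sub = nsub_subgroup[OF n(1)] nsub_subgroup[OF n(2)]
  have min: "coset_set K L \<noteq> {K}"
    "\<And>M. M \<lhd> G Mod K \<Longrightarrow> M \<subseteq> coset_set K L \<Longrightarrow> M = {K} \<or> M = coset_set K L"
    using LK unfolding chief_factor_def minimal_normal_def subgroup_quotient_eq one_FactGroup by auto
  show ?thesis
    unfolding chief_def
  proof (intro conjI allI impI n)
    show "K \<subset> L" using n(3) min(1) coset_set_self[OF sub(2)] by auto
    fix D assume D: "nsub D \<and> K \<subseteq> D \<and> D \<subseteq> L"
    then have sD: "subgroup D G" using nsub_subgroup by blast
    have "coset_set K D = {K} \<or> coset_set K D = coset_set K L"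
      using min(2)[OF coset_set_normal[OF n(2)]] D by blast
    then show "D = K \<or> D = L"
    proof
      assume "coset_set K D = {K}"
      then have "D \<subseteq> K"
        using coset_set_subset_iff[OF sub(2) sub(2), of D] coset_set_self[OF sub(2)] subgroup.subset[OF sD] by auto
      then show ?thesis using D by blast
    next
      assume "coset_set K D = coset_set K L"
      then have "L \<subseteq> D"
        using coset_set_subset_iff[OF sub(2) sD, of L] D subgroup.subset[OF sub(1)] by auto
      then show ?thesis using D by blast
    qed
  qed
qed

lemma conj_image_eq:
  assumes "g \<in> carrier G" "Y \<subseteq> carrier G" "\<And>y. y \<in> Y \<Longrightarrow> g \<otimes> y \<otimes> inv g \<in> Y"
  shows "(\<lambda>y. g \<otimes> y \<otimes> inv g) ` Y = Y"
proof (rule endo_inj_surj)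
  show "finite Y" using assms fin finite_subset by blast
  show "inj_on (\<lambda>y. g \<otimes> y \<otimes> inv g) Y"
  proof (rule inj_onI)
    fix x y assume *: "x \<in> Y" "y \<in> Y" "g \<otimes> x \<otimes> inv g = g \<otimes> y \<otimes> inv g"
    then have "x \<in> carrier G" "y \<in> carrier G" using assms(2) by auto
    then show "x = y" using *(3) assms(1) by simp
  qed
qed (use assms in blast)

text \<open>Invariance in one direction suffices, because conjugation is injective and maps a finite
  set into itself.\<close>

lemma normalizer_coset_set_iff:
  assumes K: "nsub K" and Y: "subgroup Y G" "K \<subseteq> Y" and g: "g \<in> carrier G"
  shows "K #> g \<in> normalizer (G Mod K) (coset_set K Y) \<longleftrightarrow> (\<forall>y\<in>Y. g \<otimes> y \<otimes> inv g \<in> Y)"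
proof -
  interpret K: normal K G using K by (rule nsub_normal)
  interpret Y: subgroup Y G by fact
  let ?I = "coset_set K Y" and ?f = "\<lambda>y. g \<otimes> y \<otimes> inv g"
  have I: "?I \<subseteq> carrier (G Mod K)" using Y.subset by (auto simp: carrier_FactGroup)
  have inv: "inv\<^bsub>G Mod K\<^esub> (K #> g) = K #> inv g"
    using K.inv_FactGroup K.rcos_inv g by (simp add: carrier_FactGroup)
  have conj: "(K #> g) <#\<^bsub>G Mod K\<^esub> ?I #>\<^bsub>G Mod K\<^esub> inv\<^bsub>G Mod K\<^esub> (K #> g) = coset_set K (?f ` Y)"
  proof -
    have "(K #> g) <#\<^bsub>G Mod K\<^esub> ?I #>\<^bsub>G Mod K\<^esub> inv\<^bsub>G Mod K\<^esub> (K #> g)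
        = (\<lambda>y. (K #> g) <#> (K #> y) <#> (K #> inv g)) ` Y"
      unfolding inv l_coset_def r_coset_def[of "G Mod K"] by auto
    also have "\<dots> = (\<lambda>y. K #> ?f y) ` Y"
      by (rule image_cong) (use g Y.subset in \<open>auto simp: K.rcos_sum\<close>)
    finally show ?thesis by (simp add: image_image)
  qed
  have "K #> g \<in> normalizer (G Mod K) ?I \<longleftrightarrow> coset_set K (?f ` Y) = ?I"
    unfolding normalizer_def stabilizer_def using I g conj by (auto simp: carrier_FactGroup)
  also have "\<dots> \<longleftrightarrow> (\<forall>y\<in>Y. ?f y \<in> Y)"
  proof
    assume "coset_set K (?f ` Y) = ?I"
    moreover have "?f ` Y \<subseteq> carrier G" using g by auto
    ultimately have "?f ` Y \<subseteq> Y"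
      using coset_set_subset_iff[OF K.is_subgroup Y, of "?f ` Y"] by blast
    then show "\<forall>y\<in>Y. ?f y \<in> Y" by blast
  next
    assume "\<forall>y\<in>Y. ?f y \<in> Y"
    then show "coset_set K (?f ` Y) = ?I" using conj_image_eq[OF g Y.subset] by simp
  qed
  finally show ?thesis .
qed

end

section \<open>Sylow subgroups and the index of a normalizer\<close>

locale normal_p_subgroup_Sylow = normal_p_subgroup +
  fixes S :: "'a set" and m :: nat
  assumes S: "subgroup S G" and S_card: "\<exists>a. card S = p ^ a"
    and S_index: "card (carrier G) = card S * m" "\<not> p dvd m"
begin

definition S_inv :: "'a set \<Rightarrow> bool"
  where "S_inv A \<longleftrightarrow> (\<forall>s\<in>S. \<forall>a\<in>A. s \<otimes> a \<otimes> inv s \<in> A)"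

text \<open>The index of the normalizer divides the \<open>p'\<close>-number \<open>m\<close>, as the normalizer contains \<open>S\<close>, while
  the \<open>\<Pi>\<close>-property makes it a power of \<open>p\<close>.\<close>

lemma Pi_property_normal:
  assumes Pi: "Pi_property G H" and H: "subgroup H G" and LK: "chief L K"
    and inv: "S_inv ((H <#> K) \<inter> L)"
  shows "nsub ((H <#> K) \<inter> L)"
proof -
  note L = chiefD[OF LK]
  interpret K: normal K G using L(2) by (rule nsub_normal)
  interpret Q: group "G Mod K" by (rule K.factorgroup_is_group)
  define Y where "Y = (H <#> K) \<inter> L"
  have HK: "subgroup (H <#> K) G"
    using mult_norm_subgroup[OF K.normal_axioms H] commut_normal[OF H K.normal_axioms] by simp
  have Y: "subgroup Y G" unfolding Y_def using subgroups_Inter_pair HK nsub_subgroup[OF L(1)] by blast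
  interpret Y: subgroup Y G by (rule Y)
  have KY: "K \<subseteq> Y" unfolding Y_def using set_mult_supset[OF H K.is_subgroup] L(3) by blast
  have YP: "Y \<subseteq> P" unfolding Y_def using nsub_subset[OF L(1)] by blast
  have I: "coset_set K (H <#> K) \<inter> coset_set K L = coset_set K Y"
  proof
    show "coset_set K (H <#> K) \<inter> coset_set K L \<subseteq> coset_set K Y"
    proof
      fix c assume c: "c \<in> coset_set K (H <#> K) \<inter> coset_set K L"
      then obtain x where x: "x \<in> H <#> K" "c = K #> x" by blast
      have "coset_set K {x} \<subseteq> coset_set K L" using c x by simp
      then have "x \<in> L"
        using coset_set_subset_iff[OF K.is_subgroup nsub_subgroup[OF L(1)], of "{x}"] L(3) x
          subgroup.mem_carrier[OF HK x(1)] by auto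
      then show "c \<in> coset_set K Y" using x unfolding Y_def by blast
    qed
  qed (auto simp: Y_def)
  define N where "N = normalizer (G Mod K) (coset_set K Y)"
  have N: "subgroup N (G Mod K)" unfolding N_def
    by (rule Q.normalizer_imp_subgroup) (use Y.subset in \<open>auto simp: carrier_FactGroup\<close>)
  have ND: "K #> g \<in> N \<longleftrightarrow> (\<forall>y\<in>Y. g \<otimes> y \<otimes> inv g \<in> Y)" if "g \<in> carrier G" for g
    unfolding N_def using normalizer_coset_set_iff[OF L(2) Y KY that] .
  \<comment> \<open>The full preimage of the normalizer: orders are compared in \<open>G\<close>,
    because that is where \<open>S\<close> lies.\<close>
  let ?D = "{x \<in> carrier G. K #> x \<in> N}" and ?idx = "card (rcosets\<^bsub>G Mod K\<^esub> N)"
  have D: "subgroup ?D G"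
    using K.factgroup_subgroup_union_subgroup[OF N] K.factgroup_subgroup_union_char[OF N] by simp
  have NK: "coset_set K ?D = N" using subgroup.subset[OF N] by (auto simp: carrier_FactGroup)
  have KD: "K \<subseteq> ?D"
  proof
    fix k assume "k \<in> K"
    then have "K #> k = \<one>\<^bsub>G Mod K\<^esub>" using K.rcos_const by simp
    then show "k \<in> ?D" using subgroup.one_closed[OF N] \<open>k \<in> K\<close> by simp
  qed
  have "card N * card K = card ?D" using card_cosets[OF K.is_subgroup D KD] NK by simp
  moreover have "?idx * card N = card (coset_set K (carrier G))"
    using Q.lagrange[OF N] by (simp add: order_def carrier_FactGroup)
  moreover have "card (coset_set K (carrier G)) * card K = card (carrier G)"
    using card_cosets[OF K.is_subgroup subgroup_self K.subset] .
  ultimately have idx: "?idx * card ?D = card S * m" using S_index(1) by (metis mult.assoc)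
  have SD: "S \<subseteq> ?D" using ND subgroup.subset[OF S] inv unfolding S_inv_def Y_def by auto
  obtain e where e: "card ?D = e * card S" using card_cosets[OF S D SD, symmetric] by blast
  have S0: "card S > 0" using finite_subgroup[OF S] subgroup.one_closed[OF S] by (auto simp: card_gt_0_iff)
  have "?idx * e = m" using idx S0 unfolding e by (simp add: ac_simps)
  then have p_idx: "\<not> p dvd ?idx" using S_index(2) by auto
  have "pi_number (prime_factors (card (coset_set K Y))) ?idx"
    using Pi[unfolded Pi_property_def subgroup_quotient_eq Let_def, rule_format, OF chief_imp_chief_factor[OF LK]]
    unfolding I N_def .
  then have pi: "?idx > 0" "prime_factors ?idx \<subseteq> prime_factors (card (coset_set K Y))"
    unfolding pi_number_def by auto
  have "card (coset_set K Y) dvd card Y" using card_cosets[OF K.is_subgroup Y KY] dvd_triv_left by metis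
  moreover obtain l where l: "card Y = p ^ l" using subgroup_p_card[OF Y YP] by blast
  ultimately have dvd: "card (coset_set K Y) dvd p ^ l" by simp
  have "q = p" if q: "q \<in> prime_factors (card (coset_set K Y))" for q
  proof -
    have "Factorial_Ring.prime q" "q dvd p ^ l"
      using q dvd by (auto intro: dvd_trans dest: in_prime_factors_imp_prime in_prime_factors_imp_dvd)
    then show ?thesis using prime_dvd_power prime_p primes_dvd_imp_eq by blast
  qed
  then have "prime_factors ?idx \<subseteq> {p}" using pi(2) by blast
  moreover have "p \<notin> prime_factors ?idx" using p_idx in_prime_factors_imp_dvd by blast
  ultimately have "prime_factors ?idx = {}" by blast
  \<comment> \<open>Zero also has no prime factors; the positivity in \<open>pi_number\<close>
    excludes it.\<close>
  then have "?idx = 1" using pi(1) by (simp add: prime_factorization_empty_iff)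
  then have "card ?D = card (carrier G)" using idx S_index by simp
  then have "?D = carrier G" using fin card_subset_eq[of "carrier G" ?D] by simp
  then have "g \<otimes> y \<otimes> inv g \<in> Y" if "g \<in> carrier G" "y \<in> Y" for g y
    using ND that by blast
  then have "nsub Y" using YP Y normal_invI unfolding nsub_def by blast
  then show ?thesis unfolding Y_def .
qed

end

section \<open>Sylow-invariant sections\<close>

lemma (in group) adjoin_conj_closed:
  assumes D: "subgroup (adjoin G C t) G" and C: "C \<subseteq> carrier G" and t: "t \<in> carrier G"
    and s: "s \<in> carrier G"
      and Cs: "\<And>c. c \<in> C \<Longrightarrow> s \<otimes> c \<otimes> inv s \<in> adjoin G C t"
    and ts: "s \<otimes> t \<otimes> inv s \<in> adjoin G C t" and y: "y \<in> adjoin G C t"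
  shows "s \<otimes> y \<otimes> inv s \<in> adjoin G C t"
proof -
  interpret D: subgroup "adjoin G C t" G by (rule D)
  obtain c i where ci: "c \<in> C" "y = c \<otimes> t [^] (i::nat)" using y by (elim adjoinE)
  have cc: "c \<in> carrier G" using ci C by blast
  have pow: "(s \<otimes> t \<otimes> inv s) [^] i \<in> adjoin G C t" by (induction i) (use ts in auto)
  have "s \<otimes> y \<otimes> inv s = (s \<otimes> c \<otimes> inv s) \<otimes> (s \<otimes> t [^] i \<otimes> inv s)"
    using ci cc s t by (simp add: word_simps)
  then show ?thesis using Cs[OF ci(1)] pow unfolding conj_nat_pow[OF s t] by simp
qed

context normal_p_subgroup
begin

lemma adjoin_props:
  assumes K: "nsub K" and t: "t \<in> carrier G"
  shows "subgroup (adjoin G K t) G" "K \<subseteq> adjoin G K t" "t \<in> adjoin G K t"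
  using subgroup_adjoin_normal[OF fin nsub_normal[OF K] t]
    base_subset_adjoin[OF nsub_subgroup[OF K] t] mem_adjoin[OF nsub_subgroup[OF K] t] by auto

text \<open>If all conjugates of \<open>t\<close> stayed in \<open>adjoin G K t\<close>, this
  subgroup would be normal in \<open>G\<close> and larger than \<open>K\<close>, hence equal to
  \<open>L\<close>, and \<open>L/K\<close> would be cyclic.\<close>

lemma bad_conj:
  assumes LK: "bad L K" and t: "t \<in> L" "t \<notin> K"
  shows "\<exists>g\<in>carrier G. g \<otimes> t \<otimes> inv g \<notin> adjoin G K t"
proof (rule ccontr)
  assume no: "\<not> ?thesis"
  note L = chiefD[OF badD(1)[OF LK]]
  have tc: "t \<in> carrier G" using nsub_carrier[OF L(1) t(1)] .
  note D = adjoin_props[OF L(2) tc]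
  have KG: "K \<subseteq> carrier G" using nsub_carrier[OF L(2)] by blast
  have DL: "adjoin G K t \<subseteq> L" using adjoin_subset[OF nsub_subgroup[OF L(1)]] L(3) t by blast
  have "g \<otimes> y \<otimes> inv g \<in> adjoin G K t"
    if "g \<in> carrier G" "y \<in> adjoin G K t" for g y
    by (rule adjoin_conj_closed[OF D(1) KG tc that(1) _ _ that(2)])
      (use no that(1) nsub_conj[OF L(2) that(1)] D(2) in auto)
  then have "nsub (adjoin G K t)"
    using normal_invI[OF D(1)] DL nsub_subset[OF L(1)] by (simp add: nsub_def)
  then have "adjoin G K t = L" using L(4)[OF _ D(2) DL] D(3) t by blast
  then show False using badD(2)[OF LK t(1)] by blast
qed

text \<open>This makes the passage from \<open>H\<close> to \<open>H \<inter> [H,G]\<close>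
  harmless: \<open>[H,G]\<close> is not inside \<open>K\<close> once \<open>H\<close> meets
  \<open>L\<close> outside \<open>K\<close>.\<close>

lemma bad_commutator:
  assumes LK: "bad L K" and t: "t \<in> L" "t \<notin> K"
  shows "\<exists>g\<in>carrier G. g \<otimes> t \<otimes> inv g \<otimes> inv t \<notin> K"
proof -
  note L = chiefD[OF badD(1)[OF LK]]
  have tc: "t \<in> carrier G" using nsub_carrier[OF L(1) t(1)] .
  note D = adjoin_props[OF L(2) tc]
  obtain g where g: "g \<in> carrier G" "g \<otimes> t \<otimes> inv g \<notin> adjoin G K t"
    using bad_conj[OF assms] by blast
  have "g \<otimes> t \<otimes> inv g \<otimes> inv t \<notin> K"
  proof
    assume "g \<otimes> t \<otimes> inv g \<otimes> inv t \<in> K"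
    then have "g \<otimes> t \<otimes> inv g \<otimes> inv t \<otimes> t \<in> adjoin G K t"
      using D subgroup.m_closed[OF D(1)] by blast
    then show False using g tc by (simp add: m_assoc)
  qed
  then show ?thesis using g by blast
qed

lemma chief_conj:
  assumes LK: "chief L K" and C: "subgroup C G" "K \<subseteq> C" "C \<subseteq> L" and b: "b \<in> L"
    and c: "c \<in> C"
  shows "b \<otimes> c \<otimes> inv b \<in> C"
proof -
  note L = chiefD[OF LK]
  interpret C: subgroup C G by fact
  have "b \<otimes> c \<otimes> inv b \<otimes> inv c \<in> C"
    using chief_central[OF LK, of c b] C c b nsub_subset[OF L(1)] by blast
  then have "b \<otimes> c \<otimes> inv b \<otimes> inv c \<otimes> c \<in> C" using c by blast
  then show ?thesis using c nsub_carrier[OF L(1) b] by (simp add: m_assoc)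
qed

end

context normal_p_subgroup_Sylow
begin

lemma S_carrier: "s \<in> S \<Longrightarrow> s \<in> carrier G"
  using subgroup.mem_carrier[OF S] .

lemma S_inv_normal: "nsub A \<Longrightarrow> S_inv A"
  unfolding S_inv_def using nsub_conj S_carrier by blast

text \<open>\<open>L\<close> normalizes \<open>A\<close>, as \<open>L/K\<close> is centralized by
  \<open>P\<close>. A coset of \<open>A\<close> fixed by \<open>S\<close> supplies \<open>g\<close>,
  and fixedness makes the larger subgroup invariant; the order grows by the factor \<open>p\<close>
  since \<open>L/K\<close> has exponent \<open>p\<close>.\<close>

lemma S_inv_extend:
  assumes LK: "chief L K" and A: "subgroup A G" "K \<subseteq> A" "A \<subset> L" "S_inv A"
  shows "\<exists>g\<in>L - A. subgroup (adjoin G A g) G \<and> adjoin G A g \<subseteq> L \<and> S_inv (adjoin G A g)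
    \<and> card (adjoin G A g) = p * card A"
proof -
  note L = chiefD[OF LK]
  have LP: "L \<subseteq> P" using nsub_subset[OF L(1)] .
  have AL: "A \<subseteq> L" using A(3) by blast
  have norm: "b \<otimes> a \<otimes> inv b \<in> A" if "b \<in> L" "a \<in> A" for b a
    using chief_conj[OF LK A(1,2) AL that] .
  have "\<exists>g\<in>L - A. \<forall>s\<in>S. s \<otimes> g \<otimes> inv s \<otimes> inv g \<in> A"
    by (rule fixed_coset[OF S S_card A(1) nsub_subgroup[OF L(1)] A(3) LP norm])
      (use A(4) S_inv_normal[OF L(1)] in \<open>auto simp: S_inv_def\<close>)
  then obtain g where g: "g \<in> L" "g \<notin> A" "\<And>s. s \<in> S \<Longrightarrow> s \<otimes> g \<otimes> inv s \<otimes> inv g \<in> A" by blast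
  have gc: "g \<in> carrier G" using nsub_carrier[OF L(1) g(1)] .
  have D: "subgroup (adjoin G A g) G" by (rule subgroup_adjoin[OF fin A(1) gc norm[OF g(1)]])
  have AD: "A \<subseteq> adjoin G A g" "g \<in> adjoin G A g"
    using base_subset_adjoin mem_adjoin A(1) gc by auto
  have AG: "A \<subseteq> carrier G" using subgroup.subset[OF A(1)] .
  have "s \<otimes> y \<otimes> inv s \<in> adjoin G A g" if s: "s \<in> S" "y \<in> adjoin G A g" for s y
  proof (rule adjoin_conj_closed[OF D AG gc S_carrier[OF s(1)] _ _ s(2)])
    show "s \<otimes> c \<otimes> inv s \<in> adjoin G A g" if "c \<in> A" for c
      using A(4) AD s that unfolding S_inv_def by blast
    have "s \<otimes> g \<otimes> inv s \<otimes> inv g \<otimes> g \<in> adjoin G A g"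
      using subgroup.m_closed[OF D] g(3)[OF s(1)] AD by blast
    then show "s \<otimes> g \<otimes> inv s \<in> adjoin G A g" using gc S_carrier[OF s(1)]
      by (simp add: m_assoc)
  qed
  then have "S_inv (adjoin G A g)" unfolding S_inv_def by blast
  moreover have "card (adjoin G A g) = p * card A"
    by (rule card_adjoin[OF A(1) _ _ g(2) _ norm[OF g(1)]])
      (use AL LP g(1) chief_pow[OF LK g(1)] A(2) in auto)
  moreover have "adjoin G A g \<subseteq> L" using adjoin_subset[OF nsub_subgroup[OF L(1)] AL g(1)] .
  ultimately show ?thesis using D g by blast
qed

lemma S_inv_between:
  assumes LK: "chief L K" and d: "\<exists>k. d = p ^ k" "card K \<le> d" "d \<le> card L"
  shows "\<exists>A. subgroup A G \<and> K \<subseteq> A \<and> A \<subseteq> L \<and> S_inv A \<and> card A = d"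
proof -
  note L = chiefD[OF LK]
  let ?P = "\<lambda>A. subgroup A G \<and> K \<subseteq> A \<and> A \<subseteq> L \<and> S_inv A \<and> card A \<le> d"
  have "?P K" using L(1-3) d nsub_subgroup S_inv_normal by auto
  then obtain A where A: "?P A" "\<And>B. ?P B \<Longrightarrow> card B \<le> card A"
    using ex_has_greatest_nat[of ?P K card "Suc d"] by (auto simp: less_Suc_eq_le)
  have "card A = d"
  proof (rule ccontr)
    assume "card A \<noteq> d"
    then have lt: "card A < d" using A by simp
    then have AL: "A \<subset> L" using A d by auto
    obtain g where g: "subgroup (adjoin G A g) G" "adjoin G A g \<subseteq> L" "S_inv (adjoin G A g)"
      "card (adjoin G A g) = p * card A" "g \<in> L"
      using S_inv_extend[OF LK _ _ AL] A by blast
    have "p * card A \<le> d"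
      using p_power_less(1)[OF _ d(1) lt] subgroup_p_card[of A] A nsub_subset[OF L(1)] by blast
    moreover have "K \<subseteq> adjoin G A g"
      using base_subset_adjoin[of A g] A nsub_carrier[OF L(1) g(5)] by blast
    ultimately have "p * card A \<le> card A" using A(2)[of "adjoin G A g"] g by auto
    moreover have "card A > 0"
      using A finite_subgroup[of A] subgroup.one_closed[of A G] by (auto simp: card_gt_0_iff)
    ultimately show False using p_gt_1 by simp
  qed
  then show ?thesis using A by blast
qed

lemma bad_card:
  assumes "bad L K"
  shows "card L \<noteq> p * card K" "p * card K < card L"
proof -
  note L = chiefD[OF badD(1)[OF assms]]
  note sub = nsub_subgroup[OF L(1)] nsub_subgroup[OF L(2)]
  obtain g where g: "g \<in> L" "subgroup (adjoin G K g) G" "adjoin G K g \<subseteq> L"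
      "card (adjoin G K g) = p * card K"
    using S_inv_extend[OF badD(1)[OF assms] sub(2) _ L(3) S_inv_normal[OF L(2)]] by blast
  have "adjoin G K g \<subset> L" using g(3) badD(2)[OF assms g(1)] by blast
  then show "p * card K < card L" using psubset_card_mono[OF finite_subgroup[OF sub(1)]] g(4) by metis
  then show "card L \<noteq> p * card K" by simp
qed

lemma chief_good_card:
  assumes LK: "chief L K" and good: "\<not> bad L K"
  shows "card L = p * card K"
proof -
  note L = chiefD[OF LK]
  note sub = nsub_subgroup[OF L(1)] nsub_subgroup[OF L(2)]
  obtain x where x: "x \<in> L" "L \<subseteq> adjoin G K x" using LK good unfolding bad_def by blast
  have xc: "x \<in> carrier G" using nsub_carrier[OF L(1) x(1)] .
  have "x \<notin> K" using x(2) L(3) adjoin_subset[OF sub(2) subset_refl, of x] by blast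
  then have "card (adjoin G K x) = p * card K"
    by (intro card_adjoin[OF sub(2)])
      (use x(1) nsub_subset[OF L(1)] nsub_subset[OF L(2)] chief_pow[OF LK x(1)] nsub_conj[OF L(2) xc] in auto)
  moreover have "adjoin G K x = L" using x adjoin_subset[OF sub(1) _ x(1)] L(3) by blast
  ultimately show ?thesis by simp
qed

end

section \<open>Consequences of the IC-\<Pi>-property for bad chief factors\<close>

locale IC_Pi_p_subgroup = normal_p_subgroup_Sylow +
  fixes d :: nat
  assumes d_power: "\<exists>k. d = p ^ k" and d_gt_1: "1 < d" and d_less: "d < card P"
    and IC: "subgroup H G \<Longrightarrow> H \<subseteq> P \<Longrightarrow> card H = d \<Longrightarrow> IC_Pi_property G H"
    and IC4: "p = 2 \<Longrightarrow> d = 2 \<Longrightarrow> \<not> comm_group (G\<lparr>carrier := P\<rparr>) \<Longrightarrow> subgroup H G \<Longrightarrow> H \<subseteq> P \<Longrightarrow>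
      cyclic_group (G\<lparr>carrier := H\<rparr>) \<Longrightarrow> card H = 4 \<Longrightarrow> IC_Pi_property G H"
begin

abbreviation comm :: "'a set \<Rightarrow> 'a set"
  where "comm H \<equiv> commutator_subgroup G H (carrier G)"

lemma IC_chief:
  assumes IC: "IC_Pi_property G H" and H: "subgroup H G" and LK: "chief L K"
    and inv: "S_inv (((H \<inter> comm H) <#> K) \<inter> L)"
  shows "((H \<inter> comm H) <#> K) \<inter> L = K \<or> ((H \<inter> comm H) <#> K) \<inter> L = L"
proof -
  note L = chiefD[OF LK]
  have sub: "subgroup (H \<inter> comm H) G"
    using subgroups_Inter_pair[OF H commutator_subgroup_subgroup[OF H]] .
  have "nsub (((H \<inter> comm H) <#> K) \<inter> L)"
    by (rule Pi_property_normal[OF _ sub LK inv]) (use IC in \<open>simp add: IC_Pi_property_def\<close>)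
  moreover have "K \<subseteq> ((H \<inter> comm H) <#> K) \<inter> L"
    using set_mult_supset(2)[OF sub nsub_subgroup[OF L(2)]] L(3) by blast
  ultimately show ?thesis using L(4) by blast
qed

text \<open>If \<open>H\<close> has an element of \<open>L\<close> outside \<open>K\<close>, then
  \<open>comm H\<close> and \<open>K\<close> together cover \<open>L\<close>, by
  \<open>bad_commutator\<close> and the minimality of \<open>L/K\<close>. As
  \<open>K \<subseteq> H\<close>, the modular law identifies
  \<open>(H \<inter> comm H)K \<inter> L\<close> with \<open>H \<inter> L\<close>, and
  \<open>IC_chief\<close> applies. Only \<open>H \<inter> L\<close> has to be invariant;
  \<open>H\<close> itself may be moved by \<open>S\<close>.\<close>

lemma Int_bad_trivial:
  assumes LK: "bad L K" and H: "subgroup H G" "H \<subseteq> P" "card H = d" "K \<subseteq> H"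
    and inv: "S_inv (H \<inter> L)"
  shows "H \<inter> L = K \<or> H \<inter> L = L"
proof (rule disjCI)
  assume neq: "H \<inter> L \<noteq> L"
  note L = chiefD[OF badD(1)[OF LK]]
  show "H \<inter> L = K"
  proof (rule ccontr)
    assume "H \<inter> L \<noteq> K"
    then obtain t where t: "t \<in> H" "t \<in> L" "t \<notin> K" using H(4) L(3) by blast
    interpret H: subgroup H G by (rule H(1))
    interpret K: normal K G by (rule nsub_normal[OF L(2)])
    have C: "comm H \<lhd> G" by (rule commutator_normal[OF fin H(1)])
    have CP: "comm H \<subseteq> P" using commutator_least[OF P_normal H(2)] .
    have C': "nsub (comm H)" using C CP by (simp add: nsub_def)
    have Csub: "subgroup (comm H) G" using nsub_subgroup[OF C'] .
    have D: "nsub ((comm H <#> K) \<inter> L)" using nsub_Int[OF nsub_mult[OF C' L(2)] L(1)] .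
    obtain g where g: "g \<in> carrier G" "g \<otimes> t \<otimes> inv g \<otimes> inv t \<notin> K"
      using bad_commutator[OF LK t(2,3)] by blast
    have "g \<otimes> t \<otimes> inv g \<otimes> inv t \<in> comm H"
      using commutator_mem[OF H(1) t(1) g(1)] .
    moreover have "g \<otimes> t \<otimes> inv g \<otimes> inv t \<in> L"
      using nsub_conj[OF L(1) g(1) t(2)] t(2) subgroup.m_closed[OF nsub_subgroup[OF L(1)]]
        subgroup.m_inv_closed[OF nsub_subgroup[OF L(1)]] by blast
    ultimately have "g \<otimes> t \<otimes> inv g \<otimes> inv t \<in> (comm H <#> K) \<inter> L"
      using set_mult_supset(1)[OF Csub K.is_subgroup] by blast
    moreover have "K \<subseteq> (comm H <#> K) \<inter> L"
      using set_mult_supset(2)[OF Csub K.is_subgroup] L(3) by blast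
    ultimately have CK: "(comm H <#> K) \<inter> L = L" using L(4)[OF D] g(2) by blast
    have "((H \<inter> comm H) <#> K) \<inter> L = H \<inter> L"
    proof
      show "((H \<inter> comm H) <#> K) \<inter> L \<subseteq> H \<inter> L"
        using set_mult_subset[OF H(1) _ H(4)] by blast
      show "H \<inter> L \<subseteq> ((H \<inter> comm H) <#> K) \<inter> L"
      proof
        fix y assume y: "y \<in> H \<inter> L"
        then have "y \<in> comm H <#> K" using CK by blast
        then obtain c k where ck: "y = c \<otimes> k" "c \<in> comm H" "k \<in> K"
          by (auto simp: set_mult_def)
        then have "c = y \<otimes> inv k" using subgroup.mem_carrier[OF Csub] by (simp add: m_assoc)
        moreover have "y \<otimes> inv k \<in> H" using y ck H(4) by auto
        ultimately have "c \<in> H" by metis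
        then show "y \<in> ((H \<inter> comm H) <#> K) \<inter> L" using ck y by (auto simp: set_mult_def)
      qed
    qed
    then show False
      using IC_chief[OF IC[OF H(1-3)] H(1) badD(1)[OF LK]] inv neq \<open>H \<inter> L \<noteq> K\<close>
        by simp
  qed
qed

text \<open>An \<open>S\<close>-invariant subgroup of order \<open>d\<close> strictly between
  \<open>K\<close> and \<open>L\<close> contradicts \<open>Int_bad_trivial\<close>.\<close>

lemma no_bad_across:
  assumes LK: "bad L K" and d: "card K < d" "d < card L"
  shows False
proof -
  note L = chiefD[OF badD(1)[OF LK]]
  obtain A where A: "subgroup A G" "K \<subseteq> A" "A \<subseteq> L" "S_inv A" "card A = d"
    using S_inv_between[OF badD(1)[OF LK] d_power] d by auto
  have "A \<inter> L = A" using A(3) by blast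
  then have "A = K \<or> A = L"
    using Int_bad_trivial[OF LK A(1) _ A(5,2)] A nsub_subset[OF L(1)] by auto
  then show False using A(5) d by auto
qed

text \<open>Substitute for \<open>Int_bad_trivial\<close> when the bottom of the factor does not fit
  into \<open>H\<close>. An element \<open>t\<close> of both \<open>H\<close> and
  \<open>comm H\<close> makes \<open>(H \<inter> comm H)E\<close> equal to
  \<open>adjoin G E t\<close>, which is neither \<open>E\<close>, as it contains \<open>t\<close>,
  nor \<open>M\<close>, as \<open>M/E\<close> is noncyclic.\<close>

lemma no_IC_adjoin:
  assumes ME: "bad M E" and t: "t \<in> M" "t \<notin> E" and inv: "S_inv (adjoin G E t)"
    and H: "subgroup H G" "t \<in> H" "H \<subseteq> adjoin G E t" "t \<in> comm H"
      and IC: "IC_Pi_property G H"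
  shows False
proof -
  note L = chiefD[OF badD(1)[OF ME]]
  have tc: "t \<in> carrier G" using nsub_carrier[OF L(1) t(1)] .
  note D = adjoin_props[OF L(2) tc]
  have sub: "subgroup (H \<inter> comm H) G"
    using subgroups_Inter_pair[OF H(1) commutator_subgroup_subgroup[OF H(1)]] .
  have HE: "subgroup ((H \<inter> comm H) <#> E) G"
    using mult_norm_subgroup[OF nsub_normal[OF L(2)] sub] commut_normal[OF sub nsub_normal[OF L(2)]] by simp
  note sup = set_mult_supset[OF sub nsub_subgroup[OF L(2)]]
  have DM: "adjoin G E t \<subseteq> M" using adjoin_subset[OF nsub_subgroup[OF L(1)]] L(3) t(1) by blast
  have "adjoin G E t \<subseteq> (H \<inter> comm H) <#> E"
    using adjoin_subset[OF HE sup(2)] sup(1) H(2,4) by blast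
  moreover have "(H \<inter> comm H) <#> E \<subseteq> adjoin G E t"
    using set_mult_subset[OF D(1) _ D(2)] H(3) by blast
  ultimately have "((H \<inter> comm H) <#> E) \<inter> M = adjoin G E t" using DM by blast
  then have "adjoin G E t = E \<or> adjoin G E t = M"
    using IC_chief[OF IC H(1) badD(1)[OF ME]] inv by simp
  then show False using D(3) t badD(2)[OF ME t(1)] by blast
qed

end

section \<open>Subgroups of cyclic groups\<close>

context group
begin

lemma cyclic_groupI:
  assumes x: "x \<in> carrier G"
    and gen: "\<And>y. y \<in> carrier G \<Longrightarrow> \<exists>i::nat. y = x [^] i"
  shows "cyclic_group G"
  unfolding cyclic_group
proof (intro bexI[OF _ x] equalityI subsetI)
  fix y assume "y \<in> carrier G"
  then obtain i :: nat where "y = x [^] i" using gen by blast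
  then have "y = x [^] int i" by (simp add: int_pow_int)
  then show "y \<in> range (\<lambda>n::int. x [^] n)" by blast
qed (use x in auto)

lemma adjoin_one_iff: "e \<in> carrier G \<Longrightarrow> x \<in> adjoin G {\<one>} e \<longleftrightarrow> (\<exists>i::nat. x = e [^] i)"
  unfolding adjoin_def by force

text \<open>The generator is the power of \<open>t\<close> with the least positive exponent that
  lands in \<open>A\<close>; \<open>order G\<close> shows that one exists, and division with
  remainder handles the other elements.\<close>

lemma subgroup_of_cyclic:
  assumes A: "subgroup A G" and t: "t \<in> carrier G" and sub: "A \<subseteq> adjoin G {\<one>} t"
    and fin: "finite (carrier G)"
  shows "\<exists>e\<in>A. A \<subseteq> adjoin G {\<one>} e"
proof -
  interpret A: subgroup A G by fact
  have "t [^] order G \<in> A" using pow_order_eq_1[OF t] by simp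
  moreover have "0 < order G" using fin order_gt_0_iff_finite by blast
  ultimately have ex: "\<exists>n>0. t [^] (n::nat) \<in> A" by blast
  define n where "n = (LEAST n::nat. n > 0 \<and> t [^] n \<in> A)"
  have n: "n > 0" "t [^] n \<in> A" using LeastI_ex[OF ex] unfolding n_def by auto
  have least: "n \<le> k" if "k > 0" "t [^] k \<in> A" for k
    unfolding n_def using that by (intro Least_le) auto
  have pow: "(t [^] n) [^] (j::nat) \<in> A" for j by (induction j) (use n in auto)
  have "A \<subseteq> adjoin G {\<one>} (t [^] n)"
  proof
    fix y assume y: "y \<in> A"
    then obtain i :: nat where i: "y = t [^] i" using sub adjoin_one_iff[OF t] by blast
    have split: "t [^] i = (t [^] n) [^] (i div n) \<otimes> t [^] (i mod n)"
      using t by (simp add: nat_pow_pow nat_pow_mult)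
    then have "t [^] (i mod n) = inv ((t [^] n) [^] (i div n)) \<otimes> y" using i t
      by (simp add: inv_cancel)
    moreover have "inv ((t [^] n) [^] (i div n)) \<otimes> y \<in> A" using pow y by simp
    ultimately have "t [^] (i mod n) \<in> A" by (simp only:)
    then have "i mod n = 0" using least[of "i mod n"] n by (meson mod_less_divisor not_gr0 not_le)
    then have "y = (t [^] n) [^] (i div n)" using split i t by simp
    then show "y \<in> adjoin G {\<one>} (t [^] n)" using adjoin_one_iff[of "t [^] n"] t by blast
  qed
  then show ?thesis using n by blast
qed

end

context normal_p_subgroup
begin

lemma bad_not_cyclic:
  assumes LK: "bad L K" and LE: "L \<subseteq> E"
    and E: "subgroup E G" "E \<subseteq> adjoin G {\<one>} t" and t: "t \<in> carrier G"
  shows False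
proof -
  note L = chiefD[OF badD(1)[OF LK]]
  obtain e where e: "e \<in> L" "L \<subseteq> adjoin G {\<one>} e"
    using subgroup_of_cyclic[OF nsub_subgroup[OF L(1)] t _ fin] LE E by blast
  have "adjoin G {\<one>} e \<subseteq> adjoin G K e"
    using subgroup.one_closed[OF nsub_subgroup[OF L(2)]] unfolding adjoin_def by blast
  then show False using e badD(2)[OF LK e(1)] by blast
qed

end

context IC_Pi_p_subgroup
begin

lemma comm_nsub:
  assumes "subgroup H G" "H \<subseteq> P"
  shows "nsub (comm H)"
  using commutator_normal[OF fin assms(1)] commutator_least[OF P_normal assms(2)] by (simp add: nsub_def)

text \<open>Let \<open>T\<close> be of least order among the normal subgroups in \<open>M\<close>
  not inside \<open>E\<close>. Then \<open>M = TE\<close>, and a normal subgroup that meets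
  \<open>T\<close> outside \<open>E\<close> contains \<open>T\<close>. So any \<open>t\<close> in
  \<open>T\<close> outside \<open>E\<close> lies in \<open>comm H\<close> whenever
  \<open>t \<in> H\<close>. Its order is at most \<open>d\<close>: otherwise the powers of
  \<open>t\<close> would fill \<open>adjoin G E t\<close>, of order \<open>p * d\<close>, and a
  cyclic group would contain the bad factor \<open>L/K\<close>.\<close>

lemma no_bad_above:
  assumes ME: "bad M E" and E: "card E = d" and LK: "bad L K" "L \<subseteq> E"
  shows False
proof -
  note L = chiefD[OF badD(1)[OF ME]]
  have EG: "subgroup E G" and MP: "M \<subseteq> P" using nsub_subgroup[OF L(2)] nsub_subset[OF L(1)] .
  let ?P = "\<lambda>T. nsub T \<and> T \<subseteq> M \<and> \<not> T \<subseteq> E"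
  have "?P M" using L(1,3) by blast
  then obtain T where T: "?P T" "\<And>T'. ?P T' \<Longrightarrow> card T \<le> card T'"
    using ex_has_least_nat[of ?P M card] by blast
  have nT: "nsub T" using T by blast
  have T_min: "T' = T" if "nsub T'" "T' \<subseteq> T" "\<not> T' \<subseteq> E" for T'
    using T(2)[of T'] that T(1) card_seteq[OF finite_subgroup[OF nsub_subgroup[OF nT]]] by blast
  obtain t0 where t0: "t0 \<in> M" "t0 \<notin> E" "S_inv (adjoin G E t0)" "card (adjoin G E t0) = p * card E"
    using S_inv_extend[OF badD(1)[OF ME] EG subset_refl L(3) S_inv_normal[OF L(2)]] by blast
  \<comment> \<open>The generator \<open>t0\<close> of the invariant extension need not lie in
    \<open>T\<close>. Changing it by an element of \<open>E\<close> moves it into \<open>T\<close>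
    and keeps \<open>adjoin G E t0\<close>.\<close>
  have "t0 \<in> T <#> E" using bad_Int(2)[OF ME nT] T(1) t0(1) by blast
  then obtain t e where te: "t0 = t \<otimes> e" "t \<in> T" "e \<in> E" by (auto simp: set_mult_def)
  have c: "t0 \<in> carrier G" "t \<in> carrier G" "e \<in> carrier G"
    using nsub_carrier[OF L(1) t0(1)] nsub_carrier[OF nT te(2)] nsub_carrier[OF L(2) te(3)] .
  note D = adjoin_props[OF L(2) c(2)] and D0 = adjoin_props[OF L(2) c(1)]
  have eq: "adjoin G E t0 = adjoin G E t"
  proof
    have "t0 \<in> adjoin G E t" unfolding te(1) using subgroup.m_closed[OF D(1)] D te(3) by blast
    then show "adjoin G E t0 \<subseteq> adjoin G E t" using adjoin_subset[OF D(1,2)] by blast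
    have "t = t0 \<otimes> inv e" unfolding te(1) using c(2,3) by (simp add: m_assoc)
    moreover have "t0 \<otimes> inv e \<in> adjoin G E t0"
      using subgroup.m_closed[OF D0(1)] subgroup.m_inv_closed[OF EG te(3)] D0 by blast
    ultimately have "t \<in> adjoin G E t0" by (simp only:)
    then show "adjoin G E t \<subseteq> adjoin G E t0" using adjoin_subset[OF D0(1,2)] by blast
  qed
  have tE: "t \<notin> E" using te t0(2) subgroup.m_closed[OF EG] by blast
  have tM: "t \<in> M" using te T by blast
  have DM: "adjoin G E t \<subseteq> M" using adjoin_subset[OF nsub_subgroup[OF L(1)]] L(3) tM by blast
  let ?U = "adjoin G {\<one>} t"
  note U = adjoin_props[OF nsub_one c(2)]
  have UD: "?U \<subseteq> adjoin G E t"
    using adjoin_subset[OF D(1) _ D(3)] D(2) subgroup.one_closed[OF EG] by blast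
  have "?U \<noteq> adjoin G E t" using bad_not_cyclic[OF LK EG _ c(2)] D(2) by blast
  then have "p * card ?U \<le> card (adjoin G E t)"
    using psubset_p_card[OF U(1) D(1)] UD DM MP by blast
  then have Ud: "card ?U \<le> d" using eq t0(4) E p_gt_1 by simp
  have "d \<le> card (adjoin G E t)" using eq t0(4) E p_gt_1 by simp
  then obtain H where H: "subgroup H G" "?U \<subseteq> H" "H \<subseteq> adjoin G E t" "card H = d"
    using intermediate_subgroup[OF U(1) D(1) UD _ d_power Ud] DM MP by blast
  have HP: "H \<subseteq> P" using H DM MP by blast
  have tH: "t \<in> H" using H(2) U(3) by blast
  obtain g where g: "g \<in> carrier G" "g \<otimes> t \<otimes> inv g \<otimes> inv t \<notin> E"
    using bad_commutator[OF ME tM tE] by blast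
  have "g \<otimes> t \<otimes> inv g \<otimes> inv t \<in> T"
    using nsub_conj[OF nT g(1) te(2)] te(2) subgroup.m_closed[OF nsub_subgroup[OF nT]]
      subgroup.m_inv_closed[OF nsub_subgroup[OF nT]] by blast
  then have "\<not> comm H \<inter> T \<subseteq> E" using commutator_mem[OF H(1) tH g(1)] g(2) by blast
  then have "comm H \<inter> T = T" using T_min[OF nsub_Int[OF comm_nsub[OF H(1) HP] nT]] by blast
  then have "t \<in> comm H" using te(2) by blast
  then show False
    using no_IC_adjoin[OF ME tM tE _ H(1) tH H(3) _ IC[OF H(1) HP H(4)]] t0(3) eq by simp
qed

end

section \<open>Commutator and power maps\<close>

context group
begin

lemma rcos_eq_rightD:
  assumes K: "K \<lhd> G" and a: "a \<in> carrier G" and b: "b \<in> carrier G" and eq: "K #> a = K #> b"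
  shows "\<exists>k\<in>K. a = b \<otimes> k"
proof -
  interpret K: normal K G by (rule K)
  have "a \<otimes> inv b \<in> K" using eq rcoset_eq_iff[OF K.is_subgroup a b] by blast
  then have "inv b \<otimes> (a \<otimes> inv b) \<otimes> b \<in> K" by (rule K.inv_op_closed1[OF b])
  moreover have "inv b \<otimes> (a \<otimes> inv b) \<otimes> b = inv b \<otimes> a" using a b
    by (simp add: word_simps)
  moreover have "a = b \<otimes> (inv b \<otimes> a)" using a b by (simp add: inv_cancel)
  ultimately show ?thesis by metis
qed

lemma commute_conj:
  assumes "a \<in> carrier G" "b \<in> carrier G" "a \<otimes> b = b \<otimes> a"
  shows "a \<otimes> b \<otimes> inv a = b"
  using assms by (simp add: m_assoc)

lemma commutator_mult:
  assumes c: "g \<in> carrier G" "h \<in> carrier G" "x \<in> carrier G"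
    and comm: "g \<otimes> (h \<otimes> x \<otimes> inv h \<otimes> inv x) = (h \<otimes> x \<otimes> inv h \<otimes> inv x) \<otimes> g"
      "(g \<otimes> x \<otimes> inv g \<otimes> inv x) \<otimes> (h \<otimes> x \<otimes> inv h \<otimes> inv x)
        = (h \<otimes> x \<otimes> inv h \<otimes> inv x) \<otimes> (g \<otimes> x \<otimes> inv g \<otimes> inv x)"
  shows "(g \<otimes> h) \<otimes> x \<otimes> inv (g \<otimes> h) \<otimes> inv x
    = (g \<otimes> x \<otimes> inv g \<otimes> inv x) \<otimes> (h \<otimes> x \<otimes> inv h \<otimes> inv x)"
proof -
  have "(g \<otimes> h) \<otimes> x \<otimes> inv (g \<otimes> h) \<otimes> inv x
      = (g \<otimes> (h \<otimes> x \<otimes> inv h \<otimes> inv x) \<otimes> inv g) \<otimes> (g \<otimes> x \<otimes> inv g \<otimes> inv x)"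
    using c by (simp add: word_simps)
  also have "g \<otimes> (h \<otimes> x \<otimes> inv h \<otimes> inv x) \<otimes> inv g = h \<otimes> x \<otimes> inv h \<otimes> inv x"
    by (rule commute_conj[OF _ _ comm(1)]) (use c in auto)
  finally show ?thesis unfolding comm(2) .
qed

text \<open>Applied modulo \<open>K\<close> with \<open>v \<otimes> x [^] j\<close> a conjugate of
  \<open>x\<close>, this produces the exponent \<open>j\<close> of \<open>phi_conj\<close>.\<close>

lemma commutator_pow:
  assumes c: "g \<in> carrier G" "x \<in> carrier G" "v \<in> carrier G"
    and comm: "g \<otimes> v = v \<otimes> g" "v \<otimes> (g \<otimes> x \<otimes> inv g \<otimes> inv x) = (g \<otimes> x \<otimes> inv g \<otimes> inv x) \<otimes> v"
      "(g \<otimes> x \<otimes> inv g \<otimes> inv x) \<otimes> x = x \<otimes> (g \<otimes> x \<otimes> inv g \<otimes> inv x)"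
  shows "g \<otimes> (v \<otimes> x [^] (j::nat)) \<otimes> inv g \<otimes> inv (v \<otimes> x [^] j) = (g \<otimes> x \<otimes> inv g \<otimes> inv x) [^] j"
proof -
  define u where "u = g \<otimes> x \<otimes> inv g \<otimes> inv x"
  have uc: "u \<in> carrier G" using c by (simp add: u_def)
  have "g \<otimes> x \<otimes> inv g = u \<otimes> x" using c by (simp add: u_def m_assoc)
  then have 1: "g \<otimes> x [^] j \<otimes> inv g = u [^] j \<otimes> x [^] j"
    unfolding conj_nat_pow[OF c(1,2)] using pow_mult_distrib[of u x j] comm(3) uc c by (simp add: u_def)
  have 2: "g \<otimes> v \<otimes> inv g = v" by (rule commute_conj[OF c(1,3) comm(1)])
  have "u [^] j \<otimes> v = v \<otimes> u [^] j"
    by (rule group_commutes_pow) (use comm(2) uc c in \<open>auto simp: u_def\<close>)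
  then have 3: "v \<otimes> u [^] j \<otimes> inv v = u [^] j" using uc c by (simp add: commute_conj)
  have "g \<otimes> (v \<otimes> x [^] j) \<otimes> inv g \<otimes> inv (v \<otimes> x [^] j)
      = (g \<otimes> v \<otimes> inv g) \<otimes> (g \<otimes> x [^] j \<otimes> inv g) \<otimes> inv (x [^] j) \<otimes> inv v"
    using c by (simp add: word_simps)
  also have "\<dots> = v \<otimes> u [^] j \<otimes> inv v" unfolding 1 2 using c uc
    by (simp add: word_simps)
  also have "\<dots> = u [^] j" by (rule 3)
  finally show ?thesis unfolding u_def .
qed

lemma pow_commutator:
  assumes c: "x \<in> carrier G" "y \<in> carrier G" "u \<in> carrier G"
    and yx: "y \<otimes> x = u \<otimes> (x \<otimes> y)" and ux: "u \<otimes> x = x \<otimes> u"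
      and uy: "u \<otimes> y = y \<otimes> u"
  shows "y [^] (n::nat) \<otimes> x = u [^] n \<otimes> (x \<otimes> y [^] n)"
proof (induction n)
  case (Suc n)
  have yu: "y [^] n \<otimes> u = u \<otimes> y [^] n" by (rule group_commutes_pow[OF uy[symmetric] c(2,3)])
  have "y [^] Suc n \<otimes> x = y [^] n \<otimes> (u \<otimes> (x \<otimes> y))" using c yx
    by (simp add: m_assoc)
  also have "\<dots> = (y [^] n \<otimes> u) \<otimes> x \<otimes> y" using c by (simp add: m_assoc)
  also have "\<dots> = u \<otimes> (y [^] n \<otimes> x) \<otimes> y" unfolding yu using c
    by (simp add: m_assoc)
  also have "\<dots> = (u \<otimes> u [^] n) \<otimes> (x \<otimes> (y [^] n \<otimes> y))" unfolding Suc
    using c by (simp add: m_assoc)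
  also have "u \<otimes> u [^] n = u [^] Suc n" using group_commutes_pow[OF refl c(3,3), of n] by simp
  finally show ?case by simp
qed (use c in simp)

text \<open>The power formula of class two. The exponent of \<open>u = [y,x]\<close> is the binomial
  coefficient of \<open>n\<close> over 2, as moving \<open>x\<close> past \<open>y [^] n\<close>
  costs \<open>u [^] n\<close>.\<close>

lemma mult_pow_commutator:
  assumes c: "x \<in> carrier G" "y \<in> carrier G" "u \<in> carrier G"
    and yx: "y \<otimes> x = u \<otimes> (x \<otimes> y)" and ux: "u \<otimes> x = x \<otimes> u"
      and uy: "u \<otimes> y = y \<otimes> u"
  shows "(x \<otimes> y) [^] (n::nat) = u [^] (n * (n - 1) div 2) \<otimes> (x [^] n \<otimes> y [^] n)"
proof (induction n)
  case (Suc n)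
  let ?T = "n * (n - 1) div 2"
  have "Suc n * n = n * (n - 1) + 2 * n" by (cases n) (auto simp: algebra_simps)
  then have T: "Suc n * (Suc n - 1) div 2 = ?T + n" by simp
  have xu: "x [^] n \<otimes> u [^] n = u [^] n \<otimes> x [^] n"
    by (rule group_commutes_pow) (use group_commutes_pow[OF ux] c in auto)
  have "(x \<otimes> y) [^] Suc n = u [^] ?T \<otimes> (x [^] n \<otimes> ((y [^] n \<otimes> x) \<otimes> y))"
    using Suc c by (simp add: m_assoc)
  also have "\<dots> = u [^] ?T \<otimes> ((x [^] n \<otimes> u [^] n) \<otimes> (x \<otimes> (y [^] n \<otimes> y)))"
    unfolding pow_commutator[OF c yx ux uy] using c by (simp add: m_assoc)
  also have "\<dots> = (u [^] ?T \<otimes> u [^] n) \<otimes> ((x [^] n \<otimes> x) \<otimes> (y [^] n \<otimes> y))"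
    unfolding xu using c by (simp add: m_assoc)
  also have "u [^] ?T \<otimes> u [^] n = u [^] (?T + n)" using c by (simp add: nat_pow_mult)
  finally show ?case unfolding T by simp
qed (use c in simp)

end

context normal_p_subgroup
begin

text \<open>Values lie in \<open>V\<close> by \<open>chief_central\<close>, and \<open>M\<close>
  centralizes \<open>V\<close> modulo \<open>K\<close>, so commutation with \<open>x\<close> is
  multiplicative modulo \<open>K\<close>. As \<open>x\<close> generates \<open>F/V\<close>, its
  conjugates are \<open>v \<otimes> x [^] j\<close> with \<open>v \<in> V\<close>; modulo
  \<open>K\<close> the part \<open>v\<close> is invisible and \<open>j\<close> becomes an exponent
  of the value. Here cyclicity of a chief factor is exploited.\<close>

lemma twisted_hom_commutator:
  assumes M: "nsub M" and K: "nsub K" and FV: "chief F V" and x: "x \<in> F"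
    and gen: "F \<subseteq> adjoin G V x"
    and FM: "F \<subseteq> M" and cen: "\<And>g v. g \<in> M \<Longrightarrow> v \<in> V \<Longrightarrow> g \<otimes> v \<otimes> inv g \<otimes> inv v \<in> K"
  shows "twisted_hom G p P M K (\<lambda>g. g \<otimes> x \<otimes> inv g \<otimes> inv x)"
proof -
  note F = chiefD[OF FV]
  interpret K: normal K G by (rule nsub_normal[OF K])
  interpret Q: group "G Mod K" by (rule K.factorgroup_is_group)
  interpret \<pi>: group_hom G "G Mod K" "\<lambda>y. K #> y"
    by (intro group_hom.intro group_hom_axioms.intro is_group K.factorgroup_is_group K.r_coset_hom_Mod)
  let ?\<phi> = "\<lambda>g. g \<otimes> x \<otimes> inv g \<otimes> inv x"
  have xc: "x \<in> carrier G" using nsub_carrier[OF F(1) x] .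
  have Mc: "g \<in> carrier G" if "g \<in> M" for g using nsub_carrier[OF M that] .
  have Vc: "v \<in> carrier G" if "v \<in> V" for v using nsub_carrier[OF F(2) that] .
  have VM: "V \<subseteq> M" using F(3) FM by blast
  have \<phi>V: "?\<phi> g \<in> V" if "g \<in> M" for g
    using chief_central[OF FV x] that nsub_subset[OF M] by blast
  have com: "(K #> g) \<otimes>\<^bsub>G Mod K\<^esub> (K #> v) = (K #> v) \<otimes>\<^bsub>G Mod K\<^esub> (K #> g)" if "g \<in> M" "v \<in> V" for g v
  proof -
    have c: "g \<in> carrier G" "v \<in> carrier G" using Mc Vc that by auto
    have "K #> (g \<otimes> v) = K #> (v \<otimes> g)"
      using rcos_commute_iff[OF K.is_subgroup c] cen[OF that] by blast
    then show ?thesis unfolding \<pi>.hom_mult[OF c] \<pi>.hom_mult[OF c(2,1)] .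
  qed
  have \<pi>\<phi>: "K #> ?\<phi> g = (K #> g) \<otimes>\<^bsub>G Mod K\<^esub> (K #> x) \<otimes>\<^bsub>G Mod K\<^esub> inv\<^bsub>G Mod K\<^esub> (K #> g)
      \<otimes>\<^bsub>G Mod K\<^esub> inv\<^bsub>G Mod K\<^esub> (K #> x)" if "g \<in> carrier G" for g
    using that xc by (simp only: \<pi>.hom_mult \<pi>.hom_inv m_closed inv_closed)
  show ?thesis
  proof (unfold_locales, goal_cases)
    \<comment> \<open>Cases 3, 4 and 5 are \<open>phi_P\<close>, \<open>phi_mult\<close> and
      \<open>phi_conj\<close>.\<close>
    case (3 g)
    then show ?case using \<phi>V nsub_subset[OF F(2)] by blast
  next
    case (4 g h)
    have c: "K #> g \<in> carrier (G Mod K)" "K #> h \<in> carrier (G Mod K)" "K #> x \<in> carrier (G Mod K)"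
      using 4 Mc xc by (auto intro: \<pi>.hom_closed)
    have gh: "g \<in> carrier G" "h \<in> carrier G" "g \<otimes> h \<in> carrier G" using 4 Mc by auto
    have "K #> ?\<phi> (g \<otimes> h) = (K #> ?\<phi> g) \<otimes>\<^bsub>G Mod K\<^esub> (K #> ?\<phi> h)"
      unfolding \<pi>\<phi>[OF gh(1)] \<pi>\<phi>[OF gh(2)] \<pi>\<phi>[OF gh(3)] \<pi>.hom_mult[OF gh(1,2)]
      by (rule Q.commutator_mult[OF c])
        (use com[OF 4(1) \<phi>V[OF 4(2)]] com[OF _ \<phi>V[OF 4(2)], of "?\<phi> g"] \<phi>V[OF 4(1)] VM in
          \<open>auto simp only: \<pi>\<phi>[OF gh(1)] \<pi>\<phi>[OF gh(2)]\<close>)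
    also have "\<dots> = K #> (?\<phi> g \<otimes> ?\<phi> h)"
      by (rule \<pi>.hom_mult[symmetric]) (use gh xc in auto)
    finally show ?case by (rule rcos_eq_rightD[OF K.normal_axioms, rotated 2]) (use gh xc in auto)
  next
    case (5 s g)
    let ?g = "s \<otimes> g \<otimes> inv s" and ?x = "s \<otimes> x \<otimes> inv s"
    have gM: "?g \<in> M" using nsub_conj[OF M 5] .
    have gc: "g \<in> carrier G" "?g \<in> carrier G" using 5 Mc gM by auto
    have "?x \<in> F" using nsub_conj[OF F(1) 5(1) x] .
    then obtain v j where v: "v \<in> V" "?x = v \<otimes> x [^] (j::nat)" using gen
      by (blast elim: adjoinE)
    have vc: "v \<in> carrier G" using Vc[OF v(1)] .
    have c: "K #> ?g \<in> carrier (G Mod K)" "K #> x \<in> carrier (G Mod K)" "K #> v \<in> carrier (G Mod K)"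
      using gc xc vc by (auto intro: \<pi>.hom_closed)
    have "s \<otimes> ?\<phi> g \<otimes> inv s = ?g \<otimes> ?x \<otimes> inv ?g \<otimes> inv ?x"
      using 5(1) gc xc by (simp add: word_simps)
    then have "K #> (s \<otimes> ?\<phi> g \<otimes> inv s) = K #> (?g \<otimes> (v \<otimes> x [^] j) \<otimes> inv ?g \<otimes> inv (v \<otimes> x [^] j))"
      unfolding v(2) by simp
    also have "\<dots> = (K #> ?g) \<otimes>\<^bsub>G Mod K\<^esub> ((K #> v) \<otimes>\<^bsub>G Mod K\<^esub> (K #> x) [^]\<^bsub>G Mod K\<^esub> j) \<otimes>\<^bsub>G Mod K\<^esub>
        inv\<^bsub>G Mod K\<^esub> (K #> ?g) \<otimes>\<^bsub>G Mod K\<^esub> inv\<^bsub>G Mod K\<^esub> ((K #> v) \<otimes>\<^bsub>G Mod K\<^esub> (K #> x) [^]\<^bsub>G Mod K\<^esub> j)"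
      using gc xc vc by (simp only: \<pi>.hom_mult \<pi>.hom_inv \<pi>.hom_nat_pow m_closed inv_closed nat_pow_closed)
    also have "\<dots> = (K #> ?\<phi> ?g) [^]\<^bsub>G Mod K\<^esub> j"
      unfolding \<pi>\<phi>[OF gc(2)]
      by (rule Q.commutator_pow[OF c])
        (use com[OF gM v(1)] com[OF _ \<phi>V[OF gM], of v] com[OF _ \<phi>V[OF gM], of x] v(1) VM x FM in
          \<open>auto simp only: \<pi>\<phi>[OF gc(2)]\<close>)
    also have "\<dots> = K #> (?\<phi> ?g [^] j)" using gc xc
      by (simp only: \<pi>.hom_nat_pow m_closed inv_closed)
    finally have "\<exists>k\<in>K. s \<otimes> ?\<phi> g \<otimes> inv s = ?\<phi> ?g [^] j \<otimes> k"
      by (rule rcos_eq_rightD[OF K.normal_axioms, rotated 2]) (use 5(1) gc xc in auto)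
    then show ?case by blast
  qed (use M K in auto)
qed

end

section \<open>Minimal bad chief factors\<close>

context normal_p_subgroup
begin

definition minimal_bad :: "'a set \<Rightarrow> 'a set \<Rightarrow> bool"
  where "minimal_bad L K \<longleftrightarrow> bad L K \<and> (\<forall>L' K'. bad L' K' \<longrightarrow> card L \<le> card L')"

lemma minimal_badD:
  assumes "minimal_bad L K"
  shows "bad L K" "bad L' K' \<Longrightarrow> card L \<le> card L'"
  using assms unfolding minimal_bad_def by blast+

text \<open>By \<open>bad_Int\<close>, a proper normal \<open>D\<close> not inside \<open>K\<close>
  would be the top of a bad factor of smaller order.\<close>

lemma minimal_bad_proper:
  assumes min: "minimal_bad L K"
    and D: "nsub D" "D \<subseteq> L" "D \<noteq> L"
  shows "D \<subseteq> K"
proof (rule ccontr)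
  note LK = minimal_badD(1)[OF min]
  assume "\<not> D \<subseteq> K"
  then have "card L \<le> card D" using minimal_badD(2)[OF min] bad_Int(1)[OF LK D(1,2)] by blast
  moreover have "card D < card L"
    using D psubset_card_mono finite_subgroup[OF nsub_subgroup[OF chiefD(1)[OF badD(1)[OF LK]]]] by blast
  ultimately show False by simp
qed

text \<open>Let \<open>V\<close> be a largest normal subgroup of \<open>G\<close> in
  \<open>K\<close> centralized by \<open>L\<close>. A chief factor \<open>F/V\<close> in
  \<open>K\<close> is cyclic by the choice of \<open>L\<close>, so commutation with a generator
  \<open>x\<close> is a twisted homomorphism from \<open>L\<close> to \<open>V\<close>. Its kernel
  is not \<open>L\<close>, or \<open>F\<close> would be centralized too; hence it lies in
  \<open>K\<close>, and \<open>L/K\<close> is carried to a bad factor with top inside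
  \<open>V\<close>, smaller than \<open>L\<close>.\<close>

lemma minimal_bad_central:
  assumes min: "minimal_bad L K"
    and g: "g \<in> L" and k: "k \<in> K"
  shows "g \<otimes> k \<otimes> inv g \<otimes> inv k \<in> {\<one>}"
proof -
  note LK = minimal_badD(1)[OF min]
  note L = chiefD[OF badD(1)[OF LK]]
  have finL: "finite L" using finite_subgroup[OF nsub_subgroup[OF L(1)]] .
  let ?P = "\<lambda>V. nsub V \<and> V \<subseteq> K \<and> (\<forall>g\<in>L. \<forall>v\<in>V. g \<otimes> v \<otimes> inv g \<otimes> inv v \<in> {\<one>})"
  have "?P {\<one>}"
    using nsub_one nsub_carrier[OF L(1)] subgroup.one_closed[OF nsub_subgroup[OF L(2)]] by auto
  moreover have "finite K" using finL L(3) finite_subset by blast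
  then have "\<forall>V. ?P V \<longrightarrow> card V < Suc (card K)" using card_mono le_imp_less_Suc
    by blast
  ultimately obtain V where V: "?P V" "\<And>V'. ?P V' \<Longrightarrow> card V' \<le> card V"
    using ex_has_greatest_nat[of ?P "{\<one>}" card "Suc (card K)"] by blast
  have nV: "nsub V" and VK: "V \<subseteq> K" using V(1) by auto
  have "V = K"
  proof (rule ccontr)
    assume "V \<noteq> K"
    then obtain F where F: "chief F V" "F \<subseteq> K" using exists_chief[OF nV L(2)] VK by blast
    note F' = chiefD[OF F(1)]
    have "card F < card L" using psubset_card_mono[OF finL] F(2) L(3) by blast
    then have "\<not> bad F V" using minimal_badD(2)[OF min] by (meson not_le)
    then obtain x where x: "x \<in> F" "F \<subseteq> adjoin G V x" using F(1) unfolding bad_def by blast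
    let ?\<phi> = "\<lambda>g. g \<otimes> x \<otimes> inv g \<otimes> inv x"
    have FL: "F \<subseteq> L" using F(2) L(3) by blast
    interpret T: twisted_hom G p P L "{\<one>}" ?\<phi>
      by (rule twisted_hom_commutator[OF L(1) nsub_one F(1) x FL]) (use V(1) in blast)
    have pre: "nsub (T.pre {\<one>})" by (rule T.nsub_pre[OF nsub_one subset_refl])
    have preL: "T.pre {\<one>} \<subseteq> L" unfolding T.pre_def by blast
    have "T.pre {\<one>} \<noteq> L"
    proof
      assume all: "T.pre {\<one>} = L"
      let ?C = "{y \<in> F. \<forall>g\<in>L. g \<otimes> y \<otimes> inv g \<otimes> inv y \<in> {\<one>}}"
      have C: "nsub ?C" by (rule nsub_centralizer_mod[OF F'(1) L(1) nsub_one])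
      have "x \<in> ?C" using all x(1) unfolding T.pre_def by blast
      moreover have "V \<subseteq> ?C" using V(1) F'(3) by blast
      ultimately have "F \<subseteq> ?C" using x(2) adjoin_subset[OF nsub_subgroup[OF C]] by blast
      then have "?P F" using F'(1) F(2) by blast
      then have "card F \<le> card V" by (rule V(2))
      moreover have "card V < card F"
        using F'(3) psubset_card_mono finite_subgroup[OF nsub_subgroup[OF F'(1)]] by blast
      ultimately show False by simp
    qed
    then have "T.pre {\<one>} \<subseteq> K" using minimal_bad_proper[OF min pre preL] by blast
    then have "bad (T.img L) (T.img K)" by (rule T.bad_img[OF LK subset_refl])
    then have "card L \<le> card (T.img L)" by (rule minimal_badD(2)[OF min])
    moreover have "T.img L \<subseteq> V"
    proof
      fix y assume "y \<in> T.img L"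
      then obtain g where g: "g \<in> L" "y = ?\<phi> g \<otimes> \<one>" unfolding T.img_def by blast
      have "?\<phi> g \<in> V" using chief_central[OF F(1) x(1)] g(1) nsub_subset[OF L(1)] by blast
      then show "y \<in> V" using g nsub_carrier[OF nV] by simp
    qed
    then have "card (T.img L) < card L"
      using psubset_card_mono[OF finL] VK L(3) by blast
    ultimately show False by simp
  qed
  then show ?thesis using V(1) g k by blast
qed

text \<open>In the class-two formula the commutator \<open>u\<close> lies in \<open>K\<close>, which
  is central in \<open>L\<close>, and \<open>u [^] p = \<one>\<close> because \<open>y [^] p\<close>
  is central too. So its contribution vanishes when \<open>p\<close> divides the binomial
  coefficient or \<open>L\<close> is abelian.\<close>

lemma minimal_bad_pow_mult:
  assumes min: "minimal_bad L K"
    and q: "p dvd q * (q - 1) div 2 \<or> (\<forall>x\<in>L. \<forall>y\<in>L. x \<otimes> y = y \<otimes> x)"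
    and x: "x \<in> L" and y: "y \<in> L"
  shows "(x \<otimes> y) [^] q = x [^] q \<otimes> y [^] q"
proof -
  note LK = minimal_badD(1)[OF min]
  note L = chiefD[OF badD(1)[OF LK]]
  have c: "x \<in> carrier G" "y \<in> carrier G" using nsub_carrier[OF L(1)] x y by auto
  define u where "u = y \<otimes> x \<otimes> inv y \<otimes> inv x"
  have uc: "u \<in> carrier G" using c by (simp add: u_def)
  have uK: "u \<in> K" using chief_central[OF badD(1)[OF LK] x] y nsub_subset[OF L(1)] unfolding u_def
    by blast
  have cen: "k \<otimes> g = g \<otimes> k" if g: "g \<in> L" and k: "k \<in> K" for g k
  proof -
    have gk: "g \<in> carrier G" "k \<in> carrier G" using nsub_carrier[OF L(1) g] nsub_carrier[OF L(2) k] .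
    have "g \<otimes> k \<otimes> inv g \<otimes> inv k \<otimes> (k \<otimes> g) = k \<otimes> g"
      using minimal_bad_central[OF min g k] gk by simp
    moreover have "g \<otimes> k \<otimes> inv g \<otimes> inv k \<otimes> (k \<otimes> g) = g \<otimes> k" using gk by (simp add: word_simps)
    ultimately show ?thesis by (simp only:)
  qed
  have yx: "y \<otimes> x = u \<otimes> (x \<otimes> y)" unfolding u_def using c by (simp add: word_simps)
  note pows = pow_commutator[OF c uc yx cen[OF x uK] cen[OF y uK]]
    mult_pow_commutator[OF c uc yx cen[OF x uK] cen[OF y uK]]
  have yp: "y [^] p \<in> K" using chief_pow[OF badD(1)[OF LK] y] .
  have "u [^] p \<otimes> (x \<otimes> y [^] p) = x \<otimes> y [^] p" using pows(1)[of p] cen[OF x yp]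
    by simp
  then have up: "u [^] p = \<one>" using c uc by (simp add: r_cancel_one)
  have "u [^] (q * (q - 1) div 2) = \<one>"
    using q
  proof
    assume "p dvd q * (q - 1) div 2"
    then obtain e where "q * (q - 1) div 2 = p * e" by blast
    then have "u [^] (q * (q - 1) div 2) = (u [^] p) [^] e" using uc by (simp add: nat_pow_pow)
    then show ?thesis using up by simp
  next
    assume "\<forall>x\<in>L. \<forall>y\<in>L. x \<otimes> y = y \<otimes> x"
    then have "u = \<one>" unfolding u_def using x y c by (simp add: m_assoc)
    then show ?thesis by simp
  qed
  then show ?thesis using pows(2)[of q] c by simp
qed

text \<open>Otherwise the power map would carry \<open>L/K\<close> to a bad chief factor inside \<open>K\<close>.\<close>

lemma minimal_bad_exponent:
  assumes min: "minimal_bad L K"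
    and q: "p dvd q * (q - 1) div 2 \<or> (\<forall>x\<in>L. \<forall>y\<in>L. x \<otimes> y = y \<otimes> x)" "p dvd q" and x: "x \<in> L"
  shows "x [^] q = \<one>"
proof -
  note LK = minimal_badD(1)[OF min]
  note L = chiefD[OF badD(1)[OF LK]]
  interpret L: normal L G by (rule nsub_normal[OF L(1)])
  interpret K: normal K G by (rule nsub_normal[OF L(2)])
  obtain e where e: "q = p * e" using q(2) by blast
  have powK: "y [^] q \<in> K" if "y \<in> L" for y
  proof -
    have yp: "y [^] p \<in> K" using chief_pow[OF badD(1)[OF LK] that] .
    have "(y [^] p) [^] e \<in> K" by (induction e) (use yp in auto)
    then show ?thesis using that unfolding e by (simp add: nat_pow_pow)
  qed
  interpret T: twisted_hom G p P L "{\<one>}" "\<lambda>y. y [^] q"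
  proof (unfold_locales, goal_cases)
    case (3 g)
    then show ?case using powK nsub_subset[OF L(2)] by blast
  next
    case (4 g h)
    then show ?case using minimal_bad_pow_mult[OF min q(1)] by simp
  next
    case (5 s g)
    then have "s \<otimes> g [^] q \<otimes> inv s = ((s \<otimes> g \<otimes> inv s) [^] q) [^] (1::nat) \<otimes> \<one>"
      by (simp add: conj_nat_pow)
    then show ?case by blast
  qed (use L nsub_one in auto)
  have pre: "nsub (T.pre {\<one>})" by (rule T.nsub_pre[OF nsub_one subset_refl])
  have preL: "T.pre {\<one>} \<subseteq> L" unfolding T.pre_def by blast
  have "T.pre {\<one>} = L"
  proof (rule ccontr)
    assume "T.pre {\<one>} \<noteq> L"
    then have "T.pre {\<one>} \<subseteq> K" using minimal_bad_proper[OF min pre preL] by blast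
    then have "bad (T.img L) (T.img K)" by (rule T.bad_img[OF LK subset_refl])
    then have "card L \<le> card (T.img L)" by (rule minimal_badD(2)[OF min])
    moreover have "T.img L \<subseteq> K" unfolding T.img_def using powK by auto
    then have "card (T.img L) < card L"
      using psubset_card_mono[OF finite_subgroup[OF L.subgroup_axioms]] L(3) by blast
    ultimately show False by simp
  qed
  then show ?thesis using x unfolding T.pre_def by blast
qed

lemma card_adjoin_one_le:
  assumes x: "x \<in> carrier G" and q: "x [^] q = \<one>" "(q::nat) > 0"
  shows "card (adjoin G {\<one>} x) \<le> q"
proof -
  have "adjoin G {\<one>} x \<subseteq> (\<lambda>i. x [^] i) ` {..<q}"
  proof
    fix y assume "y \<in> adjoin G {\<one>} x"
    then obtain i :: nat where i: "y = x [^] i" using adjoin_one_iff[OF x] by blast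
    have "x [^] i = (x [^] q) [^] (i div q) \<otimes> x [^] (i mod q)"
      using x by (simp add: nat_pow_pow nat_pow_mult)
    then have "y = x [^] (i mod q)" using i q x by simp
    then show "y \<in> (\<lambda>i. x [^] i) ` {..<q}" using q by simp
  qed
  then show ?thesis using surj_card_le[of "{..<q}"] by simp
qed

lemma adjoin_one_cyclic:
  assumes x: "x \<in> carrier G"
  shows "cyclic_group (G\<lparr>carrier := adjoin G {\<one>} x\<rparr>)"
proof -
  have U: "subgroup (adjoin G {\<one>} x) G" using adjoin_props[OF nsub_one x] by blast
  interpret U: group "G\<lparr>carrier := adjoin G {\<one>} x\<rparr>"
    by (rule subgroup.subgroup_is_group[OF U is_group])
  show ?thesis
  proof (rule U.cyclic_groupI)
    show "x \<in> carrier (G\<lparr>carrier := adjoin G {\<one>} x\<rparr>)"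
      using adjoin_props[OF nsub_one x] by simp
    show "\<exists>i::nat. y = x [^]\<^bsub>G\<lparr>carrier := adjoin G {\<one>} x\<rparr>\<^esub> i"
      if "y \<in> carrier (G\<lparr>carrier := adjoin G {\<one>} x\<rparr>)" for y
      using that adjoin_one_iff[OF x] by (simp flip: nat_pow_consistent)
  qed
qed

end

context IC_Pi_p_subgroup
begin

lemma p_le_d: "p \<le> d"
proof -
  obtain k where k: "d = p ^ k" using d_power by blast
  then have "k \<noteq> 0" using d_gt_1 by (cases k) auto
  then show ?thesis using k p_gt_1 self_le_power[of p k] by simp
qed

text \<open>If \<open>d < card L\<close>, then \<open>d \<le> card K\<close>, and
  \<open>no_IC_adjoin\<close> is aimed at an invariant \<open>adjoin G K x\<close>. The normal
  subgroup \<open>comm H\<close> of \<open>L\<close> is not inside \<open>K\<close>, so it is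
  \<open>L\<close> by \<open>minimal_bad_proper\<close>, and \<open>x \<in> comm H\<close> comes for
  free. It remains to find \<open>H\<close> around \<open>x\<close> of order \<open>d\<close>, or of
  order 4 in the exceptional case.\<close>

lemma minimal_bad_card:
  assumes min: "minimal_bad L K"
  shows "card L \<le> d"
proof (rule ccontr)
  note LK = minimal_badD(1)[OF min]
  assume "\<not> card L \<le> d"
  then have dL: "d < card L" by simp
  note L = chiefD[OF badD(1)[OF LK]]
  have dK: "d \<le> card K" using no_bad_across[OF LK _ dL] by force
  have KG: "subgroup K G" and LP: "L \<subseteq> P" using nsub_subgroup[OF L(2)] nsub_subset[OF L(1)] .
  obtain x where x: "x \<in> L" "x \<notin> K" "S_inv (adjoin G K x)" "card (adjoin G K x) = p * card K"
      "adjoin G K x \<subseteq> L"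
    using S_inv_extend[OF badD(1)[OF LK] KG subset_refl L(3) S_inv_normal[OF L(2)]] by blast
  have xc: "x \<in> carrier G" using nsub_carrier[OF L(1) x(1)] .
  note D = adjoin_props[OF L(2) xc] and U = adjoin_props[OF nsub_one xc]
  let ?U = "adjoin G {\<one>} x"
  have UD: "?U \<subseteq> adjoin G K x"
    using adjoin_subset[OF D(1) _ D(3)] D(2) subgroup.one_closed[OF KG] by blast
  have comm_L: "x \<in> comm H" if H: "subgroup H G" "x \<in> H" "H \<subseteq> adjoin G K x" for H
  proof -
    have HL: "H \<subseteq> L" using H x(5) by blast
    have n: "nsub (comm H)" using comm_nsub[OF H(1)] HL LP by blast
    have "comm H \<subseteq> L" using commutator_least[OF nsub_normal[OF L(1)] HL] .
    moreover have "\<not> comm H \<subseteq> K"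
      using bad_commutator[OF LK x(1,2)] commutator_mem[OF H(1,2)] by blast
    ultimately have "comm H = L" using minimal_bad_proper[OF min n] by blast
    then show ?thesis using x(1) by simp
  qed
  have "card ?U \<le> d \<or> IC_Pi_property G ?U"
  proof (cases "p \<noteq> 2 \<or> (\<forall>x\<in>L. \<forall>y\<in>L. x \<otimes> y = y \<otimes> x)")
    case True
    have "p dvd p * (p - 1) div 2" if "p \<noteq> 2"
    proof -
      have "odd p" using prime_odd_nat[OF prime_p] p_gt_1 that by simp
      then have "p * (p - 1) div 2 = p * ((p - 1) div 2)" by (simp add: div_mult_swap)
      then show ?thesis by simp
    qed
    then have "x [^] p = \<one>" using minimal_bad_exponent[OF min _ dvd_refl x(1)] True by blast
    then show ?thesis using card_adjoin_one_le[OF xc, of p] p_gt_1 p_le_d by simp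
  next
    case False
    then have p2: "p = 2" by blast
    obtain a b where ab: "a \<in> L" "b \<in> L" "a \<otimes> b \<noteq> b \<otimes> a" using False by blast
    \<comment> \<open>The binomial coefficient of 4 over 2 is 6, which is even, whereas that of 2
      over 2 is odd: on a nonabelian \<open>L\<close> fourth powers replace squares.\<close>
    have "x [^] (4::nat) = \<one>" using minimal_bad_exponent[OF min _ _ x(1), of 4] p2 by simp
    then have U4: "card ?U \<le> 4" using card_adjoin_one_le[OF xc, of 4] by simp
    show ?thesis
    proof (cases "card ?U \<le> d")
      case False
      have UP: "?U \<subseteq> P" using UD x(5) LP by blast
      \<comment> \<open>An order above \<open>d\<close> is at least \<open>2 * d\<close>, but also
        at most 4; this leaves \<open>d = 2\<close> and order 4, the case of the extra
        hypothesis.\<close>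
      have "p * d \<le> card ?U" using p_power_less(1)[OF d_power subgroup_p_card[OF U(1) UP]] False by simp
      then have "d = 2" "card ?U = 4" using U4 p2 d_gt_1 by auto
      moreover have "\<not> comm_group (G\<lparr>carrier := P\<rparr>)"
      proof
        assume "comm_group (G\<lparr>carrier := P\<rparr>)"
        then interpret CP: comm_group "G\<lparr>carrier := P\<rparr>" .
        show False using CP.m_comm[of a b] ab LP by auto
      qed
      ultimately show ?thesis using IC4[OF p2 _ _ U(1) UP adjoin_one_cyclic[OF xc]] by blast
    qed blast
  qed
  then show False
  proof
    assume "IC_Pi_property G ?U"
    then show False using no_IC_adjoin[OF LK x(1-3) U(1,3) UD comm_L[OF U(1,3) UD]] by blast
  next
    assume Ud: "card ?U \<le> d"
    have "d \<le> card (adjoin G K x)" using dK x(4) p_gt_1 mult_le_mono[of 1 p d "card K"] by simp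
    then obtain H where H: "subgroup H G" "?U \<subseteq> H" "H \<subseteq> adjoin G K x" "card H = d"
      using intermediate_subgroup[OF U(1) D(1) UD _ d_power Ud] x(5) LP by blast
    have xH: "x \<in> H" and HP: "H \<subseteq> P" using H U(3) x(5) LP by auto
    show False
      using no_IC_adjoin[OF LK x(1-3) H(1) xH H(3) comm_L[OF H(1) xH H(3)] IC[OF H(1) HP H(4)]] .
  qed
qed

end

section \<open>Maximal bad chief factors below \<open>d\<close>\<close>

context normal_p_subgroup
begin

lemma nsub_psubset_card: "nsub B \<Longrightarrow> A \<subset> B \<Longrightarrow> card A < card B"
  using psubset_card_mono finite_subgroup nsub_subgroup by blast

lemma nsub_subset_card: "nsub B \<Longrightarrow> A \<subseteq> B \<Longrightarrow> card A \<le> card B"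
  using card_mono finite_subgroup nsub_subgroup by blast

lemma cyclic_quotient:
  assumes ch: "chief L K" and x: "x \<in> L" "L \<subseteq> adjoin G K x"
  shows "cyclic_group (G\<lparr>carrier := L\<rparr> Mod K)"
proof -
  note L = chiefD[OF ch]
  have xc: "x \<in> carrier G" using nsub_carrier[OF L(1) x(1)] .
  interpret K: normal K "G\<lparr>carrier := L\<rparr>"
    by (rule normal_restrict_supergroup[OF nsub_subgroup[OF L(1)] nsub_normal[OF L(2)]]) (use L(3) in blast)
  interpret Q: group "G\<lparr>carrier := L\<rparr> Mod K" by (rule K.factorgroup_is_group)
  show ?thesis
  proof (rule Q.cyclic_groupI)
    show "K #> x \<in> carrier (G\<lparr>carrier := L\<rparr> Mod K)" using x(1)
      by (auto simp: carrier_FactGroup)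
    fix c assume "c \<in> carrier (G\<lparr>carrier := L\<rparr> Mod K)"
    then obtain y where y: "y \<in> L" "c = K #> y" by (auto simp: carrier_FactGroup)
    obtain k i where ki: "k \<in> K" "y = k \<otimes> x [^] (i::nat)" using y(1) x(2)
      by (blast elim: adjoinE)
    have "y \<otimes> inv (x [^] i) = k" using ki nsub_carrier[OF L(2) ki(1)] xc by (simp add: m_assoc)
    then have "c = K #> x [^] i"
      using rcoset_eq_iff[OF nsub_subgroup[OF L(2)], of y "x [^] i"] y ki(1) nsub_carrier[OF L(1) y(1)] xc by simp
    moreover have "(K #> x) [^]\<^bsub>G\<lparr>carrier := L\<rparr> Mod K\<^esub> i = K #> x [^] i"
      using K.FactGroup_pow[of x i] x(1) by (simp flip: nat_pow_consistent)
    ultimately show "\<exists>i::nat. c = (K #> x) [^]\<^bsub>G\<lparr>carrier := L\<rparr> Mod K\<^esub> i" by metis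
  qed
qed

end

context IC_Pi_p_subgroup
begin

text \<open>Take a normal \<open>E\<close> above \<open>L\<close> of largest order at most
  \<open>d\<close>, and a chief factor \<open>M/E\<close>. If \<open>card E < d\<close>, a cyclic
  \<open>M/E\<close> would give \<open>card M \<le> d\<close>, and a noncyclic one is excluded by
  \<open>no_bad_across\<close>. So \<open>card E = d\<close>, and then \<open>no_bad_above\<close>
  makes \<open>M/E\<close> cyclic.\<close>

lemma exists_cyclic_step:
  assumes LK: "bad L K" and Ld: "card L \<le> d"
  shows "\<exists>M E. chief M E \<and> L \<subseteq> E \<and> card E = d \<and> card M = p * d"
proof -
  note L = chiefD[OF badD(1)[OF LK]]
  let ?P = "\<lambda>E. nsub E \<and> L \<subseteq> E \<and> card E \<le> d"
  have "?P L" using L(1) Ld by blast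
  then obtain E where E: "?P E" "\<And>E'. ?P E' \<Longrightarrow> card E' \<le> card E"
    using ex_has_greatest_nat[of ?P L card "Suc d"] by (auto simp: less_Suc_eq_le)
  have nE: "nsub E" using E(1) by blast
  have "E \<subset> P" using E(1) d_less nsub_subset[OF nE] by auto
  then obtain M where M: "chief M E" using exists_chief[OF nE nsub_P] by blast
  note M' = chiefD[OF M]
  have lt: "card E < card M" using nsub_psubset_card[OF M'(1,3)] .
  have Md: "d < card M" using E(2)[of M] M'(1,3) E(1) lt by force
  have Ed: "card E = d"
  proof (rule ccontr)
    assume "card E \<noteq> d"
    then have Ed: "card E < d" using E(1) by simp
    then have "p * card E \<le> d"
      using p_power_less(1)[OF subgroup_p_card[OF nsub_subgroup[OF nE] nsub_subset[OF nE]] d_power] by blast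
    then have "bad M E" using chief_good_card[OF M] Md by fastforce
    then show False using no_bad_across Ed Md by blast
  qed
  then have "\<not> bad M E" using no_bad_above LK E(1) by blast
  then have "card M = p * d" using chief_good_card[OF M] Ed by simp
  then show ?thesis using M E(1) Ed by blast
qed

definition maximal_bad :: "'a set \<Rightarrow> 'a set \<Rightarrow> bool"
  where "maximal_bad L K \<longleftrightarrow> bad L K \<and> card L \<le> d \<and>
    (\<forall>L' K'. bad L' K' \<longrightarrow> card L' \<le> d \<longrightarrow> card L' \<le> card L)"

lemma maximal_badD:
  assumes "maximal_bad L K"
  shows "bad L K" "card L \<le> d" "bad L' K' \<Longrightarrow> card L' \<le> d \<Longrightarrow> card L' \<le> card L"
  using assms unfolding maximal_bad_def by blast+

text \<open>A bad \<open>F/V\<close> above \<open>L\<close> has \<open>card F > d\<close> by the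
  choice of \<open>L\<close>, so \<open>F = M\<close>, as subgroups properly inside \<open>M\<close>
  have order at most \<open>d\<close>. Noncyclicity then makes \<open>card V < d\<close>, and
  \<open>no_bad_across\<close> applies.\<close>

lemma good_above_maximal:
  assumes max: "maximal_bad L K"
    and M: "nsub M" "card M = p * d" and F: "chief F V" "L \<subseteq> V" "F \<subseteq> M"
  shows "\<not> bad F V"
proof
  assume bad: "bad F V"
  note F' = chiefD[OF F(1)]
  have "card L < card F" using nsub_psubset_card[OF F'(1)] F(2) F'(3) by blast
  then have Fd: "d < card F" using maximal_badD(3)[OF max bad] by force
  have "F = M"
  proof (rule ccontr)
    assume "F \<noteq> M"
    then have "p * card F \<le> p * d"
      using psubset_p_card[OF nsub_subgroup[OF F'(1)] nsub_subgroup[OF M(1)] _ nsub_subset[OF M(1)]] F(3) M(2) by auto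
    then show False using Fd p_gt_1 by simp
  qed
  then have "card V < d" using bad_card(2)[OF bad] M(2) p_gt_1 by simp
  then show False using no_bad_across[OF bad _ Fd] by blast
qed

text \<open>A largest normal \<open>V\<close> with both properties is extended through a chief
  factor \<open>F/V\<close>, which is cyclic by \<open>good_above_maximal\<close>, with generator
  \<open>x\<close>. The \<open>p\<close>-th powers of \<open>F\<close>, and the commutators of
  \<open>x\<close> with \<open>M\<close>, lead to normal subgroups between \<open>K\<close> and
  \<open>V\<close>; each is \<open>K\<close> or contains \<open>L\<close>. The second case fails by
  order for powers, and by a bad factor above \<open>L\<close> for commutators.\<close>

lemma elementary_section:
  assumes max: "maximal_bad L K"
    and M: "nsub M" "card M = p * d" and LM: "L \<subseteq> M"
  shows "(\<forall>x\<in>M. \<forall>g\<in>M. g \<otimes> x \<otimes> inv g \<otimes> inv x \<in> K) \<and> (\<forall>x\<in>M. x [^] p \<in> K)"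
proof -
  note LK = maximal_badD(1)[OF max]
  note L = chiefD[OF badD(1)[OF LK]]
  interpret K: normal K G by (rule nsub_normal[OF L(2)])
  have MP: "M \<subseteq> P" using nsub_subset[OF M(1)] .
  have KL: "K \<subseteq> L" using L(3) by blast
  let ?P = "\<lambda>V. nsub V \<and> L \<subseteq> V \<and> V \<subseteq> M \<and> (\<forall>x\<in>V. \<forall>g\<in>M. g \<otimes> x \<otimes> inv g \<otimes> inv x \<in> K) \<and> (\<forall>x\<in>V. x [^] p \<in> K)"
  have "?P L" using L(1) LM MP chief_central[OF badD(1)[OF LK]] chief_pow[OF badD(1)[OF LK]] by blast
  moreover have "\<forall>V. ?P V \<longrightarrow> card V < Suc (card M)"
    using nsub_subset_card[OF M(1)] le_imp_less_Suc by blast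
  ultimately obtain V where V: "?P V" "\<And>V'. ?P V' \<Longrightarrow> card V' \<le> card V"
    using ex_has_greatest_nat[of ?P L card "Suc (card M)"] by blast
  have nV: "nsub V" and LV: "L \<subseteq> V" and VM: "V \<subseteq> M" using V(1) by auto
  have KV: "K \<subseteq> V" using KL LV by blast
  have "V = M"
  proof (rule ccontr)
    assume neq: "V \<noteq> M"
    have VG: "subgroup V G" using nsub_subgroup[OF nV] .
    have Vd: "card V \<le> d"
      using psubset_p_card[OF VG nsub_subgroup[OF M(1)] _ MP] VM neq M(2) p_gt_1 by auto
    \<comment> \<open>Otherwise \<open>LR/R\<close> would be a bad chief factor with \<open>|L| < |LR| \<le> d\<close>.\<close>
    have inside: "L \<subseteq> R \<or> R \<subseteq> K"
      if R: "nsub R" "K \<subseteq> R" "R \<subseteq> V" for R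
    proof (rule disjCI)
      assume "\<not> R \<subseteq> K"
      have "R \<inter> L = K \<or> R \<inter> L = L" using L(4)[OF nsub_Int[OF R(1) L(1)]] R KL by blast
      moreover have "R \<inter> L \<noteq> K"
      proof
        assume RL: "R \<inter> L = K"
        note bad = bad_mult[OF LK R(1) RL]
        have LR: "nsub (L <#> R)" "L \<subseteq> L <#> R" "R \<subseteq> L <#> R"
          using nsub_mult[OF L(1) R(1)] set_mult_supset[OF nsub_subgroup[OF L(1)] nsub_subgroup[OF R(1)]]
            by auto
        have "card (L <#> R) \<le> card V"
          by (rule nsub_subset_card[OF nV set_mult_subset[OF VG LV R(3)]])
        then have "card (L <#> R) \<le> card L" using maximal_badD(3)[OF max bad] Vd by simp
        then have "L = L <#> R" using card_seteq[OF finite_subgroup[OF nsub_subgroup[OF LR(1)]] LR(2)]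
          by blast
        then show False using LR(3) RL \<open>\<not> R \<subseteq> K\<close> by blast
      qed
      ultimately show "L \<subseteq> R" by blast
    qed
    obtain F where F: "chief F V" "F \<subseteq> M" using exists_chief[OF nV M(1)] VM neq by blast
    note F' = chiefD[OF F(1)]
    obtain x where x: "x \<in> F" "F \<subseteq> adjoin G V x"
      using good_above_maximal[OF max M F(1) LV F(2)] F(1) unfolding bad_def by blast
    have xc: "x \<in> carrier G" using nsub_carrier[OF F'(1) x(1)] .
    have xM: "x \<in> M" using x(1) F(2) by blast
    have powM: "x [^] (i::nat) \<in> M" for i
      by (induction i) (use xM subgroup.one_closed subgroup.m_closed nsub_subgroup[OF M(1)] in auto)
    \<comment> \<open>Modulo \<open>K\<close>, every \<open>p\<close>-th power of an element of
      \<open>F\<close> is a power of \<open>x [^] p\<close>. So \<open>?Z\<close> contains the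
      \<open>p\<close>-th powers of all conjugates of \<open>x\<close> and is normal in
      \<open>G\<close>, while its index over \<open>K\<close> is at most \<open>p\<close>, too small
      to contain \<open>L\<close>.\<close>
    let ?Z = "adjoin G K (x [^] p)"
    have xp: "x [^] p \<in> V" using chief_pow[OF F(1) x(1)] .
    have xpc: "x [^] p \<in> carrier G" using xc by simp
    note Z = adjoin_props[OF L(2) xpc]
    have ZV: "?Z \<subseteq> V" using adjoin_subset[OF VG KV xp] .
    have FZ: "f [^] p \<in> ?Z" if f: "f \<in> F" for f
    proof -
      obtain v i where vi: "v \<in> V" "f = v \<otimes> x [^] (i::nat)" using f x(2)
        by (blast elim: adjoinE)
      have c: "v \<in> carrier G" "x [^] i \<in> carrier G" using nsub_carrier[OF nV vi(1)] xc by auto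
      have "x [^] i \<otimes> v \<otimes> inv (x [^] i) \<otimes> inv v \<in> K" using V(1) vi(1) powM
        by blast
      then have "inv (x [^] i \<otimes> v \<otimes> inv (x [^] i) \<otimes> inv v) \<in> K"
        by (rule K.m_inv_closed)
      then have "v \<otimes> x [^] i \<otimes> inv v \<otimes> inv (x [^] i) \<in> K" using c
        by (simp add: word_simps)
      from pow_mult_mod[OF K.normal_axioms c this, of p]
      have 1: "f [^] p \<otimes> inv (v [^] p \<otimes> (x [^] i) [^] p) \<in> ?Z" using Z(2) vi(2) by blast
      have "((x [^] p)) [^] i \<in> ?Z"
        by (induction i) (use Z(3) subgroup.one_closed[OF Z(1)] subgroup.m_closed[OF Z(1)] in auto)
      then have "(x [^] i) [^] p \<in> ?Z" using xc by (simp add: nat_pow_pow mult.commute)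
      moreover have "v [^] p \<in> ?Z" using V(1) vi(1) Z(2) by blast
      ultimately have "f [^] p \<otimes> inv (v [^] p \<otimes> (x [^] i) [^] p) \<otimes> (v [^] p \<otimes> (x [^] i) [^] p) \<in> ?Z"
        using 1 subgroup.m_closed[OF Z(1)] by blast
      moreover have "f [^] p \<otimes> inv (v [^] p \<otimes> (x [^] i) [^] p) \<otimes> (v [^] p \<otimes> (x [^] i) [^] p) = f [^] p"
        using vi(2) c by (simp add: word_simps)
      ultimately show ?thesis by (simp only:)
    qed
    have "s \<otimes> y \<otimes> inv s \<in> ?Z" if s: "s \<in> carrier G" "y \<in> ?Z" for s y
    proof (rule adjoin_conj_closed[OF Z(1) K.subset xpc s(1) _ _ s(2)])
      show "s \<otimes> c \<otimes> inv s \<in> ?Z" if "c \<in> K" for c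
        using nsub_conj[OF L(2) s(1) that] Z(2) by blast
      show "s \<otimes> x [^] p \<otimes> inv s \<in> ?Z"
        unfolding conj_nat_pow[OF s(1) xc] by (rule FZ[OF nsub_conj[OF F'(1) s(1) x(1)]])
    qed
    then have nZ: "nsub ?Z"
      using normal_invI[OF Z(1)] ZV nsub_subset[OF nV] by (simp add: nsub_def)
    have "x [^] p \<in> K"
    proof (rule ccontr)
      assume xK: "x [^] p \<notin> K"
      have "(x [^] p) [^] p \<in> K" using V(1) xp by blast
      then have "card ?Z = p * card K"
        by (intro card_adjoin[OF K.subgroup_axioms nsub_subset[OF L(2)] _ xK _ nsub_conj[OF L(2) xpc]])
          (use xp nsub_subset[OF nV] in auto)
      moreover have "L \<subseteq> ?Z" using inside[OF nZ Z(2) ZV] Z(3) xK by blast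
      ultimately have "card L \<le> p * card K" using nsub_subset_card[OF nZ] by fastforce
      then show False using bad_card(2)[OF LK] by simp
    qed
    then have "?Z \<subseteq> K" using adjoin_subset[OF K.subgroup_axioms subset_refl] by blast
    then have F_pow: "\<forall>f\<in>F. f [^] p \<in> K" using FZ by blast
    let ?\<phi> = "\<lambda>g. g \<otimes> x \<otimes> inv g \<otimes> inv x"
    interpret T: twisted_hom G p P M K ?\<phi>
      by (rule twisted_hom_commutator[OF M(1) L(2) F(1) x F(2)]) (use V(1) in blast)
    have \<phi>V: "?\<phi> g \<in> V" if "g \<in> M" for g
      using chief_central[OF F(1) x(1)] that MP by blast
    have "?\<phi> g \<in> K" if g: "g \<in> M" for g
    proof (rule ccontr)
      assume gK: "?\<phi> g \<notin> K"
      have R: "nsub (T.img M)" by (rule T.nsub_img[OF M(1) subset_refl])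
      have KR: "K \<subseteq> T.img M" by (rule T.K0_img[OF nsub_subgroup[OF M(1)] subset_refl])
      have RV: "T.img M \<subseteq> V"
        by (rule T.img_subset[OF _ VG KV]) (use \<phi>V in \<open>auto simp: T.pre_def\<close>)
      have "\<not> T.img M \<subseteq> K" using T.phi_img[OF g subset_refl] gK by blast
      then have LR: "L \<subseteq> T.img M" using inside[OF R KR RV] by blast
      \<comment> \<open>The pulled back factor has a bottom containing \<open>L\<close>, because
        \<open>L \<subseteq> V\<close> commutes with \<open>x\<close> modulo \<open>K\<close>;
        \<open>good_above_maximal\<close> forbids this.\<close>
      note bad = T.bad_pre[OF LK LR subset_refl]
      have "L \<subseteq> T.pre K"
      proof
        fix l assume l: "l \<in> L"
        have lc: "l \<in> carrier G" using nsub_carrier[OF L(1) l] .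
        have "x \<otimes> l \<otimes> inv x \<otimes> inv l \<in> K" using V(1) l LV xM by blast
        then have "inv (x \<otimes> l \<otimes> inv x \<otimes> inv l) \<in> K" by (rule K.m_inv_closed)
        then have "?\<phi> l \<in> K" using lc xc by (simp add: word_simps)
        then show "l \<in> T.pre K" using l LM unfolding T.pre_def by blast
      qed
      then show False
        using good_above_maximal[OF max M badD(1)[OF bad]] bad unfolding T.pre_def by blast
    qed
    then have xC: "x \<in> {y \<in> F. \<forall>g\<in>M. g \<otimes> y \<otimes> inv g \<otimes> inv y \<in> K}" (is "x \<in> ?C") using x(1) by blast
    have C: "nsub ?C" by (rule nsub_centralizer_mod[OF F'(1) M(1) L(2)])
    have "V \<subseteq> ?C" using V(1) F'(3) by blast
    then have "F \<subseteq> ?C" using x(2) adjoin_subset[OF nsub_subgroup[OF C] _ xC] by blast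
    then have "?P F" using F'(1) F(2) F'(3) LV F_pow by blast
    then have "card F \<le> card V" by (rule V(2))
    then show False using nsub_psubset_card[OF F'(1,3)] by simp
  qed
  then show ?thesis using V(1) by blast
qed

text \<open>\<open>A\<close> is an \<open>S\<close>-invariant subgroup of index \<open>p\<close> in
  \<open>L\<close>, different from \<open>K\<close> as \<open>L/K\<close> is noncyclic. A largest
  \<open>H\<close> in \<open>M\<close> with \<open>H \<inter> L = A\<close> is a complement of
  \<open>L\<close> over \<open>A\<close>, because \<open>M/K\<close> is elementary abelian. So it
  has index \<open>p\<close> in \<open>M\<close>, and \<open>card M = p * d\<close> gives it order
  \<open>d\<close>.\<close>

lemma no_maximal_bad:
  assumes max: "maximal_bad L K"
  shows False
proof -
  note LK = maximal_badD(1)[OF max] and Ld = maximal_badD(2)[OF max]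
  note L = chiefD[OF badD(1)[OF LK]]
  have LG: "subgroup L G" and LP: "L \<subseteq> P" using nsub_subgroup[OF L(1)] nsub_subset[OF L(1)] .
  obtain M E where ME: "chief M E" "L \<subseteq> E" "card M = p * d" using exists_cyclic_step[OF LK Ld]
    by blast
  have nM: "nsub M" and LM: "L \<subseteq> M" using chiefD[OF ME(1)] ME(2) by auto
  have MP: "M \<subseteq> P" using nsub_subset[OF nM] .
  interpret M: normal M G by (rule nsub_normal[OF nM])
  have M_comm: "g \<otimes> x \<otimes> inv g \<otimes> inv x \<in> K" if "x \<in> M" "g \<in> M" for x g
    using elementary_section[OF max nM ME(3) LM] that by blast
  have M_pow: "x [^] p \<in> K" if "x \<in> M" for x
    using elementary_section[OF max nM ME(3) LM] that by blast
  obtain k where k: "card L = p ^ k" using subgroup_p_card[OF LG LP] by blast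
  have KG: "subgroup K G" using nsub_subgroup[OF L(2)] .
  obtain i where i: "card K = p ^ i" using subgroup_p_card[OF KG nsub_subset[OF L(2)]] by blast
  have "p ^ Suc i < p ^ k" using bad_card(2)[OF LK] k i by simp
  then have ik: "Suc i < k" using p_gt_1 power_strict_increasing_iff by blast
  then obtain k' where k': "k = Suc k'" by (cases k) auto
  have "card K \<le> p ^ k'" "p ^ k' \<le> card L" using i k k' ik p_gt_1 by (auto simp: power_increasing)
  then obtain A where A: "subgroup A G" "K \<subseteq> A" "A \<subseteq> L" "S_inv A" "card A = p ^ k'"
    using S_inv_between[OF badD(1)[OF LK]] by blast
  have cardL: "card L = p * card A" using A(5) k k' by simp
  have AK: "A \<noteq> K" using cardL bad_card(1)[OF LK] by blast
  have "p ^ k' < card L" using k k' p_gt_1 by simp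
  then have AL: "A \<noteq> L" using A(5) by auto
  let ?P = "\<lambda>H. subgroup H G \<and> A \<subseteq> H \<and> H \<subseteq> M \<and> H \<inter> L = A"
  have "?P A" using A LM by blast
  moreover have "\<forall>H. ?P H \<longrightarrow> card H < Suc (card M)"
    using nsub_subset_card[OF nM] le_imp_less_Suc by blast
  ultimately obtain H where H: "?P H" "\<And>H'. ?P H' \<Longrightarrow> card H' \<le> card H"
    using ex_has_greatest_nat[of ?P A card "Suc (card M)"] by blast
  have HG: "subgroup H G" and AH: "A \<subseteq> H" and HM: "H \<subseteq> M" and HL: "H \<inter> L = A"
    using H(1) by auto
  interpret H: subgroup H G by (rule HG)
  have KH: "K \<subseteq> H" using A(2) AH by blast
  have norm: "g \<otimes> h \<otimes> inv g \<in> H" if g: "g \<in> M" and h: "h \<in> H" for g h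
  proof -
    have "g \<otimes> h \<otimes> inv g \<otimes> inv h \<in> H" using M_comm[OF _ g] h HM KH by blast
    then have "g \<otimes> h \<otimes> inv g \<otimes> inv h \<otimes> h \<in> H" using h by blast
    then show ?thesis using g h by (simp add: m_assoc)
  qed
  let ?N = "H <#> L"
  have NG: "subgroup ?N G"
    using mult_norm_subgroup[OF nsub_normal[OF L(1)] HG] commut_normal[OF HG nsub_normal[OF L(1)]] by simp
  interpret N: subgroup ?N G by (rule NG)
  note sup = set_mult_supset[OF HG LG]
  \<comment> \<open>Adjoining a \<open>y\<close> outside \<open>?N\<close> would not enlarge the
    intersection with \<open>L\<close>: if \<open>h \<otimes> y [^] j\<close> lies in
    \<open>L\<close> with \<open>j\<close> prime to \<open>p\<close>, then \<open>y\<close> lies in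
    \<open>?N\<close>, since \<open>y [^] p \<in> K\<close> and \<open>j\<close> is invertible
    modulo \<open>p\<close>.\<close>
  have MN: "M \<subseteq> ?N"
  proof
    fix y assume y: "y \<in> M"
    show "y \<in> ?N"
    proof (rule ccontr)
      assume yN: "y \<notin> ?N"
      have yc: "y \<in> carrier G" using y by simp
      have D: "subgroup (adjoin G H y) G" by (rule subgroup_adjoin[OF fin HG yc norm[OF y]])
      have HD: "H \<subseteq> adjoin G H y" "y \<in> adjoin G H y"
        using base_subset_adjoin[OF HG yc] mem_adjoin[OF HG yc] .
      have yp: "y [^] p \<in> K" using M_pow[OF y] .
      have ypj: "(y [^] p) [^] (j::nat) \<in> K" for j
        by (induction j) (use yp subgroup.one_closed[OF KG] subgroup.m_closed[OF KG] in auto)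
      have "adjoin G H y \<inter> L \<subseteq> H"
      proof
        fix u assume u: "u \<in> adjoin G H y \<inter> L"
        then obtain h j where hj: "h \<in> H" "u = h \<otimes> y [^] (j::nat)" by (blast elim: adjoinE)
        show "u \<in> H"
        proof (cases "p dvd j")
          case True
          then obtain e where "j = p * e" by blast
          then have "y [^] j = (y [^] p) [^] e" using yc by (simp add: nat_pow_pow)
          then show ?thesis using hj ypj KH by auto
        next
          case False
          then obtain a b where ab: "j * a = Suc (p * b)" using bezout_prime[OF prime_p False] by blast
          have "y [^] j = inv h \<otimes> u" using hj yc by (simp add: inv_cancel)
          moreover have "inv h \<otimes> u \<in> ?N" using hj(1) u sup by blast
          ultimately have yj: "y [^] j \<in> ?N" by (simp only:)
          have "(y [^] j) [^] a \<in> ?N" by (induction a) (use yj in auto)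
          moreover have "(y [^] j) [^] a = (y [^] p) [^] b \<otimes> y" using yc ab
            by (simp add: nat_pow_pow)
          ultimately have "(y [^] p) [^] b \<otimes> y \<in> ?N" by (simp only:)
          moreover have "inv ((y [^] p) [^] b) \<in> ?N" using ypj KH sup(1) by blast
          ultimately have "inv ((y [^] p) [^] b) \<otimes> ((y [^] p) [^] b \<otimes> y) \<in> ?N" by blast
          then show ?thesis using yN yc by (simp add: inv_cancel)
        qed
      qed
      then have "adjoin G H y \<inter> L = A" using HL HD by blast
      then have "?P (adjoin G H y)" using D HD AH adjoin_subset[OF M.subgroup_axioms HM y] by blast
      then have "card (adjoin G H y) \<le> card H" by (rule H(2))
      then have "H = adjoin G H y" using card_seteq[OF finite_subgroup[OF D] HD(1)] by blast
      then show False using HD(2) yN sup(1) by blast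
    qed
  qed
  obtain l where l: "l \<in> L" "l \<notin> A" "adjoin G A l \<subseteq> L" "card (adjoin G A l) = p * card A"
    using S_inv_extend[OF badD(1)[OF LK] A(1,2) _ A(4)] A(3) AL by blast
  have lc: "l \<in> carrier G" using nsub_carrier[OF L(1) l(1)] .
  have lM: "l \<in> M" using l(1) LM by blast
  have D: "subgroup (adjoin G H l) G" by (rule subgroup_adjoin[OF fin HG lc norm[OF lM]])
  have HD: "H \<subseteq> adjoin G H l" "l \<in> adjoin G H l"
    using base_subset_adjoin[OF HG lc] mem_adjoin[OF HG lc] .
  \<comment> \<open>The element \<open>l\<close> generates \<open>L\<close> over \<open>A\<close>,
    hence also \<open>M = HL\<close> over \<open>H\<close>; this transfers the index
    \<open>p\<close>.\<close>
  have "adjoin G A l = L" using card_subset_eq[OF finite_subgroup[OF LG] l(3)] l(4) cardL by simp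
  then have "L \<subseteq> adjoin G H l" using adjoin_subset[OF D _ HD(2), of A] AH HD(1) by blast
  then have "M \<subseteq> adjoin G H l" using MN set_mult_subset[OF D HD(1)] by blast
  then have "adjoin G H l = M" using adjoin_subset[OF M.subgroup_axioms HM lM] by blast
  moreover have "card (adjoin G H l) = p * card H"
    by (rule card_adjoin[OF HG _ _ _ _ norm[OF lM]]) (use HM MP lM l HL M_pow[OF lM] KH in auto)
  ultimately have "card H = d" using ME(3) p_gt_1 by simp
  then have "H \<inter> L = K \<or> H \<inter> L = L"
    using Int_bad_trivial[OF LK HG _ _ KH] HM MP HL A(4) by auto
  then show False using HL AK AL by blast
qed

text \<open>By \<open>minimal_bad_card\<close> a bad factor of least order has its top of order at
  most \<open>d\<close>, so there is a largest one under this bound.\<close>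

lemma no_bad: "\<not> bad L K"
proof
  assume "bad L K"
  define c\<^sub>0 where "c\<^sub>0 = (LEAST c. \<exists>L K. bad L K \<and> card L = c)"
  have "\<exists>L K. bad L K \<and> card L = c\<^sub>0"
    unfolding c\<^sub>0_def by (rule LeastI_ex) (use \<open>bad L K\<close> in blast)
  then obtain L' K' where L': "bad L' K'" "card L' = c\<^sub>0" by blast
  have "c\<^sub>0 \<le> card L" if "bad L K" for L K
    unfolding c\<^sub>0_def by (rule Least_le) (use that in blast)
  then have m: "minimal_bad L' K'" using L' unfolding minimal_bad_def by blast
  let ?P = "\<lambda>c. \<exists>L K. bad L K \<and> card L = c \<and> c \<le> d"
  have "?P (card L')" using minimal_badD(1)[OF m] minimal_bad_card[OF m] by blast
  then obtain c where c: "?P c" "\<And>c'. ?P c' \<Longrightarrow> c' \<le> c"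
    using ex_has_greatest_nat[of ?P "card L'" "\<lambda>c. c" "Suc d"] by (auto simp: less_Suc_eq_le)
  then obtain L K where "bad L K" "card L = c" "c \<le> d" by blast
  then have "maximal_bad L K" using c(2) unfolding maximal_bad_def by blast
  then show False by (rule no_maximal_bad)
qed

end

section \<open>Choice of a Sylow subgroup and passage to the hypercenter\<close>

theorem theorem2:
  fixes G :: "('a, 'b) monoid_scheme" and p d :: nat and P :: "'a set"
  assumes "group G" and "finite (carrier G)"
    and "Factorial_Ring.prime p"
    and "P \<lhd> G" and "\<exists>n. card P = p ^ n"
    and "\<exists>m. d = p ^ m" and "1 < d" and "d < card P"
    and "\<And>H. subgroup H G \<Longrightarrow> H \<subseteq> P \<Longrightarrow> card H = d \<Longrightarrow> IC_Pi_property G H"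
    and "p = 2 \<Longrightarrow> d = 2 \<Longrightarrow> \<not> comm_group (G\<lparr>carrier := P\<rparr>) \<Longrightarrow>
      (\<And>H. subgroup H G \<Longrightarrow> H \<subseteq> P \<Longrightarrow> cyclic_group (G\<lparr>carrier := H\<rparr>) \<Longrightarrow> card H = 4 \<Longrightarrow>
        IC_Pi_property G H)"
  shows "P \<subseteq> U_hypercenter G"
proof -
  interpret group G by fact
  have "order G \<noteq> 0" using assms(2) order_gt_0_iff_finite by simp
  then obtain m where m: "order G = p ^ multiplicity p (order G) * m" "\<not> p dvd m"
    using multiplicity_decompose'[of "order G" p] assms(3) not_prime_unit by metis
  obtain S where S: "subgroup S G" "card S = p ^ multiplicity p (order G)"
    using sylow_thm[OF assms(3) is_group m(1) assms(2)] by blast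
  interpret IC_Pi_p_subgroup G p P S m d
  proof (intro IC_Pi_p_subgroup.intro normal_p_subgroup_Sylow.intro normal_p_subgroup.intro
      IC_Pi_p_subgroup_axioms.intro normal_p_subgroup_Sylow_axioms.intro normal_p_subgroup_axioms.intro)
    show "group G" by fact
    show "finite (carrier G)" "Factorial_Ring.prime p" "P \<lhd> G" "\<exists>n. card P = p ^ n"
      "\<exists>k. d = p ^ k" "1 < d" "d < card P" "subgroup S G" "\<not> p dvd m" by fact+
    show "\<exists>a. card S = p ^ a" using S(2) by blast
    show "card (carrier G) = card S * m" using m(1) S(2) by (simp add: order_def)
    show "IC_Pi_property G H" if "subgroup H G" "H \<subseteq> P" "card H = d" for H
      using assms(9)[OF that] .
    show "IC_Pi_property G H" if "p = 2" "d = 2" "\<not> comm_group (G\<lparr>carrier := P\<rparr>)" "subgroup H G"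
      "H \<subseteq> P" "cyclic_group (G\<lparr>carrier := H\<rparr>)" "card H = 4" for H
      using assms(10)[OF that] .
  qed
  have "cyclic_group (G\<lparr>carrier := L\<rparr> Mod K)"
    if LK: "chief_factor G L K" "L \<subseteq> P" for L K
  proof -
    have ch: "chief L K" using chief_factor_imp_chief[OF LK] .
    obtain x where x: "x \<in> L" "L \<subseteq> adjoin G K x" using ch no_bad unfolding bad_def by blast
    show ?thesis by (rule cyclic_quotient[OF ch x])
  qed
  then have "P \<subseteq> \<Union>{A. A \<lhd> G \<and> (\<forall>L K. chief_factor G L K \<and> L \<subseteq> A \<longrightarrow> cyclic_group (G\<lparr>carrier := L\<rparr> Mod K))}"
    using assms(4) by blast
  then show ?thesis unfolding U_hypercenter_def by (meson generate.incl subset_iff)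
qed

end
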